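(* (Provable in $\mathsf{C}$.) $(V;\in)\models^*\mathsf{S}$.
   Context: $\mathsf{S}$ is $\mathsf{ZF}$ with the Axiom of Infinity omitted, viewed as a (coded) class of sentences in the language of set theory; $\mathsf{C}$ is Gödel–Bernays class theory $\mathsf{GB}$ (class comprehension only for formulas without bound class variables) with the Axiom of Infinity omitted. $V$ is the class of all sets. For a class $\Phi$ of formulas, a $\Phi$-satisfaction relation for a structure $\mathfrak S$ is the class of pairs $\langle\phi,A\rangle$ ($\phi$ a subformula of a member of $\Phi$, $A$ a finite function into $|\mathfrak S|$ covering the free variables of $\phi$) at which $\phi$ is true according to a valuation obeying the usual Tarskian clauses; write $\models^S\phi[A]$ for $\langle\phi,A\rangle\in S$. Universal satisfaction: $\mathfrak S\models^*\phi$ iff for every $\{\phi\}$-satisfaction relation $S$ for $\mathfrak S$, $\models^S\phi$; $\mathfrak S\models^*\Theta$ iff $\mathfrak S\models^*\theta$ for all $\theta\in\Theta$. *)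

theory Defs
  imports Main
begin

section \<open>First-order logic in the language of class theory\<close>

text \<open>
  One-sorted first-order logic with equality and one binary relation symbol; the objects are
  classes, and sets are the classes that are members of some class.  Variables are de Bruijn
  indices and are the only terms, so substitution is renaming.
\<close>

datatype fm = Bot | Mem nat nat | Eql nat nat | Imp fm fm | Forall fm

abbreviation Neg :: "fm \<Rightarrow> fm" where "Neg p \<equiv> Imp p Bot"
abbreviation Conj :: "fm \<Rightarrow> fm \<Rightarrow> fm" where "Conj p q \<equiv> Neg (Imp p (Neg q))"
abbreviation Disj :: "fm \<Rightarrow> fm \<Rightarrow> fm" where "Disj p q \<equiv> Imp (Neg p) q"
abbreviation Iff :: "fm \<Rightarrow> fm \<Rightarrow> fm" where "Iff p q \<equiv> Conj (Imp p q) (Imp q p)"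
abbreviation Exists :: "fm \<Rightarrow> fm" where "Exists p \<equiv> Neg (Forall (Neg p))"

primrec ren :: "(nat \<Rightarrow> nat) \<Rightarrow> fm \<Rightarrow> fm" where
  "ren r Bot = Bot"
| "ren r (Mem i j) = Mem (r i) (r j)"
| "ren r (Eql i j) = Eql (r i) (r j)"
| "ren r (Imp p q) = Imp (ren r p) (ren r q)"
| "ren r (Forall p) = Forall (ren (\<lambda>i. case i of 0 \<Rightarrow> 0 | Suc j \<Rightarrow> Suc (r j)) p)"

definition inst :: "nat \<Rightarrow> fm \<Rightarrow> fm" where
  "inst t p = ren (\<lambda>i. case i of 0 \<Rightarrow> t | Suc j \<Rightarrow> j) p"

text \<open>
  A Hilbert calculus.  Because of unrestricted generalization, a non-logical axiom with free
  variables stands for its universal closure.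
\<close>

inductive provable :: "fm set \<Rightarrow> fm \<Rightarrow> bool" (infix \<open>\<turnstile>\<close> 50) for T where
  Axiom: "p \<in> T \<Longrightarrow> T \<turnstile> p"
| K: "T \<turnstile> Imp p (Imp q p)"
| S: "T \<turnstile> Imp (Imp p (Imp q r)) (Imp (Imp p q) (Imp p r))"
| DNeg: "T \<turnstile> Imp (Neg (Neg p)) p"
| Spec: "T \<turnstile> Imp (Forall p) (inst t p)"
| Distrib: "T \<turnstile> Imp (Forall (Imp (ren Suc p) q)) (Imp p (Forall q))"
| Refl: "T \<turnstile> Eql t t"
| Leibniz: "T \<turnstile> Imp (Eql s t) (Imp (inst s p) (inst t p))"
| MP: "T \<turnstile> Imp p q \<Longrightarrow> T \<turnstile> p \<Longrightarrow> T \<turnstile> q"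
| Gen: "T \<turnstile> p \<Longrightarrow> T \<turnstile> Forall p"

section \<open>Formulas with de Bruijn levels\<close>

text \<open>
  To write concrete formulas legibly, variables are referred to by de Bruijn level (the number of
  binders enclosing the variable's own binder).  A level, unlike an index, does not change under
  further binders, so bound variables can be represented by variables of the metalanguage.
  A \<open>form\<close> is a formula as a function of the number \<open>n\<close> of enclosing binders;
  level \<open>v < n\<close> is index \<open>n - Suc v\<close>.
\<close>

type_synonym var = nat
type_synonym form = "nat \<Rightarrow> fm"

definition sentence :: "form \<Rightarrow> fm" where "sentence P = P 0"

definition mem\<^sub>f :: "var \<Rightarrow> var \<Rightarrow> form" (infix \<open>\<^bold>\<in>\<close> 50) where
  "(x \<^bold>\<in> y) = (\<lambda>n. Mem (n - Suc x) (n - Suc y))"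

definition eq\<^sub>f :: "var \<Rightarrow> var \<Rightarrow> form" (infix \<open>\<^bold>=\<close> 50) where
  "(x \<^bold>= y) = (\<lambda>n. Eql (n - Suc x) (n - Suc y))"

definition true\<^sub>f :: form (\<open>\<^bold>\<top>\<close>) where
  "\<^bold>\<top> = (\<lambda>n. Neg Bot)"

definition neg\<^sub>f :: "form \<Rightarrow> form" (\<open>\<^bold>\<not> _\<close> [40] 40) where
  "(\<^bold>\<not> P) = (\<lambda>n. Neg (P n))"

definition conj\<^sub>f :: "form \<Rightarrow> form \<Rightarrow> form" (infixr \<open>\<^bold>\<and>\<close> 35) where
  "(P \<^bold>\<and> Q) = (\<lambda>n. Conj (P n) (Q n))"

definition disj\<^sub>f :: "form \<Rightarrow> form \<Rightarrow> form" (infixr \<open>\<^bold>\<or>\<close> 30) where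
  "(P \<^bold>\<or> Q) = (\<lambda>n. Disj (P n) (Q n))"

definition imp\<^sub>f :: "form \<Rightarrow> form \<Rightarrow> form" (infixr \<open>\<^bold>\<longrightarrow>\<close> 25) where
  "(P \<^bold>\<longrightarrow> Q) = (\<lambda>n. Imp (P n) (Q n))"

definition iff\<^sub>f :: "form \<Rightarrow> form \<Rightarrow> form" (infixr \<open>\<^bold>\<longleftrightarrow>\<close> 25) where
  "(P \<^bold>\<longleftrightarrow> Q) = (\<lambda>n. Iff (P n) (Q n))"

text \<open>\<open>\<^bold>\<forall>\<^sub>C\<close>, \<open>\<^bold>\<exists>\<^sub>C\<close> quantify over classes; \<open>\<^bold>\<forall>\<close>, \<open>\<^bold>\<exists>\<close> over sets.\<close>

definition allC :: "(var \<Rightarrow> form) \<Rightarrow> form" (binder \<open>\<^bold>\<forall>\<^sub>C\<close> 10) where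
  "allC P = (\<lambda>n. Forall (P n (Suc n)))"

definition exC :: "(var \<Rightarrow> form) \<Rightarrow> form" (binder \<open>\<^bold>\<exists>\<^sub>C\<close> 10) where
  "exC P = (\<lambda>n. Exists (P n (Suc n)))"

abbreviation IsSet :: "nat \<Rightarrow> fm" where
  "IsSet i \<equiv> Exists (Mem (Suc i) 0)"

definition allS :: "(var \<Rightarrow> form) \<Rightarrow> form" (binder \<open>\<^bold>\<forall>\<close> 10) where
  "allS P = (\<lambda>n. Forall (Imp (IsSet 0) (P n (Suc n))))"

definition exS :: "(var \<Rightarrow> form) \<Rightarrow> form" (binder \<open>\<^bold>\<exists>\<close> 10) where
  "exS P = (\<lambda>n. Neg (Forall (Imp (IsSet 0) (Neg (P n (Suc n))))))"

section \<open>Set-theoretic vocabulary\<close>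

definition isEmpty :: "var \<Rightarrow> form" where
  "isEmpty x = (\<^bold>\<forall>z. \<^bold>\<not> z \<^bold>\<in> x)"

definition subset\<^sub>f :: "var \<Rightarrow> var \<Rightarrow> form" (infix \<open>\<^bold>\<subseteq>\<close> 50) where
  "(x \<^bold>\<subseteq> y) = (\<^bold>\<forall>z. z \<^bold>\<in> x \<^bold>\<longrightarrow> z \<^bold>\<in> y)"

definition isUPair :: "var \<Rightarrow> var \<Rightarrow> var \<Rightarrow> form" where
  "isUPair p x y = (\<^bold>\<forall>z. z \<^bold>\<in> p \<^bold>\<longleftrightarrow> z \<^bold>= x \<^bold>\<or> z \<^bold>= y)"

definition isPair :: "var \<Rightarrow> var \<Rightarrow> var \<Rightarrow> form" where
  "isPair p x y = (\<^bold>\<exists>a b. isUPair a x x \<^bold>\<and> isUPair b x y \<^bold>\<and> isUPair p a b)"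

definition maps :: "var \<Rightarrow> var \<Rightarrow> var \<Rightarrow> form" where
  "maps f x y = (\<^bold>\<exists>p. isPair p x y \<^bold>\<and> p \<^bold>\<in> f)"

definition isFun :: "var \<Rightarrow> form" where
  "isFun f =
    ((\<^bold>\<forall>p. p \<^bold>\<in> f \<^bold>\<longrightarrow> (\<^bold>\<exists>x y. isPair p x y)) \<^bold>\<and>
     (\<^bold>\<forall>x y z. maps f x y \<^bold>\<and> maps f x z \<^bold>\<longrightarrow> y \<^bold>= z))"

definition isSucc :: "var \<Rightarrow> var \<Rightarrow> form" where
  "isSucc y x = (\<^bold>\<forall>z. z \<^bold>\<in> y \<^bold>\<longleftrightarrow> z \<^bold>\<in> x \<^bold>\<or> z \<^bold>= x)"

definition isTransitive :: "var \<Rightarrow> form" where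
  "isTransitive x = (\<^bold>\<forall>y. y \<^bold>\<in> x \<^bold>\<longrightarrow> y \<^bold>\<subseteq> x)"

text \<open>
  In the presence of Foundation the ordinals are the transitive sets of transitive sets; the
  natural numbers are the ordinals such that they and all their elements are \<open>0\<close> or successors.
  No infinite set is presupposed.
\<close>

definition isNat :: "var \<Rightarrow> form" where
  "isNat x =
    (isTransitive x \<^bold>\<and> (\<^bold>\<forall>y. y \<^bold>\<in> x \<^bold>\<longrightarrow> isTransitive y) \<^bold>\<and>
     (\<^bold>\<forall>y. y \<^bold>\<in> x \<^bold>\<or> y \<^bold>= x \<^bold>\<longrightarrow> isEmpty y \<^bold>\<or> (\<^bold>\<exists>z. isSucc y z)))"

primrec isNumeral :: "nat \<Rightarrow> var \<Rightarrow> form" where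
  "isNumeral 0 x = isEmpty x"
| "isNumeral (Suc k) x = (\<^bold>\<exists>y. isNumeral k y \<^bold>\<and> isSucc x y)"

definition isFinite :: "var \<Rightarrow> form" where
  "isFinite x =
    (\<^bold>\<exists>n f. isNat n \<^bold>\<and> isFun f \<^bold>\<and>
      (\<^bold>\<forall>i. i \<^bold>\<in> n \<^bold>\<longleftrightarrow> (\<^bold>\<exists>y. maps f i y)) \<^bold>\<and>
      (\<^bold>\<forall>y. y \<^bold>\<in> x \<^bold>\<longleftrightarrow> (\<^bold>\<exists>i. maps f i y)) \<^bold>\<and>
      (\<^bold>\<forall>i j y. maps f i y \<^bold>\<and> maps f j y \<^bold>\<longrightarrow> i \<^bold>= j))"

text \<open>\<open>f\<close> is a finite sequence with domain \<open>{0, \<dots>, n}\<close>.\<close>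

definition isSeq :: "var \<Rightarrow> var \<Rightarrow> form" where
  "isSeq f n =
    (isNat n \<^bold>\<and> isFun f \<^bold>\<and> (\<^bold>\<forall>i. (\<^bold>\<exists>y. maps f i y) \<^bold>\<longleftrightarrow> i \<^bold>\<in> n \<^bold>\<or> i \<^bold>= n))"

text \<open>A finite sequence of \<open>R\<close>-steps leads from \<open>x\<close> to \<open>y\<close> (possibly \<open>x = y\<close>).\<close>

definition chain :: "(var \<Rightarrow> var \<Rightarrow> form) \<Rightarrow> var \<Rightarrow> var \<Rightarrow> form" where
  "chain R x y =
    (\<^bold>\<exists>f n. isSeq f n \<^bold>\<and> (\<^bold>\<exists>z. isEmpty z \<^bold>\<and> maps f z x) \<^bold>\<and> maps f n y \<^bold>\<and>
      (\<^bold>\<forall>i j a b. i \<^bold>\<in> n \<^bold>\<and> isSucc j i \<^bold>\<and> maps f i a \<^bold>\<and> maps f j b \<^bold>\<longrightarrow> R a b))"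

section \<open>The class theory C: GB without Infinity\<close>

text \<open>Formulas without bound class variables; free class variables are allowed.\<close>

inductive predicative :: "fm \<Rightarrow> bool" where
  "predicative Bot"
| "predicative (Mem i j)"
| "predicative (Eql i j)"
| "predicative p \<Longrightarrow> predicative q \<Longrightarrow> predicative (Imp p q)"
| "predicative p \<Longrightarrow> predicative (Forall (Imp (IsSet 0) p))"

text \<open>
  \<open>\<exists>Z. \<forall>x. x \<in> Z \<longleftrightarrow> x is a set \<and> p(x, \<dots>)\<close>, where index \<open>0\<close> of \<open>p\<close> is \<open>x\<close> and the other
  indices are parameters, which have to skip \<open>Z\<close>.
\<close>

definition comprehension :: "fm \<Rightarrow> fm" where
  "comprehension p =
    Exists (Forall (Iff (Mem 0 1)
                 (Conj (IsSet 0) (ren (\<lambda>i. case i of 0 \<Rightarrow> 0 | Suc j \<Rightarrow> Suc (Suc j)) p))))"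

text \<open>
  Infinity usually provides the existence of a set; in its absence this is the empty set axiom.
  Foundation is the axiom for sets, which is implied by the one for classes.
\<close>

definition Th_C :: "fm set" where
  "Th_C = sentence ` {
      (\<^bold>\<forall>\<^sub>C X Y. (\<^bold>\<forall>z. z \<^bold>\<in> X \<^bold>\<longleftrightarrow> z \<^bold>\<in> Y) \<^bold>\<longrightarrow> X \<^bold>= Y),
      (\<^bold>\<exists>x. isEmpty x),
      (\<^bold>\<forall>x y. \<^bold>\<exists>z. isUPair z x y),
      (\<^bold>\<forall>x. \<^bold>\<exists>y. \<^bold>\<forall>z. z \<^bold>\<in> y \<^bold>\<longleftrightarrow> (\<^bold>\<exists>w. w \<^bold>\<in> x \<^bold>\<and> z \<^bold>\<in> w)),
      (\<^bold>\<forall>x. \<^bold>\<exists>y. \<^bold>\<forall>z. z \<^bold>\<in> y \<^bold>\<longleftrightarrow> z \<^bold>\<subseteq> x),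
      (\<^bold>\<forall>x. \<^bold>\<not> isEmpty x \<^bold>\<longrightarrow> (\<^bold>\<exists>y. y \<^bold>\<in> x \<^bold>\<and> (\<^bold>\<forall>z. z \<^bold>\<in> x \<^bold>\<longrightarrow> \<^bold>\<not> z \<^bold>\<in> y))),
      (\<^bold>\<forall>\<^sub>C F. isFun F \<^bold>\<longrightarrow>
        (\<^bold>\<forall>x. \<^bold>\<exists>y. \<^bold>\<forall>z. z \<^bold>\<in> y \<^bold>\<longleftrightarrow> (\<^bold>\<exists>w. w \<^bold>\<in> x \<^bold>\<and> maps F w z)))}
    \<union> comprehension ` {p. predicative p}"

section \<open>Coded formulas of the language of set theory\<close>

text \<open>
  From here on everything happens inside C.  The variable \<open>v\<^sub>n\<close> is the natural number \<open>n\<close>.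
  The codes of \<open>v\<^sub>i \<in> v\<^sub>j\<close>, \<open>v\<^sub>i = v\<^sub>j\<close>, \<open>\<not> a\<close>, \<open>a \<longrightarrow> b\<close>, \<open>\<forall>v\<^sub>i. a\<close> are
  \<open>(0, i, j)\<close>, \<open>(1, i, j)\<close>, \<open>(2, a)\<close>, \<open>(3, a, b)\<close>, \<open>(4, i, a)\<close>.
\<close>

definition isTagged :: "nat \<Rightarrow> var \<Rightarrow> var \<Rightarrow> form" where
  "isTagged k c x = (\<^bold>\<exists>t. isNumeral k t \<^bold>\<and> isPair c t x)"

definition isMemCode :: "var \<Rightarrow> var \<Rightarrow> var \<Rightarrow> form" where
  "isMemCode c i j = (\<^bold>\<exists>p. isPair p i j \<^bold>\<and> isTagged 0 c p)"

definition isEqCode :: "var \<Rightarrow> var \<Rightarrow> var \<Rightarrow> form" where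
  "isEqCode c i j = (\<^bold>\<exists>p. isPair p i j \<^bold>\<and> isTagged 1 c p)"

definition isNegCode :: "var \<Rightarrow> var \<Rightarrow> form" where
  "isNegCode c a = isTagged 2 c a"

definition isImpCode :: "var \<Rightarrow> var \<Rightarrow> var \<Rightarrow> form" where
  "isImpCode c a b = (\<^bold>\<exists>p. isPair p a b \<^bold>\<and> isTagged 3 c p)"

definition isAllCode :: "var \<Rightarrow> var \<Rightarrow> var \<Rightarrow> form" where
  "isAllCode c i a = (\<^bold>\<exists>p. isPair p i a \<^bold>\<and> isTagged 4 c p)"

text \<open>\<open>c\<close> is a formula: the last entry of a finite construction sequence.\<close>

definition isFormula :: "var \<Rightarrow> form" where
  "isFormula c =
    (\<^bold>\<exists>f n. isSeq f n \<^bold>\<and> maps f n c \<^bold>\<and>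
      (\<^bold>\<forall>i d. maps f i d \<^bold>\<longrightarrow>
         (\<^bold>\<exists>u v. isNat u \<^bold>\<and> isNat v \<^bold>\<and> (isMemCode d u v \<^bold>\<or> isEqCode d u v)) \<^bold>\<or>
         (\<^bold>\<exists>j a. j \<^bold>\<in> i \<^bold>\<and> maps f j a \<^bold>\<and> isNegCode d a) \<^bold>\<or>
         (\<^bold>\<exists>j k a b. j \<^bold>\<in> i \<^bold>\<and> k \<^bold>\<in> i \<^bold>\<and> maps f j a \<^bold>\<and> maps f k b \<^bold>\<and> isImpCode d a b) \<^bold>\<or>
         (\<^bold>\<exists>u j a. isNat u \<^bold>\<and> j \<^bold>\<in> i \<^bold>\<and> maps f j a \<^bold>\<and> isAllCode d u a)))"

definition isImmediateSubformula :: "var \<Rightarrow> var \<Rightarrow> form" where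
  "isImmediateSubformula a c =
    (isNegCode c a \<^bold>\<or>
     (\<^bold>\<exists>b. isImpCode c a b \<^bold>\<or> isImpCode c b a) \<^bold>\<or>
     (\<^bold>\<exists>u. isNat u \<^bold>\<and> isAllCode c u a))"

definition isSubformula :: "var \<Rightarrow> var \<Rightarrow> form" where
  "isSubformula = chain isImmediateSubformula"

text \<open>
  \<open>v\<close> is free in \<open>c\<close> if it occurs in an atomic subformula from which one can ascend to \<open>c\<close>
  without passing through a quantification over \<open>v\<close>.
\<close>

definition isFreeIn :: "var \<Rightarrow> var \<Rightarrow> form" where
  "isFreeIn v c =
    (isNat v \<^bold>\<and>
     (\<^bold>\<exists>a. (\<^bold>\<exists>u. isNat u \<^bold>\<and>
             (isMemCode a u v \<^bold>\<or> isMemCode a v u \<^bold>\<or> isEqCode a u v \<^bold>\<or> isEqCode a v u)) \<^bold>\<and>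
          chain (\<lambda>d e. isNegCode e d \<^bold>\<or>
                       (\<^bold>\<exists>b. isImpCode e d b \<^bold>\<or> isImpCode e b d) \<^bold>\<or>
                       (\<^bold>\<exists>u. isNat u \<^bold>\<and> \<^bold>\<not> u \<^bold>= v \<^bold>\<and> isAllCode e u d)) a c))"

definition isSentence :: "var \<Rightarrow> form" where
  "isSentence c = (isFormula c \<^bold>\<and> \<^bold>\<not> (\<^bold>\<exists>v. isFreeIn v c))"

definition isUniversalClosure :: "var \<Rightarrow> var \<Rightarrow> form" where
  "isUniversalClosure c a =
    (isSentence c \<^bold>\<and> chain (\<lambda>d e. \<^bold>\<exists>u. isNat u \<^bold>\<and> isAllCode e u d) a c)"

section \<open>The coded theory S: ZF without Infinity\<close>

text \<open>
  Templates for coded formulas.  The arguments are levels of variables of class theory that stand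
  for coded variables and, in \<open>TSub\<close>, for a coded formula.
\<close>

datatype template =
  TMem var var | TEq var var | TNeg template | TImp template template | TAll var template | TSub var

abbreviation TConj :: "template \<Rightarrow> template \<Rightarrow> template" where
  "TConj s t \<equiv> TNeg (TImp s (TNeg t))"
abbreviation TDisj :: "template \<Rightarrow> template \<Rightarrow> template" where
  "TDisj s t \<equiv> TImp (TNeg s) t"
abbreviation TIff :: "template \<Rightarrow> template \<Rightarrow> template" where
  "TIff s t \<equiv> TConj (TImp s t) (TImp t s)"
abbreviation TEx :: "var \<Rightarrow> template \<Rightarrow> template" where
  "TEx x t \<equiv> TNeg (TAll x (TNeg t))"

primrec isCode :: "var \<Rightarrow> template \<Rightarrow> form" where
  "isCode c (TMem i j) = isMemCode c i j"
| "isCode c (TEq i j) = isEqCode c i j"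
| "isCode c (TNeg s) = (\<^bold>\<exists>a. isCode a s \<^bold>\<and> isNegCode c a)"
| "isCode c (TImp s t) = (\<^bold>\<exists>a b. isCode a s \<^bold>\<and> isCode b t \<^bold>\<and> isImpCode c a b)"
| "isCode c (TAll i s) = (\<^bold>\<exists>a. isCode a s \<^bold>\<and> isAllCode c i a)"
| "isCode c (TSub d) = (c \<^bold>= d)"

fun distinctVars :: "var list \<Rightarrow> form" where
  "distinctVars [] = \<^bold>\<top>"
| "distinctVars (x # xs) =
    (isNat x \<^bold>\<and> foldr (\<lambda>y P. \<^bold>\<not> x \<^bold>= y \<^bold>\<and> P) xs (distinctVars xs))"

text \<open>The axioms are taken for every choice of distinct variables.\<close>

definition isExtensionality :: "var \<Rightarrow> form" where
  "isExtensionality c =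
    (\<^bold>\<exists>x y z. distinctVars [x, y, z] \<^bold>\<and>
      isCode c (TAll x (TAll y (TImp (TAll z (TIff (TMem z x) (TMem z y))) (TEq x y)))))"

definition isEmptySetAxiom :: "var \<Rightarrow> form" where
  "isEmptySetAxiom c =
    (\<^bold>\<exists>x y. distinctVars [x, y] \<^bold>\<and> isCode c (TEx x (TAll y (TNeg (TMem y x)))))"

definition isPairing :: "var \<Rightarrow> form" where
  "isPairing c =
    (\<^bold>\<exists>x y z w. distinctVars [x, y, z, w] \<^bold>\<and>
      isCode c (TAll x (TAll y (TEx z (TAll w
        (TIff (TMem w z) (TDisj (TEq w x) (TEq w y))))))))"

definition isUnion :: "var \<Rightarrow> form" where
  "isUnion c =
    (\<^bold>\<exists>x y z w. distinctVars [x, y, z, w] \<^bold>\<and>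
      isCode c (TAll x (TEx y (TAll z
        (TIff (TMem z y) (TEx w (TConj (TMem w x) (TMem z w))))))))"

definition isPowerSet :: "var \<Rightarrow> form" where
  "isPowerSet c =
    (\<^bold>\<exists>x y z w. distinctVars [x, y, z, w] \<^bold>\<and>
      isCode c (TAll x (TEx y (TAll z
        (TIff (TMem z y) (TAll w (TImp (TMem w z) (TMem w x))))))))"

definition isFoundation :: "var \<Rightarrow> form" where
  "isFoundation c =
    (\<^bold>\<exists>x y z. distinctVars [x, y, z] \<^bold>\<and>
      isCode c (TAll x (TImp (TEx y (TMem y x))
        (TEx y (TConj (TMem y x) (TAll z (TImp (TMem z x) (TNeg (TMem z y)))))))))"

text \<open>\<open>\<forall>z \<exists>y \<forall>x (x \<in> y \<longleftrightarrow> x \<in> z \<and> d)\<close> with \<open>y\<close> not free in \<open>d\<close>\<close>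

definition isSeparation :: "var \<Rightarrow> form" where
  "isSeparation c =
    (\<^bold>\<exists>d x y z a. isFormula d \<^bold>\<and> distinctVars [x, y, z] \<^bold>\<and> \<^bold>\<not> isFreeIn y d \<^bold>\<and>
      isCode a (TAll z (TEx y (TAll x (TIff (TMem x y) (TConj (TMem x z) (TSub d)))))) \<^bold>\<and>
      isUniversalClosure c a)"

text \<open>
  \<open>\<forall>u (\<forall>x \<exists>z \<forall>y (d \<longrightarrow> y = z) \<longrightarrow> \<exists>w \<forall>y (y \<in> w \<longleftrightarrow> \<exists>x (x \<in> u \<and> d)))\<close> with \<open>z\<close>, \<open>w\<close> not free
  in \<open>d\<close>: the hypothesis says that for each \<open>x\<close> at most one \<open>y\<close> satisfies \<open>d\<close>, and avoids
  substitution into \<open>d\<close>.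
\<close>

definition isReplacement :: "var \<Rightarrow> form" where
  "isReplacement c =
    (\<^bold>\<exists>d x y z u w a. isFormula d \<^bold>\<and> distinctVars [x, y, z, u, w] \<^bold>\<and>
      \<^bold>\<not> isFreeIn z d \<^bold>\<and> \<^bold>\<not> isFreeIn w d \<^bold>\<and>
      isCode a (TAll u (TImp
        (TAll x (TEx z (TAll y (TImp (TSub d) (TEq y z)))))
        (TEx w (TAll y (TIff (TMem y w) (TEx x (TConj (TMem x u) (TSub d)))))))) \<^bold>\<and>
      isUniversalClosure c a)"

definition isAxiomOfS :: "var \<Rightarrow> form" where
  "isAxiomOfS c =
    (isExtensionality c \<^bold>\<or> isEmptySetAxiom c \<^bold>\<or> isPairing c \<^bold>\<or> isUnion c \<^bold>\<or> isPowerSet c \<^bold>\<or>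
     isFoundation c \<^bold>\<or> isSeparation c \<^bold>\<or> isReplacement c)"

section \<open>Satisfaction relations\<close>

text \<open>
  A structure \<open>(U; E)\<close> consists of a class \<open>U\<close> and a class \<open>E\<close> of ordered pairs.
  \<open>A\<close> is an assignment for \<open>c\<close>: a finite function into \<open>U\<close> covering the free variables of \<open>c\<close>.
\<close>

definition isAssignment :: "var \<Rightarrow> var \<Rightarrow> var \<Rightarrow> form" where
  "isAssignment A c U =
    (isFun A \<^bold>\<and> isFinite A \<^bold>\<and>
     (\<^bold>\<forall>v y. maps A v y \<^bold>\<longrightarrow> y \<^bold>\<in> U) \<^bold>\<and>
     (\<^bold>\<forall>v. isFreeIn v c \<^bold>\<longrightarrow> (\<^bold>\<exists>y. maps A v y)))"

text \<open>\<open>B\<close> is \<open>A\<close> changed to take the value \<open>y\<close> at \<open>v\<close>.\<close>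

definition isUpdate :: "var \<Rightarrow> var \<Rightarrow> var \<Rightarrow> var \<Rightarrow> form" where
  "isUpdate B A v y =
    (\<^bold>\<forall>p. p \<^bold>\<in> B \<^bold>\<longleftrightarrow> (p \<^bold>\<in> A \<^bold>\<and> \<^bold>\<not> (\<^bold>\<exists>z. isPair p v z)) \<^bold>\<or> isPair p v y)"

text \<open>\<open>(c, A)\<close> is in the domain of a valuation for the class \<open>\<Phi>\<close> of formulas over \<open>U\<close>.\<close>

definition inDomain :: "var \<Rightarrow> var \<Rightarrow> var \<Rightarrow> var \<Rightarrow> form" where
  "inDomain c A \<Phi> U = ((\<^bold>\<exists>e. e \<^bold>\<in> \<Phi> \<^bold>\<and> isSubformula c e) \<^bold>\<and> isAssignment A c U)"

text \<open>Truth values are \<open>0\<close> and \<open>1\<close>.\<close>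

definition isTrueAt :: "var \<Rightarrow> var \<Rightarrow> var \<Rightarrow> form" where
  "isTrueAt F c A = (\<^bold>\<exists>p t. isPair p c A \<^bold>\<and> isNumeral 1 t \<^bold>\<and> maps F p t)"

definition isValuation :: "var \<Rightarrow> var \<Rightarrow> var \<Rightarrow> var \<Rightarrow> form" where
  "isValuation F \<Phi> U E =
    (isFun F \<^bold>\<and>
     (\<^bold>\<forall>p. (\<^bold>\<exists>t. maps F p t) \<^bold>\<longleftrightarrow> (\<^bold>\<exists>c A. isPair p c A \<^bold>\<and> inDomain c A \<Phi> U)) \<^bold>\<and>
     (\<^bold>\<forall>p t. maps F p t \<^bold>\<longrightarrow> isNumeral 0 t \<^bold>\<or> isNumeral 1 t) \<^bold>\<and>
     (\<^bold>\<forall>c A. inDomain c A \<Phi> U \<^bold>\<longrightarrow>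
       (\<^bold>\<forall>i j. isNat i \<^bold>\<and> isNat j \<^bold>\<and> isMemCode c i j \<^bold>\<longrightarrow>
         (isTrueAt F c A \<^bold>\<longleftrightarrow> (\<^bold>\<exists>x y p. maps A i x \<^bold>\<and> maps A j y \<^bold>\<and> isPair p x y \<^bold>\<and> p \<^bold>\<in> E))) \<^bold>\<and>
       (\<^bold>\<forall>i j. isNat i \<^bold>\<and> isNat j \<^bold>\<and> isEqCode c i j \<^bold>\<longrightarrow>
         (isTrueAt F c A \<^bold>\<longleftrightarrow> (\<^bold>\<exists>x. maps A i x \<^bold>\<and> maps A j x))) \<^bold>\<and>
       (\<^bold>\<forall>a. isNegCode c a \<^bold>\<longrightarrow>
         (isTrueAt F c A \<^bold>\<longleftrightarrow> \<^bold>\<not> isTrueAt F a A)) \<^bold>\<and>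
       (\<^bold>\<forall>a b. isImpCode c a b \<^bold>\<longrightarrow>
         (isTrueAt F c A \<^bold>\<longleftrightarrow> (isTrueAt F a A \<^bold>\<longrightarrow> isTrueAt F b A))) \<^bold>\<and>
       (\<^bold>\<forall>i a. isNat i \<^bold>\<and> isAllCode c i a \<^bold>\<longrightarrow>
         (isTrueAt F c A \<^bold>\<longleftrightarrow>
           (\<^bold>\<forall>y B. y \<^bold>\<in> U \<^bold>\<and> isUpdate B A i y \<^bold>\<longrightarrow> isTrueAt F a B)))))"

definition isSatisfactionRelation :: "var \<Rightarrow> var \<Rightarrow> var \<Rightarrow> var \<Rightarrow> form" where
  "isSatisfactionRelation R \<Phi> U E =
    (\<^bold>\<exists>\<^sub>C F. isValuation F \<Phi> U E \<^bold>\<and>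
      (\<^bold>\<forall>p. p \<^bold>\<in> R \<^bold>\<longleftrightarrow> (\<^bold>\<exists>c A. isPair p c A \<^bold>\<and> isTrueAt F c A)))"

text \<open>For a sentence \<open>c\<close>, satisfaction in \<open>R\<close> is satisfaction by the empty assignment.\<close>

definition satisfies :: "var \<Rightarrow> var \<Rightarrow> form" where
  "satisfies R c = (\<^bold>\<exists>A p. isEmpty A \<^bold>\<and> isPair p c A \<^bold>\<and> p \<^bold>\<in> R)"

definition universallySatisfies :: "var \<Rightarrow> var \<Rightarrow> var \<Rightarrow> form" where
  "universallySatisfies U E c =
    (\<^bold>\<forall>\<^sub>C R. (\<^bold>\<exists>\<Phi>. isUPair \<Phi> c c \<^bold>\<and> isSatisfactionRelation R \<Phi> U E) \<^bold>\<longrightarrow> satisfies R c)"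

definition universallySatisfiesAll :: "var \<Rightarrow> var \<Rightarrow> var \<Rightarrow> form" where
  "universallySatisfiesAll U E \<Theta> = (\<^bold>\<forall>c. c \<^bold>\<in> \<Theta> \<^bold>\<longrightarrow> universallySatisfies U E c)"

definition isV :: "var \<Rightarrow> form" where
  "isV U = (\<^bold>\<forall>x. x \<^bold>\<in> U)"

definition isMembershipRelation :: "var \<Rightarrow> form" where
  "isMembershipRelation E = (\<^bold>\<forall>p. p \<^bold>\<in> E \<^bold>\<longleftrightarrow> (\<^bold>\<exists>x y. isPair p x y \<^bold>\<and> x \<^bold>\<in> y))"

definition isS :: "var \<Rightarrow> form" where
  "isS \<Theta> = (\<^bold>\<forall>c. c \<^bold>\<in> \<Theta> \<^bold>\<longleftrightarrow> isAxiomOfS c)"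

end

theory Submission
  imports Defs "HOL-Library.Countable_Set"
begin

text \<open>
  By completeness it is enough to verify the sentence in every countable model of C.  Such a model
  has infinitely many sets, so its sets may be taken to be all elements of a type, and a class
  becomes the HOL set of its elements.

  Inside a model, let \<open>F\<close> be a valuation for an axiom \<open>c\<close> of S.  The Tarskian clauses unravel
  \<open>c\<close> into a statement about sets.  For the finitely many single axioms this is the corresponding
  axiom of C.  For a coded formula \<open>d\<close> in a schema it speaks of the truth of \<open>d\<close> according to
  \<open>F\<close>, which is predicative in the class \<open>F\<close>; hence the class forms of Separation and Replacement
  apply, once it is known that truth of \<open>d\<close> depends only on the values of the free variables of
  \<open>d\<close>.  That, and the passage to universal closures, are inductions along finite sequences, again
  over classes that are predicative in \<open>F\<close>.
\<close>

section \<open>Completeness of the calculus\<close>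

text \<open>The naturals of a model of C may be nonstandard, and so may coded formulas, construction
  sequences and strings of quantifiers. On the coded side HOL induction reaches only templates and
  tag numerals. Every other induction takes place in the model, as a search for a minimal
  counterexample. Foundation concerns sets alone, and C provides no set of all naturals, so the
  search is confined to a set such as \<open>suc n\<close>, where n is the length at hand.

  Each such induction must exhibit its property as a class. Instead of writing the formulas out,
  \<open>defble\<close> is closed under the logical operations, and the class is found by following
  the syntax of the property. Predicativity causes no trouble because assignments are sets:
  quantifying over them is allowed, and a class such as \<open>F\<close> enters only as a parameter.

  In a schema nothing is unravelled below the coded formula d, which may be nonstandard. Only the
  fixed shape around d is, by recursion on a template.\<close>

primrec sem :: "'d set \<Rightarrow> ('d \<Rightarrow> 'd \<Rightarrow> bool) \<Rightarrow> (nat \<Rightarrow> 'd) \<Rightarrow> fm \<Rightarrow> bool" where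
  "sem D E e Bot = False"
| "sem D E e (Mem i j) = E (e i) (e j)"
| "sem D E e (Eql i j) = (e i = e j)"
| "sem D E e (Imp p q) = (sem D E e p \<longrightarrow> sem D E e q)"
| "sem D E e (Forall p) = (\<forall>x\<in>D. sem D E (case_nat x e) p)"

section \<open>Renaming and free variables\<close>

abbreviation lift :: "(nat \<Rightarrow> nat) \<Rightarrow> nat \<Rightarrow> nat" where
  "lift r \<equiv> case_nat 0 (\<lambda>j. Suc (r j))"

lemma sem_ren: "sem D E e (ren r p) = sem D E (\<lambda>i. e (r i)) p"
proof (induction p arbitrary: e r)
  case (Forall p)
  have "(\<lambda>i. case_nat x e (lift r i)) = case_nat x (\<lambda>i. e (r i))" for x
    by (rule ext) (simp split: nat.split)
  with Forall show ?case by simp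
qed auto

lemma ren_ren: "ren r (ren s p) = ren (\<lambda>i. r (s i)) p"
proof (induction p arbitrary: r s)
  case (Forall p)
  have "(\<lambda>i. lift r (lift s i)) = lift (\<lambda>i. r (s i))"
    by (rule ext) (simp split: nat.split)
  with Forall show ?case by simp
qed auto

primrec fv :: "fm \<Rightarrow> nat set" where
  "fv Bot = {}"
| "fv (Mem i j) = {i, j}"
| "fv (Eql i j) = {i, j}"
| "fv (Imp p q) = fv p \<union> fv q"
| "fv (Forall p) = {i. Suc i \<in> fv p}"

lemma finite_fv: "finite (fv p)"
proof (induction p)
  case (Forall p)
  then show ?case using finite_vimageI[of "fv p" Suc] by (simp add: vimage_def)
qed auto

lemma ren_cong: "(\<And>i. i \<in> fv p \<Longrightarrow> r i = s i) \<Longrightarrow> ren r p = ren s p"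
proof (induction p arbitrary: r s)
  case (Imp p q)
  then have "ren r p = ren s p" "ren r q = ren s q" by (metis UnCI fv.simps(4))+
  then show ?case by simp
next
  case (Forall p)
  have "ren (lift r) p = ren (lift s) p"
    by (rule Forall.IH) (use Forall.prems in \<open>auto split: nat.split\<close>)
  then show ?case by simp
qed simp_all

lemma ren_id: "ren (\<lambda>i. i) p = p"
proof (induction p)
  case (Forall p)
  have "lift (\<lambda>i. i) = (\<lambda>i. i)" by (rule ext) (simp split: nat.split)
  with Forall show ?case by simp
qed auto

lemma ren_inst: "ren r (inst t p) = inst (r t) (ren (lift r) p)"
  unfolding inst_def ren_ren by (rule arg_cong[where f="\<lambda>f. ren f p"]) (auto split: nat.split)

lemma inst_ren_lift: "inst t (ren (lift r) p) = ren (case_nat t r) p"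
  unfolding inst_def ren_ren by (rule arg_cong[where f="\<lambda>f. ren f p"]) (auto split: nat.split)

lemma ren_lift_Suc: "ren (lift r) (ren Suc p) = ren Suc (ren r p)"
  by (simp add: ren_ren)

text \<open>All schemes and rules are stable under renaming; the rule \<open>Gen\<close> uses the
  induction hypothesis at \<open>lift r\<close>. The purpose is to turn a variable that serves as a
  constant into a bound one.\<close>

lemma provable_ren:
  assumes closed: "\<And>p r. p \<in> T \<Longrightarrow> ren r p \<in> T"
  shows "T \<turnstile> p \<Longrightarrow> T \<turnstile> ren r p"
proof (induction arbitrary: r rule: provable.induct)
  case (Axiom p)
  then show ?case using closed by (blast intro: provable.Axiom)
next
  case (MP p q)
  then show ?case by (metis provable.MP ren.simps(4))
qed (simp_all add: ren_inst ren_lift_Suc provable.K provable.S provable.DNeg provable.Spec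
  provable.Distrib provable.Refl provable.Leibniz provable.Gen)

text \<open>Derivability from hypotheses \<open>\<Gamma>\<close> whose free variables are held fixed: no generalization.\<close>

inductive entails :: "fm set \<Rightarrow> fm set \<Rightarrow> fm \<Rightarrow> bool" for T \<Gamma> where
  Thm: "T \<turnstile> p \<Longrightarrow> entails T \<Gamma> p"
| Hyp: "p \<in> \<Gamma> \<Longrightarrow> entails T \<Gamma> p"
| MP: "entails T \<Gamma> (Imp p q) \<Longrightarrow> entails T \<Gamma> p \<Longrightarrow> entails T \<Gamma> q"

lemma entails_mono: "entails T \<Gamma> p \<Longrightarrow> \<Gamma> \<subseteq> \<Delta> \<Longrightarrow> entails T \<Delta> p"
  by (induction rule: entails.induct) (auto intro: entails.intros)

lemma entails_finite: "entails T \<Gamma> p \<Longrightarrow> \<exists>\<Delta>. finite \<Delta> \<and> \<Delta> \<subseteq> \<Gamma> \<and> entails T \<Delta> p"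
proof (induction rule: entails.induct)
  case (Thm p)
  then show ?case by (blast intro: entails.Thm)
next
  case (Hyp p)
  then show ?case by (intro exI[of _ "{p}"]) (auto intro: entails.Hyp)
next
  case (MP p q)
  then obtain \<Delta> \<Delta>' where "finite \<Delta>" "\<Delta> \<subseteq> \<Gamma>" "entails T \<Delta> (Imp p q)"
    "finite \<Delta>'" "\<Delta>' \<subseteq> \<Gamma>" "entails T \<Delta>' p" by blast
  then show ?case
    by (intro exI[of _ "\<Delta> \<union> \<Delta>'"]) (auto intro: entails.MP entails_mono)
qed

text \<open>The deduction theorem needs no condition on free variables, because
  \<open>entails\<close> has no generalization rule.\<close>

lemma entails_deduct: "entails T (insert q \<Gamma>) p \<Longrightarrow> entails T \<Gamma> (Imp q p)"
proof (induction rule: entails.induct)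
  case (Thm p)
  then show ?case by (blast intro: entails.Thm entails.MP provable.K)
next
  case (Hyp p)
  show ?case
  proof (cases "p = q")
    case True
    have "T \<turnstile> Imp q q" by (blast intro: provable.intros)
    then show ?thesis using True by (blast intro: entails.Thm)
  next
    case False
    with Hyp have "entails T \<Gamma> p" by (auto intro: entails.Hyp)
    then show ?thesis by (blast intro: entails.Thm entails.MP provable.K)
  qed
next
  case (MP p r)
  then show ?case by (blast intro: entails.Thm entails.MP provable.S)
qed

lemma entails_MP_Hyp: "entails T \<Gamma> (Imp q p) \<Longrightarrow> entails T (insert q \<Gamma>) p"
  by (meson entails.Hyp entails.MP entails_mono insertI1 subset_insertI)

lemma entails_DNeg: "entails T \<Gamma> (Neg (Neg p)) \<Longrightarrow> entails T \<Gamma> p"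
  by (blast intro: entails.Thm entails.MP provable.DNeg)

lemma entails_Bot: "entails T \<Gamma> Bot \<Longrightarrow> entails T \<Gamma> p"
  by (meson entails_DNeg entails_deduct entails_mono subset_insertI)

lemma entails_empty: "entails T {} p \<Longrightarrow> T \<turnstile> p"
  by (induction rule: entails.induct) (auto intro: provable.MP)

text \<open>Discharging all hypotheses leaves a theorem of T, to which renaming and
  \<open>Gen\<close> apply.\<close>

lemma entails_foldr: "entails T (set ps) p \<Longrightarrow> T \<turnstile> foldr Imp ps p"
proof (induction ps arbitrary: p rule: rev_induct)
  case (snoc q ps)
  then show ?case using entails_deduct[of T q "set ps" p] by simp
qed (simp add: entails_empty)

text \<open>The antecedents are shifted by \<open>Suc\<close>, so they do not contain the bound
  variable, and \<open>Distrib\<close> moves them out of the quantifier one at a time.\<close>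

lemma entails_Forall_foldr:
  "entails T \<Gamma> (Forall (foldr Imp (map (ren Suc) ps) q)) \<Longrightarrow> entails T (set ps \<union> \<Gamma>) (Forall q)"
proof (induction ps arbitrary: \<Gamma>)
  case (Cons p ps)
  then have "entails T \<Gamma> (Imp p (Forall (foldr Imp (map (ren Suc) ps) q)))"
    using entails.MP[OF entails.Thm[OF provable.Distrib]] by simp
  then have "entails T (insert p \<Gamma>) (Forall (foldr Imp (map (ren Suc) ps) q))"
    by (rule entails_MP_Hyp)
  from Cons.IH[OF this] show ?case by simp
qed simp

lemma ren_foldr_Imp: "ren r (foldr Imp ps q) = foldr Imp (map (ren r) ps) (ren r q)"
  by (induction ps) auto

text \<open>Generalization on a variable that the hypotheses do not contain, obtained by discharging
  them, renaming, applying \<open>Gen\<close> and restoring them.\<close>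

lemma entails_Forall_fresh:
  assumes closed: "\<And>p r. p \<in> T \<Longrightarrow> ren r p \<in> T"
    and "finite \<Gamma>" and fresh: "\<And>p. p \<in> \<Gamma> \<Longrightarrow> t \<notin> fv p" "Suc t \<notin> fv q"
    and ent: "entails T \<Gamma> (inst t q)"
  shows "entails T \<Gamma> (Forall q)"
proof -
  obtain ps where ps: "\<Gamma> = set ps" using \<open>finite \<Gamma>\<close> finite_list by blast
  \<comment> \<open>This renaming gives t the index 0, about to be bound, and shifts the rest. It
    acts as \<open>ren Suc\<close> on formulas without t and undoes the instantiation of q by
    t.\<close>
  define r where "r = (\<lambda>i. if i = t then 0 else Suc i)"
  have "T \<turnstile> ren r (foldr Imp ps (inst t q))"
    by (rule provable_ren[OF closed]) (use ent ps in \<open>auto intro: entails_foldr\<close>)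
  moreover have "map (ren r) ps = map (ren Suc) ps"
    using fresh(1) unfolding ps r_def by (auto intro!: ren_cong)
  moreover have "ren r (inst t q) = ren (\<lambda>i. i) q"
    unfolding inst_def ren_ren r_def using fresh(2)
    by (intro ren_cong) (auto split: nat.split)
  ultimately have "T \<turnstile> Forall (foldr Imp (map (ren Suc) ps) q)"
    by (auto simp: ren_foldr_Imp ren_id intro: provable.Gen)
  then have "entails T {} (Forall (foldr Imp (map (ren Suc) ps) q))"
    by (rule entails.Thm)
  from entails_Forall_foldr[OF this] show ?thesis by (simp add: ps)
qed

section \<open>Henkin extensions of consistent sets\<close>

instance fm :: countable
  by countable_datatype

text \<open>One step of the Lindenbaum-Henkin construction for the formula p. A finite set leaves
  some variable fresh, so variables serve as witnesses and no constants are added.\<close>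

lemma henkin_step:
  assumes closed: "\<And>p r. p \<in> T \<Longrightarrow> ren r p \<in> T"
    and fin: "finite \<Gamma>" and cons: "\<not> entails T \<Gamma> Bot"
  shows "\<exists>\<Gamma>'. finite \<Gamma>' \<and> \<not> entails T \<Gamma>' Bot \<and> \<Gamma> \<subseteq> \<Gamma>' \<and>
    (p \<in> \<Gamma>' \<or> entails T \<Gamma>' (Neg p)) \<and>
    (\<forall>q. p = Neg (Forall q) \<longrightarrow> p \<in> \<Gamma>' \<longrightarrow> (\<exists>t. Neg (inst t q) \<in> \<Gamma>'))"
proof (cases "entails T (insert p \<Gamma>) Bot")
  case True
  then have neg: "entails T \<Gamma> (Neg p)" by (rule entails_deduct)
  \<comment> \<open>The witness clause is thus vacuous when \<open>\<Gamma>\<close> itself is taken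
    as the extension.\<close>
  then have "p \<notin> \<Gamma>" using cons by (meson entails.Hyp entails.MP)
  then show ?thesis using fin cons neg by blast
next
  case False
  show ?thesis
  proof (cases "\<exists>q. p = Neg (Forall q)")
    case True
    then obtain q where q: "p = Neg (Forall q)" by blast
    let ?G = "insert p \<Gamma>"
    have "finite (\<Union>(fv ` ?G) \<union> {i. Suc i \<in> fv q})"
      using fin finite_fv finite_fv[of "Forall q"] by auto
    then obtain t where t: "t \<notin> \<Union>(fv ` ?G) \<union> {i. Suc i \<in> fv q}"
      using ex_new_if_finite infinite_UNIV_nat by blast
    \<comment> \<open>If the counterexample were refutable, freshness of t would yield
      \<open>Forall q\<close>, against the consistency of its negation.\<close>
    have "\<not> entails T (insert (Neg (inst t q)) ?G) Bot"
    proof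
      assume "entails T (insert (Neg (inst t q)) ?G) Bot"
      then have "entails T ?G (inst t q)" by (blast intro: entails_DNeg entails_deduct)
      then have "entails T ?G (Forall q)"
        by (rule entails_Forall_fresh[rotated -1]) (use closed fin t in auto)
      with False q show False by (metis entails.Hyp entails.MP insertI1)
    qed
    then show ?thesis using fin q by (intro exI[of _ "insert (Neg (inst t q)) ?G"]) auto
  next
    case False': False
    then show ?thesis using fin False by (intro exI[of _ "insert p \<Gamma>"]) auto
  qed
qed

text \<open>The formula p is treated at stage \<open>to_nat p\<close>. Stages remain finite, so
  fresh variables never run out; a contradiction in the union already occurs at some stage.\<close>

lemma henkin_extension:
  assumes closed: "\<And>p r. p \<in> T \<Longrightarrow> ren r p \<in> T"
    and "finite \<Gamma>" "\<not> entails T \<Gamma> Bot"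
  obtains \<Delta> where "\<Gamma> \<subseteq> \<Delta>" "\<not> entails T \<Delta> Bot" "\<And>p. p \<in> \<Delta> \<or> entails T \<Delta> (Neg p)"
    "\<And>q. Neg (Forall q) \<in> \<Delta> \<Longrightarrow> \<exists>t. Neg (inst t q) \<in> \<Delta>"
proof -
  let ?P = "\<lambda>n G. finite G \<and> \<not> entails T G Bot \<and> (n = 0 \<longrightarrow> G = \<Gamma>)"
  let ?Q = "\<lambda>n G G'. G \<subseteq> G' \<and> (from_nat n \<in> G' \<or> entails T G' (Neg (from_nat n))) \<and>
    (\<forall>q. from_nat n = Neg (Forall q) \<longrightarrow> from_nat n \<in> G' \<longrightarrow> (\<exists>t. Neg (inst t q) \<in> G'))"
  have "\<exists>H. \<forall>n. ?P n (H n) \<and> ?Q n (H n) (H (Suc n))"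
  proof (rule dependent_nat_choice)
    show "\<exists>G. ?P 0 G" using assms by blast
    show "\<exists>G'. ?P (Suc n) G' \<and> ?Q n G G'" if "?P n G" for n G
      using henkin_step[OF closed, of G "from_nat n"] that by auto
  qed
  then obtain H where H: "\<And>n. ?P n (H n)" "\<And>n. ?Q n (H n) (H (Suc n))" by blast
  have mono: "H m \<subseteq> H n" if "m \<le> n" for m n
    using lift_Suc_mono_le[of H] H(2) that by blast
  let ?D = "\<Union>n. H n"
  show thesis
  proof (rule that[of ?D])
    show "\<Gamma> \<subseteq> ?D" using H(1)[of 0] by auto
    show "\<not> entails T ?D Bot"
    proof
      assume "entails T ?D Bot"
      then obtain G where G: "finite G" "G \<subseteq> ?D" "entails T G Bot"
        using entails_finite[of T ?D Bot] by auto
      have "\<exists>n. G \<subseteq> H n" using G(1,2)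
      proof (induction G)
        case (insert p G)
        then obtain m n where "p \<in> H m" "G \<subseteq> H n" by auto
        then have "insert p G \<subseteq> H (max m n)" using mono[of m "max m n"] mono[of n "max m n"] by auto
        then show ?case by blast
      qed simp
      then show False using G(3) H(1) by (meson entails_mono)
    qed
    show "p \<in> ?D \<or> entails T ?D (Neg p)" for p
      using H(2)[of "to_nat p"] entails_mono[of T "H (Suc (to_nat p))" "Neg p" ?D] by auto
    show "\<exists>t. Neg (inst t q) \<in> ?D" if q: "Neg (Forall q) \<in> ?D" for q
    proof -
      let ?p = "Neg (Forall q)"
      let ?H = "H (Suc (to_nat ?p))"
      obtain n where n: "?p \<in> H n" using q by blast
      \<comment> \<open>The formula may have entered at another stage n, whereas its witness is
        supplied at its own stage. Had that stage refuted it, the larger of the two sets would be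
        inconsistent.\<close>
      have "?p \<in> ?H"
      proof (rule ccontr)
        assume "?p \<notin> ?H"
        then have "entails T ?H (Neg ?p)" using H(2)[of "to_nat ?p"] by auto
        then have "entails T (H (max n (Suc (to_nat ?p)))) (Neg ?p)"
          by (rule entails_mono) (simp add: mono)
        moreover have "entails T (H (max n (Suc (to_nat ?p)))) ?p"
          using n mono[of n "max n (Suc (to_nat ?p))"] by (auto intro: entails.Hyp)
        ultimately show False using H(1) by (meson entails.MP)
      qed
      then show ?thesis using H(2)[of "to_nat ?p"] by auto
    qed
  qed
qed

text \<open>Variables are the only terms, so the term model consists of variables modulo equality in
  a Henkin set. Hence structures over sets of natural numbers suffice.\<close>

theorem completeness:
  assumes closed: "\<And>p r. p \<in> T \<Longrightarrow> ren r p \<in> T"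
    and valid: "\<And>D E e. (\<And>p e. p \<in> T \<Longrightarrow> range e \<subseteq> D \<Longrightarrow> sem D E e p) \<Longrightarrow>
      range e \<subseteq> D \<Longrightarrow> sem (D :: nat set) E e \<phi>"
  shows "T \<turnstile> \<phi>"
proof (rule ccontr)
  assume "\<not> T \<turnstile> \<phi>"
  then have "\<not> entails T {Neg \<phi>} Bot"
    by (blast intro: entails_empty entails_DNeg entails_deduct)
  then obtain \<Gamma> where G: "{Neg \<phi>} \<subseteq> \<Gamma>" "\<not> entails T \<Gamma> Bot" "\<And>p. p \<in> \<Gamma> \<or> entails T \<Gamma> (Neg p)"
    "\<And>q. Neg (Forall q) \<in> \<Gamma> \<Longrightarrow> \<exists>t. Neg (inst t q) \<in> \<Gamma>"
    using henkin_extension[OF closed, of "{Neg \<phi>}"] by auto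
  have ent: "entails T \<Gamma> p \<longleftrightarrow> p \<in> \<Gamma>" for p
    using G(2,3) by (blast intro: entails.intros)
  have imp: "Imp p q \<in> \<Gamma> \<longleftrightarrow> (p \<in> \<Gamma> \<longrightarrow> q \<in> \<Gamma>)" for p q
  proof
    show "Imp p q \<in> \<Gamma> \<Longrightarrow> p \<in> \<Gamma> \<longrightarrow> q \<in> \<Gamma>" using ent by (blast intro: entails.MP)
    assume "p \<in> \<Gamma> \<longrightarrow> q \<in> \<Gamma>"
    moreover have "Imp p q \<in> \<Gamma>" if "q \<in> \<Gamma>"
      using that ent by (meson entails_deduct entails_mono subset_insertI)
    moreover have "Imp p q \<in> \<Gamma>" if "p \<notin> \<Gamma>"
      using that G(3)[of p] ent by (meson entails_Bot entails_MP_Hyp entails_deduct)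
    ultimately show "Imp p q \<in> \<Gamma>" by blast
  qed
  have bot: "Bot \<notin> \<Gamma>" using G(2) ent by blast
  have derivable: "p \<in> \<Gamma>" if "T \<turnstile> p" for p using that ent by (blast intro: entails.Thm)
  have all: "Forall p \<in> \<Gamma> \<longleftrightarrow> (\<forall>t. inst t p \<in> \<Gamma>)" for p
    using derivable[OF provable.Spec, of p] G(4)[of p] imp bot by blast
  have leib: "inst s p \<in> \<Gamma>" if "Eql t s \<in> \<Gamma>" "inst t p \<in> \<Gamma>" for s t p
    using derivable[OF provable.Leibniz, of t s p] that imp by blast
  have refl: "Eql t t \<in> \<Gamma>" for t by (rule derivable[OF provable.Refl])
  have sym: "Eql s t \<in> \<Gamma>" if "Eql t s \<in> \<Gamma>" for s t
    using leib[OF that, of "Eql 0 (Suc t)"] refl[of t] by (simp add: inst_def)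
  have trans: "Eql s u \<in> \<Gamma>" if "Eql s t \<in> \<Gamma>" "Eql t u \<in> \<Gamma>" for s t u
    using leib[OF that(2), of "Eql (Suc s) 0"] that(1) by (simp add: inst_def)
  \<comment> \<open>Least representatives instead of equivalence classes keep the domain within
    \<open>nat\<close> and make \<open>Eql\<close> true identity.\<close>
  define rep where "rep i = (LEAST j. Eql j i \<in> \<Gamma>)" for i
  have rep: "Eql (rep i) i \<in> \<Gamma>" for i
    unfolding rep_def by (rule LeastI[of _ i]) (rule refl)
  have rep_eq: "rep i = rep j \<longleftrightarrow> Eql i j \<in> \<Gamma>" for i j
  proof
    show "rep i = rep j \<Longrightarrow> Eql i j \<in> \<Gamma>" by (metis rep sym trans)
    assume "Eql i j \<in> \<Gamma>"
    then have "(Eql k i \<in> \<Gamma>) = (Eql k j \<in> \<Gamma>)" for k by (meson sym trans)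
    then show "rep i = rep j" unfolding rep_def by simp
  qed
  have rep_mem: "Mem (rep i) (rep j) \<in> \<Gamma> \<longleftrightarrow> Mem i j \<in> \<Gamma>" for i j
  proof
    assume "Mem (rep i) (rep j) \<in> \<Gamma>"
    then show "Mem i j \<in> \<Gamma>"
      using leib[OF rep[of i], of "Mem 0 (Suc (rep j))"] leib[OF rep[of j], of "Mem (Suc i) 0"]
      by (simp add: inst_def)
  next
    assume "Mem i j \<in> \<Gamma>"
    then show "Mem (rep i) (rep j) \<in> \<Gamma>"
      using leib[OF sym[OF rep[of i]], of "Mem 0 (Suc j)"]
        leib[OF sym[OF rep[of j]], of "Mem (Suc (rep i)) 0"]
      by (simp add: inst_def)
  qed
  let ?E = "\<lambda>i j. Mem i j \<in> \<Gamma>"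
  \<comment> \<open>The truth lemma is proved for all renamings e, because the quantifier case
    extends e by a witness.\<close>
  have truth: "sem (range rep) ?E (\<lambda>i. rep (e i)) p \<longleftrightarrow> ren e p \<in> \<Gamma>" for e p
  proof (induction p arbitrary: e)
    case (Forall p)
    have "case_nat (rep t) (\<lambda>i. rep (e i)) = (\<lambda>i. rep (case_nat t e i))" for t
      by (auto split: nat.split)
    with Forall show ?case by (simp add: all inst_ren_lift)
  qed (simp_all add: bot imp rep_mem rep_eq)
  have "sem (range rep) ?E (\<lambda>i. rep i) \<phi>"
  proof (rule valid)
    fix p and e :: "nat \<Rightarrow> nat" assume "p \<in> T" and e: "range e \<subseteq> range rep"
    \<comment> \<open>Environments into the domain are fixed by \<open>rep\<close>, so the truth
      lemma applies with the environment itself as the renaming.\<close>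
    have "rep (rep i) = rep i" for i using rep rep_eq by blast
    then have "e = (\<lambda>i. rep (e i))" using e by (intro HOL.ext) (metis rangeE range_subsetD)
    moreover have "ren e p \<in> \<Gamma>" using derivable closed[OF \<open>p \<in> T\<close>] by (blast intro: provable.Axiom)
    ultimately show "sem (range rep) ?E e p" using truth[of e p] by simp
  qed auto
  then have "\<phi> \<in> \<Gamma>" using truth[of "\<lambda>i. i" \<phi>] by (simp add: ren_id)
  then show False using G(1) imp bot by blast
qed

section \<open>Models of class theory\<close>

lemma sem_abbrevs:
  "sem D E e (Exists p) \<longleftrightarrow> (\<exists>x\<in>D. sem D E (case_nat x e) p)"
  "sem D E e (Conj p q) \<longleftrightarrow> sem D E e p \<and> sem D E e q"
  "sem D E e (Iff p q) \<longleftrightarrow> (sem D E e p \<longleftrightarrow> sem D E e q)"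
  "sem D E e (Forall p) \<longleftrightarrow> (\<forall>x\<in>D. sem D E (case_nat x e) p)"
  by auto

lemma predicative_ren: "predicative p \<Longrightarrow> predicative (ren r p)"
  by (induction arbitrary: r rule: predicative.induct) (auto intro: predicative.intros)

text \<open>Introduction rules for \<open>defble\<close> and \<open>defterm\<close>:
  \<open>intro definable\<close> assembles a predicative formula along the syntax of a
  property.\<close>

named_theorems definable

text \<open>The elements of the type are the sets, and \<open>ext x\<close> is the set x regarded as
  a class. By \<open>covered\<close>, \<open>IsSet\<close> holds exactly of the classes
  \<open>ext x\<close>.\<close>

locale class_structure =
  fixes ext :: "'a \<Rightarrow> 'a set" and Cls :: "'a set set"
  assumes inj_ext: "inj ext" and ext_Cls: "ext x \<in> Cls" and covered: "\<exists>X\<in>Cls. x \<in> X"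
begin

abbreviation sat :: "(nat \<Rightarrow> 'a set) \<Rightarrow> fm \<Rightarrow> bool" where
  "sat \<equiv> sem Cls (\<lambda>X Y. \<exists>s. X = ext s \<and> s \<in> Y)"

lemma ext_eq [simp]: "ext x = ext y \<longleftrightarrow> x = y"
  using inj_ext by (auto dest: injD)

text \<open>The inverse of \<open>ext\<close> on its range. Environments store sets as classes, and
  \<open>st\<close> recovers them in the rewrite rules for \<open>holds\<close>.\<close>

definition st :: "'a set \<Rightarrow> 'a" where
  "st X = (THE s. X = ext s)"

lemma st_ext [simp]: "st (ext x) = x"
  by (simp add: st_def)

text \<open>The values of the variables are indexed by level; \<open>\<delta>\<close> supplies the free variables.\<close>

definition holds :: "(nat \<Rightarrow> 'a set) \<Rightarrow> form \<Rightarrow> nat \<Rightarrow> (nat \<Rightarrow> 'a set) \<Rightarrow> bool" where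
  "holds \<delta> P n e = sat (\<lambda>i. if i < n then e (n - Suc i) else \<delta> (i - n)) (P n)"

lemma sat_sentence: "sat \<delta> (sentence P) = holds \<delta> P 0 e"
  by (simp add: sentence_def holds_def)

lemma holds_mem [simp]:
  "x < n \<Longrightarrow> y < n \<Longrightarrow> holds \<delta> (x \<^bold>\<in> y) n e = (\<exists>s. e x = ext s \<and> s \<in> e y)"
  by (simp add: holds_def mem\<^sub>f_def Suc_diff_Suc)

lemma holds_eq [simp]: "x < n \<Longrightarrow> y < n \<Longrightarrow> holds \<delta> (x \<^bold>= y) n e = (e x = e y)"
  by (simp add: holds_def eq\<^sub>f_def Suc_diff_Suc)

lemma holds_connectives [simp]:
  "holds \<delta> \<^bold>\<top> n e"
  "holds \<delta> (\<^bold>\<not> P) n e = (\<not> holds \<delta> P n e)"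
  "holds \<delta> (P \<^bold>\<and> Q) n e = (holds \<delta> P n e \<and> holds \<delta> Q n e)"
  "holds \<delta> (P \<^bold>\<or> Q) n e = (holds \<delta> P n e \<or> holds \<delta> Q n e)"
  "holds \<delta> (P \<^bold>\<longrightarrow> Q) n e = (holds \<delta> P n e \<longrightarrow> holds \<delta> Q n e)"
  "holds \<delta> (P \<^bold>\<longleftrightarrow> Q) n e = (holds \<delta> P n e \<longleftrightarrow> holds \<delta> Q n e)"
  by (auto simp: holds_def true\<^sub>f_def neg\<^sub>f_def conj\<^sub>f_def disj\<^sub>f_def imp\<^sub>f_def iff\<^sub>f_def)

text \<open>A binder shifts all indices but merely adds the level n, so earlier variables keep their
  places in e.\<close>

lemma env_shift:
  "case_nat X (\<lambda>i. if i < n then e (n - Suc i) else \<delta> (i - n)) =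
    (\<lambda>i. if i < Suc n then (e(n := X)) (Suc n - Suc i) else \<delta> (i - Suc n))"
  by (rule HOL.ext) (auto split: nat.split)

lemma holds_allC [simp]: "holds \<delta> (allC P) n e = (\<forall>X\<in>Cls. holds \<delta> (P n) (Suc n) (e(n := X)))"
  unfolding holds_def allC_def sem.simps env_shift ..

lemma holds_exC [simp]: "holds \<delta> (exC P) n e = (\<exists>X\<in>Cls. holds \<delta> (P n) (Suc n) (e(n := X)))"
  unfolding holds_def exC_def sem.simps env_shift by blast

lemma sat_IsSet: "sat (case_nat X e) (IsSet 0) \<longleftrightarrow> X \<in> range ext"
  using covered by auto

lemma sat_Forall_set: "sat e (Forall (Imp (IsSet 0) p)) = (\<forall>x. sat (case_nat (ext x) e) p)"
proof -
  have "sat e (Forall (Imp (IsSet 0) p)) =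
      (\<forall>X\<in>Cls. sat (case_nat X e) (IsSet 0) \<longrightarrow> sat (case_nat X e) p)"
    by simp
  then show ?thesis unfolding sat_IsSet using ext_Cls by auto
qed

lemma holds_allS [simp]: "holds \<delta> (allS P) n e = (\<forall>x. holds \<delta> (P n) (Suc n) (e(n := ext x)))"
  unfolding holds_def allS_def sat_Forall_set env_shift ..

lemma holds_exS [simp]: "holds \<delta> (exS P) n e = (\<exists>x. holds \<delta> (P n) (Suc n) (e(n := ext x)))"
proof -
  have "exS P = (\<^bold>\<not> (allS (\<lambda>x. \<^bold>\<not> P x)))" by (simp add: exS_def allS_def neg\<^sub>f_def)
  then show ?thesis by simp
qed

lemma holds_isEmpty [simp]: "x < n \<Longrightarrow> holds \<delta> (isEmpty x) n e = (e x = {})"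
  by (auto simp: isEmpty_def)

lemma holds_subset [simp]: "x < n \<Longrightarrow> y < n \<Longrightarrow> holds \<delta> (x \<^bold>\<subseteq> y) n e = (e x \<subseteq> e y)"
  by (auto simp: subset\<^sub>f_def)

lemma holds_isUPair [simp]:
  "p < n \<Longrightarrow> x < n \<Longrightarrow> y < n \<Longrightarrow> e x \<in> range ext \<Longrightarrow> e y \<in> range ext \<Longrightarrow>
    holds \<delta> (isUPair p x y) n e = (e p = {st (e x), st (e y)})"
  by (auto simp: isUPair_def)

end

locale class_theory_model = class_structure +
  assumes sat_Th_C: "p \<in> Th_C \<Longrightarrow> range e \<subseteq> Cls \<Longrightarrow> sat e p"
begin

lemma holds_axiom:
  assumes "sentence P \<in> Th_C"
  shows "holds (\<lambda>_. ext undefined) P 0 (\<lambda>_. {})"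
  using sat_Th_C[OF assms, of "\<lambda>_. ext undefined"] ext_Cls
  by (simp add: sat_sentence[of _ _ "\<lambda>_. {}"] image_subset_iff)

lemma ex_empty: "\<exists>x. ext x = {}"
  using holds_axiom[of "\<^bold>\<exists>x. isEmpty x"] by (simp add: Th_C_def)

lemma ex_upair: "\<exists>z. ext z = {x, y}"
  using holds_axiom[of "\<^bold>\<forall>x y. \<^bold>\<exists>z. isUPair z x y"] by (simp add: Th_C_def)

lemma ex_union: "\<exists>y. ext y = \<Union> (ext ` ext x)"
proof -
  have "\<forall>x. \<exists>y. \<forall>z. z \<in> ext y \<longleftrightarrow> (\<exists>w. w \<in> ext x \<and> z \<in> ext w)"
    using holds_axiom[of "\<^bold>\<forall>x. \<^bold>\<exists>y. \<^bold>\<forall>z. z \<^bold>\<in> y \<^bold>\<longleftrightarrow> (\<^bold>\<exists>w. w \<^bold>\<in> x \<^bold>\<and> z \<^bold>\<in> w)"]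
    by (simp add: Th_C_def)
  then obtain y where "\<forall>z. z \<in> ext y \<longleftrightarrow> (\<exists>w. w \<in> ext x \<and> z \<in> ext w)" by blast
  then show ?thesis by (intro exI[of _ y]) auto
qed

lemma ex_power: "\<exists>y. ext y = {z. ext z \<subseteq> ext x}"
proof -
  have "\<forall>x. \<exists>y. \<forall>z. z \<in> ext y \<longleftrightarrow> ext z \<subseteq> ext x"
    using holds_axiom[of "\<^bold>\<forall>x. \<^bold>\<exists>y. \<^bold>\<forall>z. z \<^bold>\<in> y \<^bold>\<longleftrightarrow> z \<^bold>\<subseteq> x"] by (simp add: Th_C_def)
  then obtain y where "\<forall>z. z \<in> ext y \<longleftrightarrow> ext z \<subseteq> ext x" by blast
  then show ?thesis by (intro exI[of _ y]) auto
qed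

lemma foundation: "ext x \<noteq> {} \<Longrightarrow> \<exists>y\<in>ext x. ext x \<inter> ext y = {}"
proof -
  have "\<forall>x. ext x \<noteq> {} \<longrightarrow> (\<exists>y. y \<in> ext x \<and> (\<forall>z. z \<in> ext x \<longrightarrow> z \<notin> ext y))"
    using holds_axiom[of "\<^bold>\<forall>x. \<^bold>\<not> isEmpty x \<^bold>\<longrightarrow>
      (\<^bold>\<exists>y. y \<^bold>\<in> x \<^bold>\<and> (\<^bold>\<forall>z. z \<^bold>\<in> x \<^bold>\<longrightarrow> \<^bold>\<not> z \<^bold>\<in> y))"] by (simp add: Th_C_def)
  then show "ext x \<noteq> {} \<Longrightarrow> ?thesis" by blast
qed

definition the_set :: "'a set \<Rightarrow> 'a" where
  "the_set X = (THE x. ext x = X)"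

lemma ext_the_set: "\<exists>x. ext x = X \<Longrightarrow> ext (the_set X) = X"
  unfolding the_set_def by (rule theI') (metis ext_eq)

definition emp :: 'a where "emp = the_set {}"
definition upair :: "'a \<Rightarrow> 'a \<Rightarrow> 'a" where "upair x y = the_set {x, y}"
definition pair :: "'a \<Rightarrow> 'a \<Rightarrow> 'a" where "pair x y = upair (upair x x) (upair x y)"

lemma ext_emp [simp]: "ext emp = {}"
  unfolding emp_def by (rule ext_the_set[OF ex_empty])

lemma ext_upair [simp]: "ext (upair x y) = {x, y}"
  unfolding upair_def by (rule ext_the_set[OF ex_upair])

lemma ext_eq_empty [simp]: "ext x = {} \<longleftrightarrow> x = emp"
  using ext_eq[of x emp] unfolding ext_emp .

lemma eq_upair: "z = upair x y \<longleftrightarrow> ext z = {x, y}"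
  by (metis ext_eq ext_upair)

lemma ext_eq_doubleton: "ext z = {x, y} \<longleftrightarrow> z = upair x y" "ext z = {x} \<longleftrightarrow> z = upair x x"
  by (simp_all add: eq_upair)

lemma pair_eq [simp]: "pair x y = pair x' y' \<longleftrightarrow> x = x' \<and> y = y'"
proof -
  have "upair a b = upair c d \<longleftrightarrow> {a, b} = {c, d}" for a b c d by (simp add: eq_upair)
  then show ?thesis by (auto simp: pair_def doubleton_eq_iff)
qed

lemma holds_isPair [simp]:
  "p < n \<Longrightarrow> x < n \<Longrightarrow> y < n \<Longrightarrow> e p \<in> range ext \<Longrightarrow> e x \<in> range ext \<Longrightarrow> e y \<in> range ext \<Longrightarrow>
    holds \<delta> (isPair p x y) n e = (st (e p) = pair (st (e x)) (st (e y)))"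
  by (elim rangeE) (simp add: isPair_def pair_def ext_eq_doubleton)

lemma holds_maps [simp]:
  "f < n \<Longrightarrow> x < n \<Longrightarrow> y < n \<Longrightarrow> e x \<in> range ext \<Longrightarrow> e y \<in> range ext \<Longrightarrow>
    holds \<delta> (maps f x y) n e = (pair (st (e x)) (st (e y)) \<in> e f)"
  by (auto simp: maps_def)

definition Fun :: "'a set \<Rightarrow> bool" where
  "Fun F \<longleftrightarrow> (\<forall>p\<in>F. \<exists>x y. p = pair x y) \<and> (\<forall>x y z. pair x y \<in> F \<and> pair x z \<in> F \<longrightarrow> y = z)"

lemma holds_isFun [simp]: "f < n \<Longrightarrow> holds \<delta> (isFun f) n e = Fun (e f)"
  by (auto simp: isFun_def Fun_def)

lemma replacement:
  assumes "F \<in> Cls" "Fun F"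
  shows "\<exists>y. ext y = {z. \<exists>w\<in>ext x. pair w z \<in> F}"
proof -
  have "\<forall>F\<in>Cls. Fun F \<longrightarrow> (\<forall>x. \<exists>y. \<forall>z. z \<in> ext y \<longleftrightarrow> (\<exists>w. w \<in> ext x \<and> pair w z \<in> F))"
    using holds_axiom[of "\<^bold>\<forall>\<^sub>C F. isFun F \<^bold>\<longrightarrow>
        (\<^bold>\<forall>x. \<^bold>\<exists>y. \<^bold>\<forall>z. z \<^bold>\<in> y \<^bold>\<longleftrightarrow> (\<^bold>\<exists>w. w \<^bold>\<in> x \<^bold>\<and> maps F w z))"]
    by (simp add: Th_C_def)
  then obtain y where "\<forall>z. z \<in> ext y \<longleftrightarrow> (\<exists>w. w \<in> ext x \<and> pair w z \<in> F)"
    using assms by blast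
  then show ?thesis by (intro exI[of _ y]) auto
qed

lemma comprehension_sat:
  assumes "predicative p" "range e \<subseteq> Cls"
  shows "{x. sat (case_nat (ext x) e) p} \<in> Cls"
proof -
  have "comprehension p \<in> Th_C" using assms(1) by (simp add: Th_C_def)
  then have "sat e (comprehension p)" using assms(2) by (rule sat_Th_C)
  moreover have "(\<lambda>i. case_nat X (case_nat Z e) (case i of 0 \<Rightarrow> 0 | Suc j \<Rightarrow> Suc (Suc j))) = case_nat X e"
    for X Z by (rule HOL.ext) (simp split: nat.split)
  ultimately have "\<exists>Z\<in>Cls. \<forall>X\<in>Cls. (\<exists>s. X = ext s \<and> s \<in> Z) \<longleftrightarrow>
      sat (case_nat X (case_nat Z e)) (IsSet 0) \<and> sat (case_nat X e) p"
    unfolding comprehension_def sem_abbrevs(1,4) unfolding sem_abbrevs(3)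
    unfolding sem_abbrevs(2) sem_ren by simp
  then obtain Z where "Z \<in> Cls"
    and Z: "\<forall>X\<in>Cls. (\<exists>s. X = ext s \<and> s \<in> Z) \<longleftrightarrow> X \<in> range ext \<and> sat (case_nat X e) p"
    unfolding sat_IsSet by (rule bexE)
  have "{x. sat (case_nat (ext x) e) p} = Z"
    using Z[THEN bspec, OF ext_Cls] by auto
  then show ?thesis using \<open>Z \<in> Cls\<close> by simp
qed

section \<open>Definability\<close>

text \<open>
  \<open>defble P\<close> says that \<open>P\<close> is expressible by a predicative formula whose free variables are set
  variables (\<open>Inl j\<close>) or class parameters (\<open>Inr X\<close>).
\<close>

definition env :: "(nat \<Rightarrow> nat + 'a set) \<Rightarrow> (nat \<Rightarrow> 'a) \<Rightarrow> nat \<Rightarrow> 'a set" where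
  "env w e i = (case w i of Inl j \<Rightarrow> ext (e j) | Inr X \<Rightarrow> X)"

definition defble :: "((nat \<Rightarrow> 'a) \<Rightarrow> bool) \<Rightarrow> bool" where
  "defble P \<longleftrightarrow> (\<exists>p w. predicative p \<and> (\<forall>i X. w i = Inr X \<longrightarrow> X \<in> Cls) \<and> (\<forall>e. P e = sat (env w e) p))"

lemma defble_class:
  assumes "defble (\<lambda>e. P (e 0))"
  shows "{x. P x} \<in> Cls"
proof -
  obtain p w where p: "predicative p" "\<And>i X. w i = Inr X \<Longrightarrow> X \<in> Cls"
    and eq: "\<And>e. P (e 0) = sat (env w e) p"
    using assms unfolding defble_def by blast
  \<comment> \<open>Since P looks only at \<open>e 0\<close>, a constant environment may be used:
    all set variables collapse to index 0 and the class parameters move up by one.\<close>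
  let ?r = "\<lambda>i. case w i of Inl j \<Rightarrow> 0 | Inr X \<Rightarrow> Suc i"
  let ?e = "\<lambda>i. case w i of Inl j \<Rightarrow> ext undefined | Inr X \<Rightarrow> X"
  have "(\<lambda>i. case_nat (ext x) ?e (?r i)) = env w (\<lambda>_. x)" for x
    by (rule HOL.ext) (auto simp: env_def split: sum.split)
  then have "P x = sat (case_nat (ext x) ?e) (ren ?r p)" for x
    using eq[of "\<lambda>_. x"] by (simp add: sem_ren)
  moreover have "range ?e \<subseteq> Cls" using p(2) ext_Cls by (auto split: sum.split)
  ultimately show ?thesis
    using comprehension_sat[OF predicative_ren[OF p(1)], of ?e ?r] by simp
qed

lemma defble_False: "defble (\<lambda>_. False)"
  unfolding defble_def
  by (intro exI[of _ Bot] exI[of _ "\<lambda>_. Inl 0"]) (auto intro: predicative.intros)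

lemma defble_imp:
  assumes "defble P" "defble Q"
  shows "defble (\<lambda>e. P e \<longrightarrow> Q e)"
proof -
  obtain p w q v where p: "predicative p" "\<And>i X. w i = Inr X \<Longrightarrow> X \<in> Cls" "\<And>e. P e = sat (env w e) p"
    and q: "predicative q" "\<And>i X. v i = Inr X \<Longrightarrow> X \<in> Cls" "\<And>e. Q e = sat (env v e) q"
    using assms unfolding defble_def by blast
  \<comment> \<open>The parameters of P occupy the even indices and those of Q the odd ones.\<close>
  let ?u = "\<lambda>i. if even i then w (i div 2) else v (i div 2)"
  show ?thesis unfolding defble_def
  proof (intro exI conjI allI)
    show "predicative (Imp (ren (\<lambda>i. 2 * i) p) (ren (\<lambda>i. Suc (2 * i)) q))"
      using p q by (auto intro: predicative.intros predicative_ren)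
    show "?u i = Inr X \<longrightarrow> X \<in> Cls" for i X using p(2) q(2) by auto
    have "(\<lambda>i. env ?u e (2 * i)) = env w e" "(\<lambda>i. env ?u e (Suc (2 * i))) = env v e" for e
      by (auto simp: env_def)
    then show "(P e \<longrightarrow> Q e) = sat (env ?u e) (Imp (ren (\<lambda>i. 2 * i) p) (ren (\<lambda>i. Suc (2 * i)) q))" for e
      by (simp add: sem_ren p(3) q(3))
  qed
qed

lemma defble_all:
  assumes "defble (\<lambda>e. P (e 0) (\<lambda>i. e (Suc i)))"
  shows "defble (\<lambda>e. \<forall>x. P x e)"
proof -
  obtain p w where p: "predicative p" "\<And>i X. w i = Inr X \<Longrightarrow> X \<in> Cls"
    "\<And>e. P (e 0) (\<lambda>i. e (Suc i)) = sat (env w e) p"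
    using assms unfolding defble_def by blast
  \<comment> \<open>Several indices may denote set variable 0; all are sent to the new bound
    variable. The value of \<open>?v\<close> at such an index is never read.\<close>
  let ?r = "\<lambda>i. if w i = Inl 0 then 0 else Suc i"
  let ?v = "\<lambda>i. case w i of Inl j \<Rightarrow> Inl (j - 1) | Inr X \<Rightarrow> Inr X"
  show ?thesis unfolding defble_def
  proof (intro exI conjI allI)
    show "predicative (Forall (Imp (IsSet 0) (ren ?r p)))"
      using p by (auto intro: predicative.intros predicative_ren)
    show "?v i = Inr X \<longrightarrow> X \<in> Cls" for i X using p(2) by (auto split: sum.split)
    have "(\<lambda>i. case_nat (ext x) (env ?v e) (?r i)) = env w (case_nat x e)" for x e
      by (rule HOL.ext) (auto simp: env_def split: sum.split nat.split)
    then show "(\<forall>x. P x e) = sat (env ?v e) (Forall (Imp (IsSet 0) (ren ?r p)))" for e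
      unfolding sat_Forall_set sem_ren using p(3)[of "case_nat x e" for x] by simp
  qed
qed

lemma defble_reindex:
  assumes "defble P"
  shows "defble (\<lambda>e. P (\<lambda>i. e (f i)))"
proof -
  obtain p w where p: "predicative p" "\<And>i X. w i = Inr X \<Longrightarrow> X \<in> Cls" "\<And>e. P e = sat (env w e) p"
    using assms unfolding defble_def by blast
  let ?v = "\<lambda>i. case w i of Inl j \<Rightarrow> Inl (f j) | Inr X \<Rightarrow> Inr X"
  show ?thesis unfolding defble_def
  proof (intro exI conjI allI)
    show "?v i = Inr X \<longrightarrow> X \<in> Cls" for i X using p(2) by (auto split: sum.split)
    have "env ?v e = env w (\<lambda>i. e (f i))" for e
      by (rule HOL.ext) (auto simp: env_def split: sum.split)
    then show "P (\<lambda>i. e (f i)) = sat (env ?v e) p" for e by (simp add: p(3))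
  qed (rule p(1))
qed

lemma defble_not: "defble P \<Longrightarrow> defble (\<lambda>e. \<not> P e)"
  using defble_imp[OF _ defble_False] by simp

lemma defble_conj: "defble P \<Longrightarrow> defble Q \<Longrightarrow> defble (\<lambda>e. P e \<and> Q e)"
  using defble_not[OF defble_imp[OF _ defble_not]] by simp

lemma defble_disj: "defble P \<Longrightarrow> defble Q \<Longrightarrow> defble (\<lambda>e. P e \<or> Q e)"
  using defble_imp[OF defble_not] by (simp add: imp_conv_disj)

lemma defble_iff: "defble P \<Longrightarrow> defble Q \<Longrightarrow> defble (\<lambda>e. P e \<longleftrightarrow> Q e)"
  unfolding iff_conv_conj_imp by (intro defble_conj defble_imp)

lemma defble_ex: "defble (\<lambda>e. P (e 0) (\<lambda>i. e (Suc i))) \<Longrightarrow> defble (\<lambda>e. \<exists>x. P x e)"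
  using defble_not[OF defble_all[of "\<lambda>x e. \<not> P x e"]] defble_not by simp

text \<open>Formulas have no function symbols, so a term is treated through its graph: index 0 holds
  the value and the arguments move up by one.\<close>

definition defterm :: "((nat \<Rightarrow> 'a) \<Rightarrow> 'a) \<Rightarrow> bool" where
  "defterm t \<longleftrightarrow> defble (\<lambda>e. e 0 = t (\<lambda>i. e (Suc i)))"

text \<open>The value of the term is named by a quantified set variable, which keeps the formula
  predicative.\<close>

lemma defble_subst:
  assumes "defble (\<lambda>e. P (e 0) (\<lambda>i. e (Suc i)))" "defterm t"
  shows "defble (\<lambda>e. P (t e) e)"
proof -
  have "defble (\<lambda>e. \<exists>x. x = t e \<and> P x e)"
    by (intro defble_ex defble_conj assms assms(2)[unfolded defterm_def])
  then show ?thesis by simp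
qed

lemma defterm_reindex: "defterm t \<Longrightarrow> defterm (\<lambda>e. t (\<lambda>i. e (f i)))"
  unfolding defterm_def
  using defble_reindex[of "\<lambda>e. e 0 = t (\<lambda>i. e (Suc i))" "case_nat 0 (\<lambda>i. Suc (f i))"] by simp

lemma defble_subst1: "defble (\<lambda>e. P (e 0)) \<Longrightarrow> defterm s \<Longrightarrow> defble (\<lambda>e. P (s e))"
  by (rule defble_subst)

lemma defble_eq_var: "defble (\<lambda>e. e i = e j)"
  unfolding defble_def
  by (intro exI[of _ "Eql i j"] exI[of _ Inl]) (auto simp: env_def intro: predicative.intros)

lemma defterm_var: "defterm (\<lambda>e. e i)"
  unfolding defterm_def by (rule defble_eq_var)

lemma defterm_const: "defterm (\<lambda>e. c)"
  unfolding defterm_def defble_def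
  by (intro exI[of _ "Eql 0 1"] exI[of _ "case_nat (Inl 0) (\<lambda>_. Inr (ext c))"])
    (auto simp: env_def ext_Cls intro: predicative.intros split: nat.splits)

lemma defble_graph: "defterm t \<Longrightarrow> defble (\<lambda>e. e k = t (\<lambda>i. e (f i)))"
  unfolding defterm_def
  using defble_reindex[of "\<lambda>e. e 0 = t (\<lambda>i. e (Suc i))" "case_nat k f"] by simp

lemma defble_subst2:
  assumes "defble (\<lambda>e. P (e 0) (e 1))" "defterm s" "defterm t"
  shows "defble (\<lambda>e. P (s e) (t e))"
proof -
  \<comment> \<open>The inner quantifier takes index 0, so x and y occur in reverse order and the
    reindexing swaps them.\<close>
  have "defble (\<lambda>e. \<exists>x y. x = s e \<and> y = t e \<and> P x y)"
    by (intro defble_ex defble_conj defble_graph assms(2,3))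
      (use defble_reindex[OF assms(1), of "case_nat 1 (\<lambda>_. 0)"] in simp)
  then show ?thesis by simp
qed

lemma defble_subst3:
  assumes "defble (\<lambda>e. P (e 0) (e 1) (e 2))" "defterm s" "defterm t" "defterm u"
  shows "defble (\<lambda>e. P (s e) (t e) (u e))"
proof -
  have "defble (\<lambda>e. \<exists>x y z. x = s e \<and> y = t e \<and> z = u e \<and> P x y z)"
    by (intro defble_ex defble_conj defble_graph assms(2-4))
      (use defble_reindex[OF assms(1), of "\<lambda>i. 2 - i"] in \<open>simp add: numeral_2_eq_2\<close>)
  then show ?thesis by simp
qed

lemma defterm_subst1:
  assumes "defterm (\<lambda>e. f (e 0))" "defterm s"
  shows "defterm (\<lambda>e. f (s e))"
  unfolding defterm_def
proof (rule defble_subst2[of "\<lambda>x y. x = f y"])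
  show "defble (\<lambda>e. e 0 = f (e 1))" using assms(1) unfolding defterm_def by simp
qed (auto intro: defterm_reindex assms defterm_var)

lemma defterm_subst2:
  assumes "defterm (\<lambda>e. f (e 0) (e 1))" "defterm s" "defterm t"
  shows "defterm (\<lambda>e. f (s e) (t e))"
  unfolding defterm_def
proof (rule defble_subst3[of "\<lambda>x y z. x = f y z"])
  show "defble (\<lambda>e. e 0 = f (e 1) (e 2))"
    using assms(1) unfolding defterm_def by (simp add: numeral_2_eq_2)
qed (auto intro: defterm_reindex assms defterm_var)

lemma defterm_subst3:
  assumes "defterm (\<lambda>e. f (e 0) (e 1) (e 2))" "defterm s" "defterm t" "defterm u"
  shows "defterm (\<lambda>e. f (s e) (t e) (u e))"
proof -
  have "defble (\<lambda>e. \<exists>x y z. x = s (\<lambda>i. e (Suc i)) \<and> y = t (\<lambda>i. e (Suc i)) \<and> z = u (\<lambda>i. e (Suc i)) \<and> e 0 = f x y z)"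
    by (intro defble_ex defble_conj assms(2-4)[THEN defble_graph])
      (use defble_graph[OF assms(1), of 3 "\<lambda>i. 2 - i"] in \<open>simp add: eval_nat_numeral\<close>)
  then show ?thesis unfolding defterm_def by simp
qed

lemma defble_mem_ext: "defterm s \<Longrightarrow> defterm t \<Longrightarrow> defble (\<lambda>e. s e \<in> ext (t e))"
proof (rule defble_subst2[of "\<lambda>x y. x \<in> ext y"])
  show "defble (\<lambda>e. e 0 \<in> ext (e 1))" unfolding defble_def
    by (intro exI[of _ "Mem 0 1"] exI[of _ Inl]) (auto simp: env_def intro: predicative.intros)
qed

lemma defble_mem_Cls: "X \<in> Cls \<Longrightarrow> defterm s \<Longrightarrow> defble (\<lambda>e. s e \<in> X)"
proof (rule defble_subst1[of "\<lambda>x. x \<in> X"])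
  assume "X \<in> Cls"
  then show "defble (\<lambda>e. e 0 \<in> X)" unfolding defble_def
    by (intro exI[of _ "Mem 0 1"] exI[of _ "case_nat (Inl 0) (\<lambda>_. Inr X)"])
      (auto simp: env_def intro: predicative.intros split: nat.splits)
qed

lemma defble_eq: "defterm s \<Longrightarrow> defterm t \<Longrightarrow> defble (\<lambda>e. s e = t e)"
  by (rule defble_subst2[of "(=)"]) (rule defble_eq_var)

lemma defble_ball: "defterm s \<Longrightarrow> defble (\<lambda>e. P (e 0) (\<lambda>i. e (Suc i))) \<Longrightarrow> defble (\<lambda>e. \<forall>x\<in>ext (s e). P x e)"
  unfolding Ball_def by (rule defble_all, rule defble_imp, rule defble_mem_ext, rule defterm_var, erule defterm_reindex)

lemma defble_bex: "defterm s \<Longrightarrow> defble (\<lambda>e. P (e 0) (\<lambda>i. e (Suc i))) \<Longrightarrow> defble (\<lambda>e. \<exists>x\<in>ext (s e). P x e)"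
  unfolding Bex_def by (rule defble_ex, rule defble_conj, rule defble_mem_ext, rule defterm_var, erule defterm_reindex)

text \<open>By extensionality the graph of t is definable as soon as membership in its values
  is.\<close>

lemma defterm_ext:
  assumes "defble (\<lambda>e. P (e 0) (\<lambda>i. e (Suc i)))" and eq: "\<And>e. ext (t e) = {x. P x e}"
  shows "defterm t"
proof -
  have *: "(y = t e) = (\<forall>x. x \<in> ext y \<longleftrightarrow> P x e)" for y e
    using ext_eq[of y "t e"] unfolding eq by blast
  show ?thesis unfolding defterm_def *
    by (intro defble_all defble_iff defble_mem_ext defterm_var)
      (use defble_reindex[OF assms(1), of "case_nat 0 (\<lambda>i. Suc (Suc i))"] in simp)
qed

lemmas defble_logic = defble_imp defble_not defble_conj defble_disj defble_iff defble_all defble_ex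
  defble_ball defble_bex defble_eq defble_mem_ext defble_mem_Cls

lemma defterm_upair: "defterm s \<Longrightarrow> defterm t \<Longrightarrow> defterm (\<lambda>e. upair (s e) (t e))"
proof (rule defterm_subst2[of upair])
  show "defterm (\<lambda>e. upair (e 0) (e 1))"
    by (rule defterm_ext[of "\<lambda>x e. x = e 0 \<or> x = e 1"])
      (auto intro!: defble_logic defterm_var)
qed

lemma defterm_pair: "defterm s \<Longrightarrow> defterm t \<Longrightarrow> defterm (\<lambda>e. pair (s e) (t e))"
  unfolding pair_def by (intro defterm_upair)

lemmas [definable] = defble_logic defterm_var defterm_const defterm_upair defterm_pair ext_Cls

lemma defble_subset [definable]:
  "defterm s \<Longrightarrow> defterm t \<Longrightarrow> defble (\<lambda>e. ext (s e) \<subseteq> ext (t e))"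
proof (rule defble_subst2[of "\<lambda>x y. ext x \<subseteq> ext y"])
  show "defble (\<lambda>e. ext (e 0) \<subseteq> ext (e 1))" unfolding subset_eq by (intro definable)
qed

section \<open>Natural numbers and finite sequences\<close>

text \<open>Apply Replacement to the identity function restricted to the class of P.\<close>

lemma separation:
  assumes "{x. P x} \<in> Cls"
  shows "\<exists>b. ext b = {x \<in> ext a. P x}"
proof -
  let ?F = "{p. \<exists>x. p = pair x x \<and> x \<in> {x. P x}}"
  have "?F \<in> Cls" by (rule defble_class) (intro definable assms)
  moreover have "Fun ?F" unfolding Fun_def by auto
  ultimately obtain b where "ext b = {z. \<exists>w\<in>ext a. pair w z \<in> ?F}" using replacement by blast
  then show ?thesis by (intro exI[of _ b]) auto
qed

definition cons :: "'a \<Rightarrow> 'a \<Rightarrow> 'a" where "cons x a = the_set (insert x (ext a))"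
definition suc :: "'a \<Rightarrow> 'a" where "suc x = cons x x"
definition upd :: "'a \<Rightarrow> 'a \<Rightarrow> 'a \<Rightarrow> 'a" where
  "upd a v y = the_set (insert (pair v y) {p \<in> ext a. \<not> (\<exists>z. p = pair v z)})"

text \<open>The element is adjoined by taking the union of {a, {x}}.\<close>

lemma ext_cons [simp]: "ext (cons x a) = insert x (ext a)"
proof -
  obtain b where "ext b = \<Union> (ext ` ext (upair a (upair x x)))" using ex_union by blast
  then have "ext b = insert x (ext a)" by auto
  then show ?thesis unfolding cons_def by (intro ext_the_set exI)
qed

lemma ext_suc [simp]: "ext (suc x) = insert x (ext x)"
  by (simp add: suc_def)

lemma ext_upd: "ext (upd a v y) = insert (pair v y) {p \<in> ext a. \<not> (\<exists>z. p = pair v z)}"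
proof -
  have "{p. \<not> (\<exists>z. p = pair v z)} \<in> Cls" by (rule defble_class) (intro definable)
  from separation[OF this] obtain b where "ext b = {p \<in> ext a. \<not> (\<exists>z. p = pair v z)}" by blast
  then have "ext (cons (pair v y) b) = insert (pair v y) {p \<in> ext a. \<not> (\<exists>z. p = pair v z)}" by simp
  then show ?thesis unfolding upd_def by (intro ext_the_set exI)
qed

lemma pair_mem_upd [simp]: "pair w z \<in> ext (upd a v y) \<longleftrightarrow> (if w = v then z = y else pair w z \<in> ext a)"
  by (auto simp: ext_upd)

lemma Fun_upd: "Fun (ext a) \<Longrightarrow> Fun (ext (upd a v y))"
  unfolding Fun_def pair_mem_upd by (auto simp: ext_upd)

lemma Fun_empty: "Fun {}"
  by (simp add: Fun_def)

lemma defterm_suc [definable]: "defterm t \<Longrightarrow> defterm (\<lambda>e. suc (t e))"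
proof (rule defterm_subst1[of suc])
  show "defterm (\<lambda>e. suc (e 0))"
    by (rule defterm_ext[of "\<lambda>x e. x = e 0 \<or> x \<in> ext (e 0)"]) (intro definable, auto simp: ext_upd)
qed

lemma defterm_upd [definable]:
  "defterm s \<Longrightarrow> defterm t \<Longrightarrow> defterm u \<Longrightarrow> defterm (\<lambda>e. upd (s e) (t e) (u e))"
proof (rule defterm_subst3[of upd])
  show "defterm (\<lambda>e. upd (e 0) (e 1) (e 2))"
    by (rule defterm_ext[of "\<lambda>x e. x = pair (e 1) (e 2) \<or> x \<in> ext (e 0) \<and> \<not> (\<exists>z. x = pair (e 1) z)"])
      (intro definable, auto simp: ext_upd)
qed

lemma not_mem_self [simp]: "x \<notin> ext x"
  using foundation[of "upair x x"] by auto

lemma not_mem_cycle: "x \<in> ext y \<Longrightarrow> y \<notin> ext x"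
  using foundation[of "upair x y"] by auto

text \<open>Otherwise x and y would be members of each other, which Foundation forbids.\<close>

lemma suc_eq [simp]: "suc x = suc y \<longleftrightarrow> x = y"
  by (metis ext_suc insertE insertI1 not_mem_cycle)

lemma suc_neq_emp [simp]: "suc x \<noteq> emp" "emp \<noteq> suc x"
  by (metis ext_emp ext_suc insert_not_empty)+

lemma suc_neq_self [simp]: "suc x \<noteq> x" "x \<noteq> suc x"
  by (metis ext_suc insertI1 not_mem_self)+

text \<open>Foundation is available for sets, so the class is first cut down to a. Used with a =
  \<open>suc n\<close> it replaces the least number principle.\<close>

lemma foundation_class:
  assumes "{x. P x} \<in> Cls" "x \<in> ext a" "P x"
  obtains m where "m \<in> ext a" "P m" "\<And>y. y \<in> ext m \<Longrightarrow> y \<in> ext a \<Longrightarrow> \<not> P y"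
proof -
  obtain b where b: "ext b = {x \<in> ext a. P x}" using separation[OF assms(1)] by blast
  then have "ext b \<noteq> {}" using assms(2,3) by blast
  then obtain m where m: "m \<in> ext b" "ext b \<inter> ext m = {}" using foundation by blast
  show thesis by (rule that[of m]) (use m in \<open>auto simp: b\<close>)
qed

definition transitive :: "'a \<Rightarrow> bool" where
  "transitive x \<longleftrightarrow> (\<forall>y\<in>ext x. ext y \<subseteq> ext x)"

definition Nat :: "'a \<Rightarrow> bool" where
  "Nat x \<longleftrightarrow> transitive x \<and> (\<forall>y\<in>ext x. transitive y) \<and>
    (\<forall>y. y \<in> ext x \<or> y = x \<longrightarrow> y = emp \<or> (\<exists>z. y = suc z))"

lemma defble_Nat [definable]: "defterm t \<Longrightarrow> defble (\<lambda>e. Nat (t e))"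
proof (rule defble_subst1[of Nat])
  show "defble (\<lambda>e. Nat (e 0))" unfolding Nat_def transitive_def by (intro definable)
qed

lemma Nat_emp [simp]: "Nat emp"
  by (simp add: Nat_def transitive_def)

lemma Nat_suc [simp]: "Nat n \<Longrightarrow> Nat (suc n)"
  unfolding Nat_def transitive_def by auto

lemma Nat_trans: "Nat n \<Longrightarrow> m \<in> ext n \<Longrightarrow> x \<in> ext m \<Longrightarrow> x \<in> ext n"
  unfolding Nat_def transitive_def by blast

lemma Nat_mem: "Nat n \<Longrightarrow> m \<in> ext n \<Longrightarrow> Nat m"
  unfolding Nat_def transitive_def by blast

lemma Nat_cases:
  assumes "Nat n"
  obtains "n = emp" | m where "n = suc m" "Nat m"
  using assms Nat_mem[OF assms] unfolding Nat_def[of n] by auto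

text \<open>Naturals of the model may be nonstandard, so the property has to be a class; a minimal
  counterexample is sought in \<open>suc n\<close>.\<close>

lemma Nat_induct:
  assumes cls: "{x. P x} \<in> Cls" and "Nat n"
    and "P emp" and step: "\<And>m. Nat m \<Longrightarrow> P m \<Longrightarrow> P (suc m)"
  shows "P n"
proof (rule ccontr)
  assume "\<not> P n"
  \<comment> \<open>P enters only through the class \<open>{x. P x}\<close>, used as a parameter;
    this phrasing lets \<open>definable\<close> see it.\<close>
  have "{x. \<not> x \<in> {x. P x}} \<in> Cls" by (rule defble_class) (intro definable cls)
  then obtain m where m: "m \<in> ext (suc n)" "\<not> P m" "\<And>y. y \<in> ext m \<Longrightarrow> y \<in> ext (suc n) \<Longrightarrow> P y"
    using foundation_class[of "\<lambda>x. \<not> P x" n "suc n"] \<open>\<not> P n\<close> by auto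
  have "Nat m" using m(1) \<open>Nat n\<close> Nat_mem Nat_suc by blast
  then show False
  proof (cases rule: Nat_cases)
    case 1
    then show False using m(2) \<open>P emp\<close> by simp
  next
    case (2 k)
    \<comment> \<open>By transitivity the predecessor k also lies in \<open>suc n\<close>, so
      minimality of m yields P k.\<close>
    then have "k \<in> ext (suc n)" using m(1) Nat_trans[OF Nat_suc[OF \<open>Nat n\<close>] m(1), of k] by simp
    then show False using 2 m(2,3) step by simp
  qed
qed

section \<open>Finite sequences and chains inside the model\<close>

definition Seq :: "'a \<Rightarrow> 'a \<Rightarrow> bool" where
  "Seq f n \<longleftrightarrow> Nat n \<and> Fun (ext f) \<and> (\<forall>i. (\<exists>y. pair i y \<in> ext f) \<longleftrightarrow> i \<in> ext n \<or> i = n)"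

text \<open>The shape copies \<open>chain\<close> literally, down to the variable j for
  \<open>suc i\<close>, so that evaluating the formula is mere unfolding.\<close>

definition Chain :: "('a \<Rightarrow> 'a \<Rightarrow> bool) \<Rightarrow> 'a \<Rightarrow> 'a \<Rightarrow> bool" where
  "Chain R x y \<longleftrightarrow> (\<exists>f n. Seq f n \<and> pair emp x \<in> ext f \<and> pair n y \<in> ext f \<and>
    (\<forall>i j a b. i \<in> ext n \<and> j = suc i \<and> pair i a \<in> ext f \<and> pair j b \<in> ext f \<longrightarrow> R a b))"

lemma defble_Fun [definable]: "defterm t \<Longrightarrow> defble (\<lambda>e. Fun (ext (t e)))"
proof (rule defble_subst1[of "\<lambda>x. Fun (ext x)"])
  show "defble (\<lambda>e. Fun (ext (e 0)))" unfolding Fun_def by (intro definable)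
qed

lemma defble_Seq [definable]: "defterm s \<Longrightarrow> defterm t \<Longrightarrow> defble (\<lambda>e. Seq (s e) (t e))"
proof (rule defble_subst2[of Seq])
  show "defble (\<lambda>e. Seq (e 0) (e 1))" unfolding Seq_def by (intro definable)
qed

text \<open>R carries one set parameter, as \<open>Free_step\<close> needs; relations without one
  ignore it.\<close>

lemma defble_Chain:
  assumes R: "defble (\<lambda>e. R (e 0) (e 1) (e 2))" and "defterm s" "defterm t" "defterm u"
  shows "defble (\<lambda>e. Chain (R (s e)) (t e) (u e))"
proof (rule defble_subst3[OF _ assms(2-4), of "\<lambda>v. Chain (R v)"])
  show "defble (\<lambda>e. Chain (R (e 0)) (e 1) (e 2))"
    unfolding Chain_def by (intro definable defble_subst3[OF R])
qed

lemma Chain_refl: "Chain R x x"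
  unfolding Chain_def
proof (intro exI conjI)
  \<comment> \<open>The witness is the one-term sequence {(0, x)}; domains include the last index,
    so its index bound is 0.\<close>
  show "Seq (upd emp emp x) emp" unfolding Seq_def by (auto simp: Fun_upd Fun_empty)
qed auto

lemma Chain_step:
  assumes "Chain R x y" "R y z"
  shows "Chain R x z"
proof -
  obtain f n where f: "Seq f n" "pair emp x \<in> ext f" "pair n y \<in> ext f"
    "\<And>i a b. i \<in> ext n \<Longrightarrow> pair i a \<in> ext f \<Longrightarrow> pair (suc i) b \<in> ext f \<Longrightarrow> R a b"
    using assms(1) unfolding Chain_def by blast
  have n: "Nat n" "Fun (ext f)" and dom: "\<And>i. (\<exists>y. pair i y \<in> ext f) \<longleftrightarrow> i \<in> ext n \<or> i = n"
    using f(1) unfolding Seq_def by auto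
  \<comment> \<open>The domain of f is {0, ..., n}, so the new entry at \<open>suc n\<close>
    overwrites nothing.\<close>
  have notin: "pair (suc n) a \<notin> ext f" for a
    using dom[of "suc n"] not_mem_cycle[of n "suc n"] by (metis ext_suc insertI1 not_mem_self)
  let ?f = "upd f (suc n) z"
  show ?thesis unfolding Chain_def
  proof (intro exI conjI allI impI)
    show "Seq ?f (suc n)"
      unfolding Seq_def pair_mem_upd using n dom notin by (auto simp: Fun_upd)
    show "pair emp x \<in> ext ?f" using f(2) by simp
    show "pair (suc n) z \<in> ext ?f" by simp
    fix i j a b
    assume "i \<in> ext (suc n) \<and> j = suc i \<and> pair i a \<in> ext ?f \<and> pair j b \<in> ext ?f"
    then have ij: "i \<in> ext n \<or> i = n" "pair i a \<in> ext ?f" "pair (suc i) b \<in> ext ?f" by auto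
    from ij(1) have "i \<noteq> suc n" using not_mem_cycle[of n "suc n"] by auto
    with ij(2) have a: "pair i a \<in> ext f" by simp
    from ij(1) show "R a b"
    proof
      assume "i \<in> ext n"
      then have "i \<noteq> n" by auto
      with ij(3) have "pair (suc i) b \<in> ext f" by simp
      with \<open>i \<in> ext n\<close> a show "R a b" using f(4) by blast
    next
      assume "i = n"
      then have "b = z" "a = y" using ij(3) a f(3) n(2)
        by (auto simp: Fun_def)
      then show "R a b" using assms(2) by simp
    qed
  qed
qed

text \<open>The length n may be nonstandard, so the induction runs over the indices inside the model
  and requires P to be a class.\<close>

lemma Chain_induct:
  assumes "Chain R x y" and cls: "{z. P z} \<in> Cls" and "P x"
    and step: "\<And>a b. P a \<Longrightarrow> R a b \<Longrightarrow> P b"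
  shows "P y"
proof -
  obtain f n where f: "Seq f n" "pair emp x \<in> ext f" "pair n y \<in> ext f"
    "\<And>i a b. i \<in> ext n \<Longrightarrow> pair i a \<in> ext f \<Longrightarrow> pair (suc i) b \<in> ext f \<Longrightarrow> R a b"
    using assms(1) unfolding Chain_def by blast
  have n: "Nat n" "Fun (ext f)" and dom: "\<And>i. (\<exists>y. pair i y \<in> ext f) \<longleftrightarrow> i \<in> ext n \<or> i = n"
    using f(1) unfolding Seq_def by auto
  \<comment> \<open>Membership in \<open>suc n\<close> expresses that an index is at most n; beyond
    n the property is vacuous.\<close>
  have "\<forall>a. n \<in> ext (suc n) \<longrightarrow> pair n a \<in> ext f \<longrightarrow> a \<in> {z. P z}"
  proof (rule Nat_induct[OF _ n(1), where P="\<lambda>i. \<forall>a. i \<in> ext (suc n) \<longrightarrow> pair i a \<in> ext f \<longrightarrow> a \<in> {z. P z}"])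
    show "{i. \<forall>a. i \<in> ext (suc n) \<longrightarrow> pair i a \<in> ext f \<longrightarrow> a \<in> {z. P z}} \<in> Cls"
      by (rule defble_class) (intro definable cls)
    show "\<forall>a. emp \<in> ext (suc n) \<longrightarrow> pair emp a \<in> ext f \<longrightarrow> a \<in> {z. P z}"
      using f(2) \<open>P x\<close> n(2) unfolding Fun_def by blast
    fix i assume i: "Nat i" "\<forall>a. i \<in> ext (suc n) \<longrightarrow> pair i a \<in> ext f \<longrightarrow> a \<in> {z. P z}"
    show "\<forall>b. suc i \<in> ext (suc n) \<longrightarrow> pair (suc i) b \<in> ext f \<longrightarrow> b \<in> {z. P z}"
    proof (intro allI impI)
      fix b assume b: "suc i \<in> ext (suc n)" "pair (suc i) b \<in> ext f"
      then have "i \<in> ext n" using Nat_trans[OF n(1), of "suc i" i] by auto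
      then obtain a where a: "pair i a \<in> ext f" using dom[of i] by blast
      then have "P a" using i(2) \<open>i \<in> ext n\<close> by simp
      then show "b \<in> {z. P z}" using step f(4) \<open>i \<in> ext n\<close> a b(2) by blast
    qed
  qed
  then show ?thesis using f(3) by simp
qed

text \<open>Inversion at the last step. Either alternative for a gives \<open>Chain R x a\<close>,
  which is all that the next step requires.\<close>

lemma Chain_cases:
  assumes R: "defble (\<lambda>e. R (e 0) (e 1))" and "Chain R x y"
  obtains "x = y" | z where "Chain R x z" "R z y"
proof -
  have "x = y \<or> (\<exists>z. Chain R x z \<and> R z y)"
  proof (rule Chain_induct[OF assms(2)])
    show "{y. x = y \<or> (\<exists>z. Chain R x z \<and> R z y)} \<in> Cls"
      by (rule defble_class)
        (intro definable defble_subst2[OF R] defble_Chain[of "\<lambda>_. R" "\<lambda>e. x"] defble_reindex[OF R, of Suc, simplified])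
    show "x = b \<or> (\<exists>z. Chain R x z \<and> R z b)" if "x = a \<or> (\<exists>z. Chain R x z \<and> R z a)" "R a b" for a b
      using that by (blast intro: Chain_refl Chain_step)
  qed simp
  then show thesis using that by blast
qed

lemma Chain_trans:
  assumes R: "defble (\<lambda>e. R (e 0) (e 1))" and "Chain R x y" "Chain R y z"
  shows "Chain R x z"
proof (rule Chain_induct[OF assms(3)])
  show "{z. Chain R x z} \<in> Cls"
    by (rule defble_class)
      (intro definable defble_subst2[OF R] defble_Chain[of "\<lambda>_. R" "\<lambda>e. x"])
qed (fact assms, blast intro: Chain_step)

section \<open>Finite sets inside the model\<close>

definition Fin :: "'a \<Rightarrow> bool" where
  "Fin x \<longleftrightarrow> (\<exists>n f. Nat n \<and> Fun (ext f) \<and> (\<forall>i. i \<in> ext n \<longleftrightarrow> (\<exists>y. pair i y \<in> ext f)) \<and>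
    (\<forall>y. y \<in> ext x \<longleftrightarrow> (\<exists>i. pair i y \<in> ext f)) \<and>
    (\<forall>i j y. pair i y \<in> ext f \<and> pair j y \<in> ext f \<longrightarrow> i = j))"

lemma defble_Fin [definable]: "defterm t \<Longrightarrow> defble (\<lambda>e. Fin (t e))"
proof (rule defble_subst1[of Fin])
  show "defble (\<lambda>e. Fin (e 0))" unfolding Fin_def by (intro definable)
qed

lemma Fin_emp: "Fin emp"
  unfolding Fin_def by (intro exI[of _ emp]) (simp add: Fun_empty)

text \<open>An old entry at v is replaced at its own place in the enumeration; if v is new, the
  enumeration is prolonged.\<close>

lemma Fin_upd:
  assumes "Fun (ext a)" "Fin a"
  shows "Fin (upd a v y)"
proof -
  obtain n f where n: "Nat n" and f: "Fun (ext f)" "\<And>i. i \<in> ext n \<longleftrightarrow> (\<exists>y. pair i y \<in> ext f)"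
    "\<And>y. y \<in> ext a \<longleftrightarrow> (\<exists>i. pair i y \<in> ext f)"
    "\<And>i j y. pair i y \<in> ext f \<Longrightarrow> pair j y \<in> ext f \<Longrightarrow> i = j"
    using assms(2) unfolding Fin_def by blast
  show ?thesis
  proof (cases "\<exists>z. pair v z \<in> ext a")
    case True
    then obtain z i where z: "pair v z \<in> ext a" "pair i (pair v z) \<in> ext f" using f(3) by blast
    have uniq: "z' = z" if "pair v z' \<in> ext a" for z' using that z(1) assms(1) unfolding Fun_def by blast
    have i: "p = pair v z" if "pair i p \<in> ext f" for p using that z(2) f(1) unfolding Fun_def by blast
    show ?thesis unfolding Fin_def
    proof (rule exI[of _ n], rule exI[of _ "upd f i (pair v y)"], intro conjI allI impI)
      show "j \<in> ext n \<longleftrightarrow> (\<exists>x. pair j x \<in> ext (upd f i (pair v y)))" for j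
        unfolding pair_mem_upd using f(2) z(2) by auto
      show "p \<in> ext (upd a v y) \<longleftrightarrow> (\<exists>j. pair j p \<in> ext (upd f i (pair v y)))" for p
      proof
        assume "p \<in> ext (upd a v y)"
        then consider "p = pair v y" | "p \<in> ext a" "\<not> (\<exists>z. p = pair v z)" unfolding ext_upd by blast
        then show "\<exists>j. pair j p \<in> ext (upd f i (pair v y))"
        proof cases
          case 2
          then obtain j where j: "pair j p \<in> ext f" using f(3) by blast
          then have "j \<noteq> i" using i 2(2) by blast
          then show ?thesis using j by auto
        qed auto
      next
        assume "\<exists>j. pair j p \<in> ext (upd f i (pair v y))"
        then obtain j where "j = i \<and> p = pair v y \<or> j \<noteq> i \<and> pair j p \<in> ext f"
          unfolding pair_mem_upd by (auto split: if_splits)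
        then show "p \<in> ext (upd a v y)"
        proof
          assume j: "j \<noteq> i \<and> pair j p \<in> ext f"
          then have "p \<noteq> pair v z" using f(4)[OF z(2)] by blast
          moreover have "p \<in> ext a" using j f(3) by blast
          ultimately show ?thesis unfolding ext_upd using uniq by blast
        qed (simp add: ext_upd)
      qed
      show "j = k" if "pair j p \<in> ext (upd f i (pair v y)) \<and> pair k p \<in> ext (upd f i (pair v y))" for j k p
      proof -
        have "j = i" if "pair j (pair v y) \<in> ext f" for j
          using that f(3,4) uniq z(2) by blast
        then show ?thesis using that f(4) unfolding pair_mem_upd by (auto split: if_splits)
      qed
    qed (auto intro: Nat_suc n Fun_upd f(1))
  next
    case False
    \<comment> \<open>Here the domain of f is {0, ..., n - 1}, unlike in \<open>Seq\<close>, so n is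
      the first free place.\<close>
    have dom: "pair n p \<notin> ext f" for p using f(2)[of n] by auto
    show ?thesis unfolding Fin_def
    proof (rule exI[of _ "suc n"], rule exI[of _ "upd f n (pair v y)"], intro conjI allI impI)
      show "j \<in> ext (suc n) \<longleftrightarrow> (\<exists>x. pair j x \<in> ext (upd f n (pair v y)))" for j
        unfolding pair_mem_upd using f(2) by auto
      show "p \<in> ext (upd a v y) \<longleftrightarrow> (\<exists>j. pair j p \<in> ext (upd f n (pair v y)))" for p
        unfolding pair_mem_upd ext_upd[of a] using f(3) False dom by auto metis
      show "j = k" if "pair j p \<in> ext (upd f n (pair v y)) \<and> pair k p \<in> ext (upd f n (pair v y))" for j k p
      proof -
        have "pair j (pair v y) \<notin> ext f" for j using f(3) False by blast
        then show ?thesis using that f(4) unfolding pair_mem_upd by (auto split: if_splits)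
      qed
    qed (auto intro: Nat_suc n Fun_upd f(1))
  qed
qed

section \<open>Coded formulas\<close>

primrec num :: "nat \<Rightarrow> 'a" where
  "num 0 = emp"
| "num (Suc k) = suc (num k)"

lemma num_eq [simp]: "num j = num k \<longleftrightarrow> j = k"
proof (induction j arbitrary: k)
  case 0
  then show ?case by (cases k) simp_all
next
  case (Suc j)
  then show ?case by (cases k) simp_all
qed

definition memc :: "'a \<Rightarrow> 'a \<Rightarrow> 'a" where "memc i j = pair (num 0) (pair i j)"
definition eqc :: "'a \<Rightarrow> 'a \<Rightarrow> 'a" where "eqc i j = pair (num 1) (pair i j)"
definition negc :: "'a \<Rightarrow> 'a" where "negc a = pair (num 2) a"
definition impc :: "'a \<Rightarrow> 'a \<Rightarrow> 'a" where "impc a b = pair (num 3) (pair a b)"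
definition allc :: "'a \<Rightarrow> 'a \<Rightarrow> 'a" where "allc i a = pair (num 4) (pair i a)"

lemmas code_defs = memc_def eqc_def negc_def impc_def allc_def

lemma code_eq [simp]:
  "memc i j = memc i' j' \<longleftrightarrow> i = i' \<and> j = j'" "memc i j \<noteq> eqc i' j'" "memc i j \<noteq> negc a'"
  "memc i j \<noteq> impc a' b'" "memc i j \<noteq> allc i' a'"
  "eqc i j = eqc i' j' \<longleftrightarrow> i = i' \<and> j = j'" "eqc i j \<noteq> memc i' j'" "eqc i j \<noteq> negc a'"
  "eqc i j \<noteq> impc a' b'" "eqc i j \<noteq> allc i' a'"
  "negc a = negc a' \<longleftrightarrow> a = a'" "negc a \<noteq> memc i' j'" "negc a \<noteq> eqc i' j'"
  "negc a \<noteq> impc a' b'" "negc a \<noteq> allc i' a'"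
  "impc a b = impc a' b' \<longleftrightarrow> a = a' \<and> b = b'" "impc a b \<noteq> memc i' j'" "impc a b \<noteq> eqc i' j'"
  "impc a b \<noteq> negc a'" "impc a b \<noteq> allc i' a'"
  "allc i a = allc i' a' \<longleftrightarrow> i = i' \<and> a = a'" "allc i a \<noteq> memc i' j'" "allc i a \<noteq> eqc i' j'"
  "allc i a \<noteq> negc a''" "allc i a \<noteq> impc a'' b''"
  unfolding code_defs pair_eq num_eq by auto

lemma defterm_codes [definable]:
  "defterm s \<Longrightarrow> defterm t \<Longrightarrow> defterm (\<lambda>e. memc (s e) (t e))"
  "defterm s \<Longrightarrow> defterm t \<Longrightarrow> defterm (\<lambda>e. eqc (s e) (t e))"
  "defterm s \<Longrightarrow> defterm (\<lambda>e. negc (s e))"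
  "defterm s \<Longrightarrow> defterm t \<Longrightarrow> defterm (\<lambda>e. impc (s e) (t e))"
  "defterm s \<Longrightarrow> defterm t \<Longrightarrow> defterm (\<lambda>e. allc (s e) (t e))"
  unfolding code_defs by (intro definable; assumption)+

definition Formula :: "'a \<Rightarrow> bool" where
  "Formula c \<longleftrightarrow> (\<exists>f n. Seq f n \<and> pair n c \<in> ext f \<and> (\<forall>i d. pair i d \<in> ext f \<longrightarrow>
    (\<exists>u v. Nat u \<and> Nat v \<and> (d = memc u v \<or> d = eqc u v)) \<or>
    (\<exists>j a. j \<in> ext i \<and> pair j a \<in> ext f \<and> d = negc a) \<or>
    (\<exists>j k a b. j \<in> ext i \<and> k \<in> ext i \<and> pair j a \<in> ext f \<and> pair k b \<in> ext f \<and> d = impc a b) \<or>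
    (\<exists>u j a. Nat u \<and> j \<in> ext i \<and> pair j a \<in> ext f \<and> d = allc u a)))"

lemma defble_Formula [definable]: "defterm t \<Longrightarrow> defble (\<lambda>e. Formula (t e))"
proof (rule defble_subst1[of Formula])
  show "defble (\<lambda>e. Formula (e 0))" unfolding Formula_def by (intro definable)
qed

text \<open>Structural recursion is impossible for nonstandard codes. A minimal index of the
  construction sequence whose entry violates P gives the contradiction, since its parts stand at
  smaller indices.\<close>

lemma Formula_induct:
  assumes "Formula c" and cls: "{x. P x} \<in> Cls"
    and "\<And>i j. Nat i \<Longrightarrow> Nat j \<Longrightarrow> P (memc i j)" "\<And>i j. Nat i \<Longrightarrow> Nat j \<Longrightarrow> P (eqc i j)"
    and "\<And>a. P a \<Longrightarrow> P (negc a)" "\<And>a b. P a \<Longrightarrow> P b \<Longrightarrow> P (impc a b)"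
    and "\<And>i a. Nat i \<Longrightarrow> P a \<Longrightarrow> P (allc i a)"
  shows "P c"
proof (rule ccontr)
  assume "\<not> P c"
  obtain f n where f: "Seq f n" "pair n c \<in> ext f" and parts: "\<forall>i d. pair i d \<in> ext f \<longrightarrow>
    (\<exists>u v. Nat u \<and> Nat v \<and> (d = memc u v \<or> d = eqc u v)) \<or>
    (\<exists>j a. j \<in> ext i \<and> pair j a \<in> ext f \<and> d = negc a) \<or>
    (\<exists>j k a b. j \<in> ext i \<and> k \<in> ext i \<and> pair j a \<in> ext f \<and> pair k b \<in> ext f \<and> d = impc a b) \<or>
    (\<exists>u j a. Nat u \<and> j \<in> ext i \<and> pair j a \<in> ext f \<and> d = allc u a)"
    using assms(1) unfolding Formula_def by blast
  have "{i. \<exists>d. pair i d \<in> ext f \<and> \<not> d \<in> {x. P x}} \<in> Cls"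
    by (rule defble_class) (intro definable cls)
  then have "{i. \<exists>d. pair i d \<in> ext f \<and> \<not> P d} \<in> Cls" by simp
  moreover have "n \<in> ext (suc n)" "\<exists>d. pair n d \<in> ext f \<and> \<not> P d" using f(2) \<open>\<not> P c\<close> by auto
  ultimately obtain i where "i \<in> ext (suc n)" "\<exists>d. pair i d \<in> ext f \<and> \<not> P d"
    and "\<And>j. j \<in> ext i \<Longrightarrow> j \<in> ext (suc n) \<Longrightarrow> \<not> (\<exists>a. pair j a \<in> ext f \<and> \<not> P a)"
    by (rule foundation_class) blast
  then obtain d where i: "i \<in> ext (suc n)" "pair i d \<in> ext f" "\<not> P d"
    and least: "\<And>j a. j \<in> ext i \<Longrightarrow> j \<in> ext (suc n) \<Longrightarrow> pair j a \<in> ext f \<Longrightarrow> P a"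
    by blast
  have "Nat (suc n)" using f(1) by (simp add: Seq_def)
  then have IH: "P a" if "j \<in> ext i" "pair j a \<in> ext f" for j a
    using that least i(1) Nat_trans by blast
  have "P d" using parts[rule_format, OF i(2)]
    by (elim disjE exE conjE) (simp_all add: assms(3-7) IH)
  then show False using i(3) by contradiction
qed

section \<open>Subformulas and free variables\<close>

definition Imm :: "'a \<Rightarrow> 'a \<Rightarrow> bool" where
  "Imm a c \<longleftrightarrow> c = negc a \<or> (\<exists>b. c = impc a b \<or> c = impc b a) \<or> (\<exists>u. Nat u \<and> c = allc u a)"

definition Sub :: "'a \<Rightarrow> 'a \<Rightarrow> bool" where "Sub = Chain Imm"

definition Free_step :: "'a \<Rightarrow> 'a \<Rightarrow> 'a \<Rightarrow> bool" where
  "Free_step v d e \<longleftrightarrow> e = negc d \<or> (\<exists>b. e = impc d b \<or> e = impc b d) \<or>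
    (\<exists>u. Nat u \<and> \<not> u = v \<and> e = allc u d)"

definition Free :: "'a \<Rightarrow> 'a \<Rightarrow> bool" where
  "Free v c \<longleftrightarrow> Nat v \<and> (\<exists>a. (\<exists>u. Nat u \<and> (a = memc u v \<or> a = memc v u \<or> a = eqc u v \<or> a = eqc v u)) \<and>
    Chain (Free_step v) a c)"

lemma defble_Imm: "defble (\<lambda>e. Imm (e 0) (e 1))"
  unfolding Imm_def by (intro definable)

lemma defble_Free_step: "defble (\<lambda>e. Free_step (e 0) (e 1) (e 2))"
  unfolding Free_step_def by (intro definable)

lemma defble_Sub [definable]: "defterm s \<Longrightarrow> defterm t \<Longrightarrow> defble (\<lambda>e. Sub (s e) (t e))"
  unfolding Sub_def
  by (rule defble_Chain[of "\<lambda>_. Imm", OF _ defterm_const])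
    (use defble_reindex[OF defble_Imm, of Suc] in \<open>simp_all add: numeral_2_eq_2\<close>)

lemma defble_Free [definable]: "defterm s \<Longrightarrow> defterm t \<Longrightarrow> defble (\<lambda>e. Free (s e) (t e))"
proof (rule defble_subst2[of Free])
  show "defble (\<lambda>e. Free (e 0) (e 1))"
    unfolding Free_def by (intro definable defble_Chain[OF defble_Free_step])
qed

lemma Sub_refl: "Sub c c"
  unfolding Sub_def by (rule Chain_refl)

lemma Sub_Imm: "Imm a b \<Longrightarrow> Sub b c \<Longrightarrow> Sub a c"
  unfolding Sub_def by (blast intro: Chain_trans[OF defble_Imm] Chain_step Chain_refl)

lemma Sub_parts:
  "Sub (negc a) c \<Longrightarrow> Sub a c" "Sub (impc a b) c \<Longrightarrow> Sub a c" "Sub (impc a b) c \<Longrightarrow> Sub b c"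
  "Nat u \<Longrightarrow> Sub (allc u a) c \<Longrightarrow> Sub a c"
  by (erule Sub_Imm[rotated], simp add: Imm_def; blast)+

text \<open>No step ends in an atomic code, so the chain from the atom has no steps.\<close>

lemma Free_atom:
  assumes "Nat i" "Nat j"
  shows "Free v (memc i j) \<longleftrightarrow> v = i \<or> v = j" "Free v (eqc i j) \<longleftrightarrow> v = i \<or> v = j"
proof -
  have R: "defble (\<lambda>e. Free_step v (e 0) (e 1))" unfolding Free_step_def by (intro definable)
  have *: "Chain (Free_step v) a c \<longleftrightarrow> a = c" if "c = memc i j \<or> c = eqc i j" for a c
  proof
    assume "Chain (Free_step v) a c"
    then show "a = c" by (rule Chain_cases[OF R]) (use that in \<open>auto simp: Free_step_def\<close>)
  qed (simp add: Chain_refl)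
  show "Free v (memc i j) \<longleftrightarrow> v = i \<or> v = j" "Free v (eqc i j) \<longleftrightarrow> v = i \<or> v = j"
    unfolding Free_def using assms by (auto simp: *)
qed

text \<open>A compound code is not atomic, so the chain has a last step, and injectivity of the
  codes determines the part from which it comes.\<close>

lemma Free_compound:
  "Free v (negc a) \<longleftrightarrow> Free v a"
  "Free v (impc a b) \<longleftrightarrow> Free v a \<or> Free v b"
  "Nat u \<Longrightarrow> Free v (allc u a) \<longleftrightarrow> v \<noteq> u \<and> Free v a"
proof -
  have R: "defble (\<lambda>e. Free_step v (e 0) (e 1))" unfolding Free_step_def by (intro definable)
  have step: "Free v e" if "Free v d" "Free_step v d e" for d e
    using that Chain_step unfolding Free_def by blast
  have cases: "\<exists>d. Free v d \<and> Free_step v d e" if "Free v e" "e = negc a \<or> e = impc a b \<or> e = allc u a" for e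
  proof -
    from that(1) obtain d where d: "Nat v"
      "\<exists>u. Nat u \<and> (d = memc u v \<or> d = memc v u \<or> d = eqc u v \<or> d = eqc v u)" "Chain (Free_step v) d e"
      unfolding Free_def by blast
    from d(3) show ?thesis
      by (rule Chain_cases[OF R]) (use d(1,2) that(2) in \<open>auto simp: Free_def\<close>)
  qed
  show "Free v (negc a) \<longleftrightarrow> Free v a"
    using cases[of "negc a"] step[of a "negc a"] by (auto simp: Free_step_def)
  show "Free v (impc a b) \<longleftrightarrow> Free v a \<or> Free v b"
    using cases[of "impc a b"] step[of a "impc a b"] step[of b "impc a b"] by (auto simp: Free_step_def)
  show "Free v (allc u a) \<longleftrightarrow> v \<noteq> u \<and> Free v a" if "Nat u"
    using that cases[of "allc u a"] step[of a "allc u a"] by (auto simp: Free_step_def)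
qed

primrec tcode :: "(var \<Rightarrow> 'a) \<Rightarrow> template \<Rightarrow> 'a" where
  "tcode \<nu> (TMem i j) = memc (\<nu> i) (\<nu> j)"
| "tcode \<nu> (TEq i j) = eqc (\<nu> i) (\<nu> j)"
| "tcode \<nu> (TNeg s) = negc (tcode \<nu> s)"
| "tcode \<nu> (TImp s t) = impc (tcode \<nu> s) (tcode \<nu> t)"
| "tcode \<nu> (TAll i s) = allc (\<nu> i) (tcode \<nu> s)"
| "tcode \<nu> (TSub d) = \<nu> d"

section \<open>The axioms of S as properties of codes\<close>

definition distinct_Nats :: "'a list \<Rightarrow> bool" where
  "distinct_Nats xs \<longleftrightarrow> (\<forall>x\<in>set xs. Nat x) \<and> distinct xs"

definition Sentence :: "'a \<Rightarrow> bool" where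
  "Sentence c \<longleftrightarrow> Formula c \<and> \<not> (\<exists>v. Free v c)"

definition All_step :: "'a \<Rightarrow> 'a \<Rightarrow> bool" where
  "All_step d e \<longleftrightarrow> (\<exists>u. Nat u \<and> e = allc u d)"

definition Universal_closure :: "'a \<Rightarrow> 'a \<Rightarrow> bool" where
  "Universal_closure c a \<longleftrightarrow> Sentence c \<and> Chain All_step a c"

text \<open>Here and in the following axioms template variables are positions in a list of values,
  whereas in \<open>isExtensionality\<close> and its companions they are levels. Computing
  \<open>tcode\<close> removes the difference.\<close>

definition Ext_axiom :: "'a \<Rightarrow> bool" where
  "Ext_axiom c \<longleftrightarrow> (\<exists>x y z. distinct_Nats [x, y, z] \<and> c = tcode ((!) [x, y, z])
    (TAll 0 (TAll 1 (TImp (TAll 2 (TIff (TMem 2 0) (TMem 2 1))) (TEq 0 1)))))"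

definition Empty_axiom :: "'a \<Rightarrow> bool" where
  "Empty_axiom c \<longleftrightarrow> (\<exists>x y. distinct_Nats [x, y] \<and> c = tcode ((!) [x, y])
    (TEx 0 (TAll 1 (TNeg (TMem 1 0)))))"

definition Pairing_axiom :: "'a \<Rightarrow> bool" where
  "Pairing_axiom c \<longleftrightarrow> (\<exists>x y z w. distinct_Nats [x, y, z, w] \<and> c = tcode ((!) [x, y, z, w])
    (TAll 0 (TAll 1 (TEx 2 (TAll 3 (TIff (TMem 3 2) (TDisj (TEq 3 0) (TEq 3 1))))))))"

definition Union_axiom :: "'a \<Rightarrow> bool" where
  "Union_axiom c \<longleftrightarrow> (\<exists>x y z w. distinct_Nats [x, y, z, w] \<and> c = tcode ((!) [x, y, z, w])
    (TAll 0 (TEx 1 (TAll 2 (TIff (TMem 2 1) (TEx 3 (TConj (TMem 3 0) (TMem 2 3))))))))"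

definition Power_axiom :: "'a \<Rightarrow> bool" where
  "Power_axiom c \<longleftrightarrow> (\<exists>x y z w. distinct_Nats [x, y, z, w] \<and> c = tcode ((!) [x, y, z, w])
    (TAll 0 (TEx 1 (TAll 2 (TIff (TMem 2 1) (TAll 3 (TImp (TMem 3 2) (TMem 3 0))))))))"

definition Foundation_axiom :: "'a \<Rightarrow> bool" where
  "Foundation_axiom c \<longleftrightarrow> (\<exists>x y z. distinct_Nats [x, y, z] \<and> c = tcode ((!) [x, y, z])
    (TAll 0 (TImp (TEx 1 (TMem 1 0))
      (TEx 1 (TConj (TMem 1 0) (TAll 2 (TImp (TMem 2 0) (TNeg (TMem 2 1)))))))))"

definition Separation_axiom :: "'a \<Rightarrow> bool" where
  "Separation_axiom c \<longleftrightarrow> (\<exists>d x y z a. Formula d \<and> distinct_Nats [x, y, z] \<and> \<not> Free y d \<and>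
    a = tcode ((!) [x, y, z, d])
      (TAll 2 (TEx 1 (TAll 0 (TIff (TMem 0 1) (TConj (TMem 0 2) (TSub 3)))))) \<and>
    Universal_closure c a)"

definition Replacement_axiom :: "'a \<Rightarrow> bool" where
  "Replacement_axiom c \<longleftrightarrow> (\<exists>d x y z u w a. Formula d \<and> distinct_Nats [x, y, z, u, w] \<and>
    \<not> Free z d \<and> \<not> Free w d \<and>
    a = tcode ((!) [x, y, z, u, w, d])
      (TAll 3 (TImp
        (TAll 0 (TEx 2 (TAll 1 (TImp (TSub 5) (TEq 1 2)))))
        (TEx 4 (TAll 1 (TIff (TMem 1 4) (TEx 0 (TConj (TMem 0 3) (TSub 5)))))))) \<and>
    Universal_closure c a)"

definition Axiom_S :: "'a \<Rightarrow> bool" where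
  "Axiom_S c \<longleftrightarrow> Ext_axiom c \<or> Empty_axiom c \<or> Pairing_axiom c \<or> Union_axiom c \<or> Power_axiom c \<or>
    Foundation_axiom c \<or> Separation_axiom c \<or> Replacement_axiom c"

lemmas axiom_defs = Ext_axiom_def Empty_axiom_def Pairing_axiom_def Union_axiom_def Power_axiom_def
  Foundation_axiom_def Separation_axiom_def Replacement_axiom_def

lemma defble_All_step: "defble (\<lambda>e. All_step (e 0) (e 1))"
  unfolding All_step_def by (intro definable)

lemma defble_Universal_closure [definable]:
  "defterm s \<Longrightarrow> defterm t \<Longrightarrow> defble (\<lambda>e. Universal_closure (s e) (t e))"
proof (rule defble_subst2[of Universal_closure])
  show "defble (\<lambda>e. Universal_closure (e 0) (e 1))"
    unfolding Universal_closure_def Sentence_def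
    by (intro definable defble_Chain[of "\<lambda>_. All_step", OF _ defterm_const])
      (use defble_reindex[OF defble_All_step, of Suc] in \<open>simp add: numeral_2_eq_2\<close>)
qed

text \<open>The coded theory exists as a class because being an axiom is expressed with set
  quantifiers alone.\<close>

lemma Axiom_S_Cls: "{c. Axiom_S c} \<in> Cls"
  by (rule defble_class)
    (simp add: Axiom_S_def axiom_defs distinct_Nats_def eval_nat_numeral, intro definable)

section \<open>Assignments and valuations\<close>

definition Asg :: "'a \<Rightarrow> 'a \<Rightarrow> 'a set \<Rightarrow> bool" where
  "Asg A c U \<longleftrightarrow> Fun (ext A) \<and> Fin A \<and> (\<forall>v y. pair v y \<in> ext A \<longrightarrow> y \<in> U) \<and>
    (\<forall>v. Free v c \<longrightarrow> (\<exists>y. pair v y \<in> ext A))"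

definition Dom :: "'a \<Rightarrow> 'a \<Rightarrow> 'a set \<Rightarrow> 'a set \<Rightarrow> bool" where
  "Dom c A \<Phi> U \<longleftrightarrow> (\<exists>e. e \<in> \<Phi> \<and> Sub c e) \<and> Asg A c U"

definition Tr :: "'a set \<Rightarrow> 'a \<Rightarrow> 'a \<Rightarrow> bool" where
  "Tr F c A \<longleftrightarrow> pair (pair c A) (num 1) \<in> F"

text \<open>The quantifier over updates B in \<open>isValuation\<close> disappears, because
  \<open>upd A i y\<close> is the only set that satisfies \<open>isUpdate\<close>.\<close>

definition Valuation :: "'a set \<Rightarrow> 'a set \<Rightarrow> 'a set \<Rightarrow> 'a set \<Rightarrow> bool" where
  "Valuation F \<Phi> U E \<longleftrightarrow> Fun F \<and>
    (\<forall>p. (\<exists>t. pair p t \<in> F) \<longleftrightarrow> (\<exists>c A. p = pair c A \<and> Dom c A \<Phi> U)) \<and>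
    (\<forall>p t. pair p t \<in> F \<longrightarrow> t = num 0 \<or> t = num 1) \<and>
    (\<forall>c A. Dom c A \<Phi> U \<longrightarrow>
      (\<forall>i j. Nat i \<and> Nat j \<and> c = memc i j \<longrightarrow>
        (Tr F c A \<longleftrightarrow> (\<exists>x y. pair i x \<in> ext A \<and> pair j y \<in> ext A \<and> pair x y \<in> E))) \<and>
      (\<forall>i j. Nat i \<and> Nat j \<and> c = eqc i j \<longrightarrow>
        (Tr F c A \<longleftrightarrow> (\<exists>x. pair i x \<in> ext A \<and> pair j x \<in> ext A))) \<and>
      (\<forall>a. c = negc a \<longrightarrow> (Tr F c A \<longleftrightarrow> \<not> Tr F a A)) \<and>
      (\<forall>a b. c = impc a b \<longrightarrow> (Tr F c A \<longleftrightarrow> (Tr F a A \<longrightarrow> Tr F b A))) \<and>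
      (\<forall>i a. Nat i \<and> c = allc i a \<longrightarrow>
        (Tr F c A \<longleftrightarrow> (\<forall>y. y \<in> U \<longrightarrow> Tr F a (upd A i y)))))"

end

section \<open>Truth over the universe\<close>

text \<open>The class of formulas stays general; in the application it is the singleton of the axiom
  under consideration.\<close>

locale V_valuation = class_theory_model +
  fixes F \<Phi>
  assumes F_Cls: "F \<in> Cls" and Phi_Cls: "\<Phi> \<in> Cls"
    and valuation: "Valuation F \<Phi> UNIV {p. \<exists>x y. p = pair x y \<and> x \<in> ext y}"
begin

definition sub :: "'a \<Rightarrow> bool" where "sub d \<longleftrightarrow> (\<exists>e. e \<in> \<Phi> \<and> Sub d e)"

lemma defble_Asg [definable]: "defterm s \<Longrightarrow> defterm t \<Longrightarrow> defble (\<lambda>e. Asg (s e) (t e) UNIV)"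
proof (rule defble_subst2[of "\<lambda>x y. Asg x y UNIV"])
  show "defble (\<lambda>e. Asg (e 0) (e 1) UNIV)" unfolding Asg_def by (simp, intro definable)
qed

lemma defble_sub [definable]: "defterm t \<Longrightarrow> defble (\<lambda>e. sub (t e))"
proof (rule defble_subst1[of sub])
  show "defble (\<lambda>e. sub (e 0))" unfolding sub_def by (intro definable Phi_Cls)
qed

lemma defble_Tr [definable]: "defterm s \<Longrightarrow> defterm t \<Longrightarrow> defble (\<lambda>e. Tr F (s e) (t e))"
  unfolding Tr_def by (intro definable F_Cls)

lemma sub_parts:
  "sub (negc a) \<Longrightarrow> sub a" "sub (impc a b) \<Longrightarrow> sub a \<and> sub b" "Nat u \<Longrightarrow> sub (allc u a) \<Longrightarrow> sub a"
  unfolding sub_def using Sub_parts by blast+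

text \<open>A free variable of a other than u is free in \<open>allc u a\<close>, and u is covered
  by the update, which stays a finite function.\<close>

lemma Asg_parts:
  "Asg A (negc a) U \<Longrightarrow> Asg A a U" "Asg A (impc a b) U \<Longrightarrow> Asg A a U \<and> Asg A b U"
  "Nat u \<Longrightarrow> Asg A (allc u a) UNIV \<Longrightarrow> Asg (upd A u y) a UNIV"
  unfolding Asg_def by (auto simp: Free_compound Fun_upd Fin_upd)

lemma Tr_clauses:
  assumes "sub c" "Asg A c UNIV"
  shows "c = memc i j \<Longrightarrow> Nat i \<Longrightarrow> Nat j \<Longrightarrow>
      Tr F c A \<longleftrightarrow> (\<exists>x y. pair i x \<in> ext A \<and> pair j y \<in> ext A \<and> x \<in> ext y)"
    and "c = eqc i j \<Longrightarrow> Nat i \<Longrightarrow> Nat j \<Longrightarrow> Tr F c A \<longleftrightarrow> (\<exists>x. pair i x \<in> ext A \<and> pair j x \<in> ext A)"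
    and "c = negc a \<Longrightarrow> Tr F c A \<longleftrightarrow> \<not> Tr F a A"
    and "c = impc a b \<Longrightarrow> Tr F c A \<longleftrightarrow> (Tr F a A \<longrightarrow> Tr F b A)"
    and "c = allc i a \<Longrightarrow> Nat i \<Longrightarrow> Tr F c A \<longleftrightarrow> (\<forall>y. Tr F a (upd A i y))"
proof -
  have "Dom c A \<Phi> UNIV" using assms by (simp add: Dom_def sub_def)
  note * = valuation[unfolded Valuation_def, THEN conjunct2, THEN conjunct2, THEN conjunct2,
      rule_format, OF this]
  show "c = memc i j \<Longrightarrow> Nat i \<Longrightarrow> Nat j \<Longrightarrow>
      Tr F c A \<longleftrightarrow> (\<exists>x y. pair i x \<in> ext A \<and> pair j y \<in> ext A \<and> x \<in> ext y)"
    using *[THEN conjunct1] by simp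
  show "c = eqc i j \<Longrightarrow> Nat i \<Longrightarrow> Nat j \<Longrightarrow> Tr F c A \<longleftrightarrow> (\<exists>x. pair i x \<in> ext A \<and> pair j x \<in> ext A)"
    using *[THEN conjunct2, THEN conjunct1] by simp
  show "c = negc a \<Longrightarrow> Tr F c A \<longleftrightarrow> \<not> Tr F a A"
    using *[THEN conjunct2, THEN conjunct2, THEN conjunct1] by simp
  show "c = impc a b \<Longrightarrow> Tr F c A \<longleftrightarrow> (Tr F a A \<longrightarrow> Tr F b A)"
    using *[THEN conjunct2, THEN conjunct2, THEN conjunct2, THEN conjunct1] by simp
  show "c = allc i a \<Longrightarrow> Nat i \<Longrightarrow> Tr F c A \<longleftrightarrow> (\<forall>y. Tr F a (upd A i y))"
    using *[THEN conjunct2, THEN conjunct2, THEN conjunct2, THEN conjunct2] by simp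
qed

section \<open>Dependence of truth on the free variables\<close>

definition agree :: "'a \<Rightarrow> 'a \<Rightarrow> 'a \<Rightarrow> bool" where
  "agree d A B \<longleftrightarrow> (\<forall>v y. Free v d \<longrightarrow> (pair v y \<in> ext A \<longleftrightarrow> pair v y \<in> ext B))"

lemma defble_agree [definable]:
  "defterm s \<Longrightarrow> defterm t \<Longrightarrow> defterm u \<Longrightarrow> defble (\<lambda>e. agree (s e) (t e) (u e))"
proof (rule defble_subst3[of agree])
  show "defble (\<lambda>e. agree (e 0) (e 1) (e 2))" unfolding agree_def by (intro definable)
qed

text \<open>Coincidence lemma. The property quantifies over both assignments because the quantifier
  clause updates them; it includes \<open>sub\<close> and \<open>Asg\<close> because the clauses are
  guaranteed only on the domain of F.\<close>

lemma Tr_agree: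
  assumes "Formula d" "sub d" "Asg A d UNIV" "Asg B d UNIV" "agree d A B"
  shows "Tr F d A \<longleftrightarrow> Tr F d B"
proof -
  let ?P = "\<lambda>d. \<forall>A B. sub d \<and> Asg A d UNIV \<and> Asg B d UNIV \<and> agree d A B \<longrightarrow> (Tr F d A \<longleftrightarrow> Tr F d B)"
  have "?P d"
  proof (rule Formula_induct[OF assms(1), where P="?P"])
    show "{d. ?P d} \<in> Cls" by (rule defble_class) (intro definable)
  next
    fix i j assume ij: "Nat i" "Nat j"
    show "?P (memc i j)"
    proof (intro allI impI)
      fix A B assume H: "sub (memc i j) \<and> Asg A (memc i j) UNIV \<and> Asg B (memc i j) UNIV \<and> agree (memc i j) A B"
      then have "pair i y \<in> ext A \<longleftrightarrow> pair i y \<in> ext B" "pair j y \<in> ext A \<longleftrightarrow> pair j y \<in> ext B" for y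
        using ij unfolding agree_def by (simp_all add: Free_atom)
      then show "Tr F (memc i j) A \<longleftrightarrow> Tr F (memc i j) B"
        using H ij by (simp only: Tr_clauses(1))
    qed
    show "?P (eqc i j)"
    proof (intro allI impI)
      fix A B assume H: "sub (eqc i j) \<and> Asg A (eqc i j) UNIV \<and> Asg B (eqc i j) UNIV \<and> agree (eqc i j) A B"
      then have "pair i y \<in> ext A \<longleftrightarrow> pair i y \<in> ext B" "pair j y \<in> ext A \<longleftrightarrow> pair j y \<in> ext B" for y
        using ij unfolding agree_def by (simp_all add: Free_atom)
      then show "Tr F (eqc i j) A \<longleftrightarrow> Tr F (eqc i j) B"
        using H ij by (simp only: Tr_clauses(2))
    qed
  next
    fix a assume IH: "?P a"
    show "?P (negc a)"
    proof (intro allI impI)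
      fix A B assume H: "sub (negc a) \<and> Asg A (negc a) UNIV \<and> Asg B (negc a) UNIV \<and> agree (negc a) A B"
      then have "sub a \<and> Asg A a UNIV \<and> Asg B a UNIV \<and> agree a A B"
        using sub_parts(1)[of a] Asg_parts(1)[of _ a] by (simp add: agree_def Free_compound)
      with IH have "Tr F a A \<longleftrightarrow> Tr F a B" by blast
      then show "Tr F (negc a) A \<longleftrightarrow> Tr F (negc a) B" using H by (simp add: Tr_clauses(3))
    qed
  next
    fix a b assume IH: "?P a" "?P b"
    show "?P (impc a b)"
    proof (intro allI impI)
      fix A B assume H: "sub (impc a b) \<and> Asg A (impc a b) UNIV \<and> Asg B (impc a b) UNIV \<and> agree (impc a b) A B"
      then have "sub a \<and> Asg A a UNIV \<and> Asg B a UNIV \<and> agree a A B"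
        "sub b \<and> Asg A b UNIV \<and> Asg B b UNIV \<and> agree b A B"
        using sub_parts(2)[of a b] Asg_parts(2)[of _ a b] by (simp_all add: agree_def Free_compound)
      with IH have "Tr F a A \<longleftrightarrow> Tr F a B" "Tr F b A \<longleftrightarrow> Tr F b B" by blast+
      then show "Tr F (impc a b) A \<longleftrightarrow> Tr F (impc a b) B" using H by (simp add: Tr_clauses(4))
    qed
  next
    fix i a assume i: "Nat i" and IH: "?P a"
    show "?P (allc i a)"
    proof (intro allI impI)
      fix A B assume H: "sub (allc i a) \<and> Asg A (allc i a) UNIV \<and> Asg B (allc i a) UNIV \<and> agree (allc i a) A B"
      then have "sub a \<and> Asg (upd A i y) a UNIV \<and> Asg (upd B i y) a UNIV \<and> agree a (upd A i y) (upd B i y)" for y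
        using i sub_parts(3)[of i a] Asg_parts(3)[of i _ a] by (simp add: agree_def Free_compound)
      with IH have "Tr F a (upd A i y) \<longleftrightarrow> Tr F a (upd B i y)" for y by blast
      then show "Tr F (allc i a) A \<longleftrightarrow> Tr F (allc i a) B" using H i by (simp add: Tr_clauses(5))
    qed
  qed
  then show ?thesis using assms by blast
qed

section \<open>Truth of templates\<close>

definition val :: "'a \<Rightarrow> 'a \<Rightarrow> 'a" where
  "val A v = (THE y. pair v y \<in> ext A)"

text \<open>Valid for every set A, since the update leaves exactly one value at v; so
  \<open>tsat\<close> can be computed without checking assignments.\<close>

lemma val_upd [simp]: "val (upd A v y) w = (if w = v then y else val A w)"
  by (simp add: val_def)

lemma val_eq:
  assumes "Fun (ext A)" "\<exists>y. pair v y \<in> ext A"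
  shows "pair v x \<in> ext A \<longleftrightarrow> x = val A v"
proof -
  have "\<exists>!y. pair v y \<in> ext A" using assms unfolding Fun_def by blast
  then have "pair v (val A v) \<in> ext A" unfolding val_def by (rule theI')
  then show ?thesis using assms(1) unfolding Fun_def by blast
qed

text \<open>The recursion is over the template, a finite HOL object, and stops at an inserted coded
  formula, whose truth is left to F.\<close>

primrec tsat :: "(var \<Rightarrow> 'a) \<Rightarrow> 'a \<Rightarrow> template \<Rightarrow> bool" where
  "tsat \<nu> A (TMem i j) \<longleftrightarrow> val A (\<nu> i) \<in> ext (val A (\<nu> j))"
| "tsat \<nu> A (TEq i j) \<longleftrightarrow> val A (\<nu> i) = val A (\<nu> j)"
| "tsat \<nu> A (TNeg s) \<longleftrightarrow> \<not> tsat \<nu> A s"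
| "tsat \<nu> A (TImp s t) \<longleftrightarrow> (tsat \<nu> A s \<longrightarrow> tsat \<nu> A t)"
| "tsat \<nu> A (TAll i s) \<longleftrightarrow> (\<forall>y. tsat \<nu> (upd A (\<nu> i) y) s)"
| "tsat \<nu> A (TSub d) \<longleftrightarrow> Tr F (\<nu> d) A"

lemma tsat_derived:
  "tsat \<nu> A (TIff s t) \<longleftrightarrow> (tsat \<nu> A s \<longleftrightarrow> tsat \<nu> A t)"
  "tsat \<nu> A (TEx i s) \<longleftrightarrow> (\<exists>y. tsat \<nu> (upd A (\<nu> i) y) s)"
  by auto

primrec tvars :: "template \<Rightarrow> var set" where
  "tvars (TMem i j) = {i, j}"
| "tvars (TEq i j) = {i, j}"
| "tvars (TNeg s) = tvars s"
| "tvars (TImp s t) = tvars s \<union> tvars t"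
| "tvars (TAll i s) = insert i (tvars s)"
| "tvars (TSub d) = {}"

primrec tfree :: "(var \<Rightarrow> 'a) \<Rightarrow> template \<Rightarrow> 'a \<Rightarrow> bool" where
  "tfree \<nu> (TMem i j) v \<longleftrightarrow> v = \<nu> i \<or> v = \<nu> j"
| "tfree \<nu> (TEq i j) v \<longleftrightarrow> v = \<nu> i \<or> v = \<nu> j"
| "tfree \<nu> (TNeg s) v \<longleftrightarrow> tfree \<nu> s v"
| "tfree \<nu> (TImp s t) v \<longleftrightarrow> tfree \<nu> s v \<or> tfree \<nu> t v"
| "tfree \<nu> (TAll i s) v \<longleftrightarrow> v \<noteq> \<nu> i \<and> tfree \<nu> s v"
| "tfree \<nu> (TSub d) v \<longleftrightarrow> Free v (\<nu> d)"

lemma Free_tcode: "\<forall>i\<in>tvars t. Nat (\<nu> i) \<Longrightarrow> Free v (tcode \<nu> t) \<longleftrightarrow> tfree \<nu> t v"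
  by (induction t) (auto simp: Free_atom Free_compound)

text \<open>The Tarskian clauses are applied along the template; the assignment is general because
  quantifiers update it.\<close>

lemma Tr_tcode:
  "\<forall>i\<in>tvars t. Nat (\<nu> i) \<Longrightarrow> sub (tcode \<nu> t) \<Longrightarrow> Asg A (tcode \<nu> t) UNIV \<Longrightarrow>
    Tr F (tcode \<nu> t) A \<longleftrightarrow> tsat \<nu> A t"
proof (induction t arbitrary: A)
  case (TMem i j)
  then have dom: "\<exists>y. pair (\<nu> i) y \<in> ext A" "\<exists>y. pair (\<nu> j) y \<in> ext A"
    unfolding Asg_def by (auto simp: Free_atom)
  have "Fun (ext A)" using TMem by (simp add: Asg_def)
  then have "\<And>x. pair (\<nu> i) x \<in> ext A \<longleftrightarrow> x = val A (\<nu> i)"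
    "\<And>x. pair (\<nu> j) x \<in> ext A \<longleftrightarrow> x = val A (\<nu> j)"
    using val_eq[OF _ dom(1)] val_eq[OF _ dom(2)] by blast+
  then show ?case using TMem(1) Tr_clauses(1)[OF TMem(2,3), of "\<nu> i" "\<nu> j"] by simp
next
  case (TEq i j)
  then have dom: "\<exists>y. pair (\<nu> i) y \<in> ext A" "\<exists>y. pair (\<nu> j) y \<in> ext A"
    unfolding Asg_def by (auto simp: Free_atom)
  have "Fun (ext A)" using TEq by (simp add: Asg_def)
  then have "\<And>x. pair (\<nu> i) x \<in> ext A \<longleftrightarrow> x = val A (\<nu> i)"
    "\<And>x. pair (\<nu> j) x \<in> ext A \<longleftrightarrow> x = val A (\<nu> j)"
    using val_eq[OF _ dom(1)] val_eq[OF _ dom(2)] by blast+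
  then show ?case using TEq(1) Tr_clauses(2)[OF TEq(2,3), of "\<nu> i" "\<nu> j"] by simp
next
  case (TNeg t)
  then show ?case
    using Tr_clauses(3)[OF TNeg.prems(2,3)] sub_parts(1)[of "tcode \<nu> t"] Asg_parts(1)[of A "tcode \<nu> t"]
    by simp
next
  case (TImp s t)
  then show ?case
    using Tr_clauses(4)[OF TImp.prems(2,3)] sub_parts(2)[of "tcode \<nu> s" "tcode \<nu> t"]
      Asg_parts(2)[of A "tcode \<nu> s" "tcode \<nu> t"]
    by simp
next
  case (TAll i t)
  then show ?case
    using Tr_clauses(5)[OF TAll.prems(2,3)] sub_parts(3)[of "\<nu> i" "tcode \<nu> t"]
      Asg_parts(3)[of "\<nu> i" A "tcode \<nu> t"]
    by simp
qed simp

text \<open>The number of prefixed quantifiers may be nonstandard, so truth at all assignments is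
  carried along the chain inside the model. The closure c is a sentence, hence the empty set is an
  assignment for it.\<close>

lemma Tr_universal_closure:
  assumes "Universal_closure c a" "sub c" and a: "\<And>A. sub a \<Longrightarrow> Asg A a UNIV \<Longrightarrow> Tr F a A"
  shows "Tr F c emp"
proof -
  have "Chain All_step a c" using assms(1) by (simp add: Universal_closure_def)
  \<comment> \<open>The chain ascends from a to c, while being a subformula is inherited downwards;
    hence \<open>sub\<close> is a premise within the property and not a fact about a.\<close>
  then have "sub c \<longrightarrow> (\<forall>A. Asg A c UNIV \<longrightarrow> Tr F c A)"
  proof (rule Chain_induct)
    show "{c. sub c \<longrightarrow> (\<forall>A. Asg A c UNIV \<longrightarrow> Tr F c A)} \<in> Cls"
      by (rule defble_class) (intro definable)
    show "sub a \<longrightarrow> (\<forall>A. Asg A a UNIV \<longrightarrow> Tr F a A)" using a by blast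
    show "sub e \<longrightarrow> (\<forall>A. Asg A e UNIV \<longrightarrow> Tr F e A)"
      if "sub d \<longrightarrow> (\<forall>A. Asg A d UNIV \<longrightarrow> Tr F d A)" "All_step d e" for d e
    proof (intro impI allI)
      fix A assume e: "sub e" "Asg A e UNIV"
      obtain u where u: "Nat u" "e = allc u d" using \<open>All_step d e\<close> unfolding All_step_def by blast
      then have "Tr F d (upd A u y)" for y
        using e that(1) sub_parts(3)[of u d] Asg_parts(3)[of u A d] by simp
      then show "Tr F e A" using Tr_clauses(5)[OF e u(2,1)] by simp
    qed
  qed
  moreover have "Asg emp c UNIV"
    using assms(1) by (simp add: Asg_def Fin_emp Fun_empty Universal_closure_def Sentence_def)
  ultimately show ?thesis using assms(2) by blast
qed

lemma Tr_closed_tcode: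
  assumes "\<forall>i\<in>tvars t. Nat (\<nu> i)" "\<forall>v. \<not> tfree \<nu> t v" "sub (tcode \<nu> t)" "tsat \<nu> emp t"
  shows "Tr F (tcode \<nu> t) emp"
proof -
  have "Asg emp (tcode \<nu> t) UNIV" using assms by (simp add: Asg_def Fin_emp Fun_empty Free_tcode)
  then show ?thesis using assms Tr_tcode by blast
qed

text \<open>The class of all X at which d is true is predicative in F, and the class form of
  Separation supplies the set. Since y is not free in d, assigning this set to y does not alter the
  truth of d.\<close>

lemma Tr_separation:
  assumes d: "Formula d" "\<not> Free y d" and xyz: "distinct_Nats [x, y, z]"
    and a: "a = tcode ((!) [x, y, z, d])
      (TAll 2 (TEx 1 (TAll 0 (TIff (TMem 0 1) (TConj (TMem 0 2) (TSub 3))))))"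
    and sub: "sub a" and A: "Asg A a UNIV"
  shows "Tr F a A"
proof -
  have nats: "Nat x" "Nat y" "Nat z" and dist: "x \<noteq> y" "x \<noteq> z" "y \<noteq> z"
    using xyz by (auto simp: distinct_Nats_def)
  have "sub d" using sub nats unfolding a by (auto simp: eval_nat_numeral dest!: sub_parts)
  \<comment> \<open>A covers only the free variables of a; the values at x, y and z come from the
    updates.\<close>
  have dom: "\<exists>y. pair v y \<in> ext A" if "Free v d" "v \<noteq> x" "v \<noteq> y" "v \<noteq> z" for v
    using A that nats unfolding Asg_def a by (simp add: Free_compound Free_atom eval_nat_numeral)
  have A': "Fun (ext A)" "Fin A" using A by (auto simp: Asg_def)
  have "\<exists>Y. \<forall>X. X \<in> ext Y \<longleftrightarrow> X \<in> ext Z \<and> Tr F d (upd (upd (upd A z Z) y Y) x X)" for Z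
  proof -
    \<comment> \<open>The update at y is left out here, because its value Y is the set about to be
      defined.\<close>
    have "{X. Tr F d (upd (upd A z Z) x X)} \<in> Cls" by (rule defble_class) (intro definable)
    from separation[OF this] obtain Y where Y: "ext Y = {X \<in> ext Z. Tr F d (upd (upd A z Z) x X)}"
      by blast
    have "Tr F d (upd (upd A z Z) x X) \<longleftrightarrow> Tr F d (upd (upd (upd A z Z) y Y) x X)" for X
    proof (rule Tr_agree[OF d(1) \<open>sub d\<close>])
      show "Asg (upd (upd A z Z) x X) d UNIV" "Asg (upd (upd (upd A z Z) y Y) x X) d UNIV"
        using dom d(2) A' by (auto simp: Asg_def Fun_upd Fin_upd)
      show "agree d (upd (upd A z Z) x X) (upd (upd (upd A z Z) y Y) x X)"
        using d(2) by (auto simp: agree_def)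
    qed
    then show ?thesis using Y by (intro exI[of _ Y]) auto
  qed
  then have "tsat ((!) [x, y, z, d]) A
      (TAll 2 (TEx 1 (TAll 0 (TIff (TMem 0 1) (TConj (TMem 0 2) (TSub 3))))))"
    unfolding tsat_derived tsat.simps(5)
    by (simp add: dist dist[symmetric] eval_nat_numeral)
  then show ?thesis
    using sub A unfolding a by (subst Tr_tcode) (use nats in \<open>simp_all add: eval_nat_numeral\<close>)
qed

text \<open>Truth of d defines a class of pairs (X, Y); the hypothesis of the axiom makes it a
  function. Values at z and w are removed by coincidence, as neither is free in d.\<close>

lemma Tr_replacement:
  assumes d: "Formula d" "\<not> Free z d" "\<not> Free w d" and xyzuw: "distinct_Nats [x, y, z, u, w]"
    and a: "a = tcode ((!) [x, y, z, u, w, d])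
      (TAll 3 (TImp
        (TAll 0 (TEx 2 (TAll 1 (TImp (TSub 5) (TEq 1 2)))))
        (TEx 4 (TAll 1 (TIff (TMem 1 4) (TEx 0 (TConj (TMem 0 3) (TSub 5))))))))"
    and sub: "sub a" and A: "Asg A a UNIV"
  shows "Tr F a A"
proof -
  have nats: "Nat x" "Nat y" "Nat z" "Nat u" "Nat w" and dist: "x \<noteq> y" "x \<noteq> z" "x \<noteq> u" "x \<noteq> w"
      "y \<noteq> z" "y \<noteq> u" "y \<noteq> w" "z \<noteq> u" "z \<noteq> w" "u \<noteq> w"
    using xyzuw by (auto simp: distinct_Nats_def)
  have "sub d" using sub nats unfolding a by (auto simp: eval_nat_numeral dest!: sub_parts)
  have dom: "\<exists>y. pair v y \<in> ext A" if "Free v d" "v \<noteq> x" "v \<noteq> y" "v \<noteq> u" for v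
    using A that nats d unfolding Asg_def a by (auto simp: Free_compound Free_atom eval_nat_numeral)
  have A': "Fun (ext A)" "Fin A" using A by (auto simp: Asg_def)
  have "\<exists>W. \<forall>Y. Y \<in> ext W \<longleftrightarrow> (\<exists>X. X \<in> ext U \<and> Tr F d (upd (upd (upd (upd A u U) w W) y Y) x X))"
    if uniq: "\<forall>X. \<exists>Z. \<forall>Y. Tr F d (upd (upd (upd (upd A u U) x X) z Z) y Y) \<longrightarrow> Y = Z" for U
  proof -
    let ?G = "\<lambda>X Y. upd (upd (upd A u U) x X) y Y"
    have Asg: "Asg (?G X Y) d UNIV" for X Y
      using dom A' by (auto simp: Asg_def Fun_upd Fin_upd)
    have z: "Tr F d (upd (upd (upd (upd A u U) x X) z Z) y Y) \<longleftrightarrow> Tr F d (?G X Y)" for X Y Z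
    proof (rule Tr_agree[OF d(1) \<open>sub d\<close> _ Asg])
      show "Asg (upd (upd (upd (upd A u U) x X) z Z) y Y) d UNIV"
        using dom A' by (auto simp: Asg_def Fun_upd Fin_upd)
      show "agree d (upd (upd (upd (upd A u U) x X) z Z) y Y) (?G X Y)"
        using d by (auto simp: agree_def)
    qed
    \<comment> \<open>Besides dropping w, this exchanges the updates at x and y, which is harmless
      because they are distinct.\<close>
    have w: "Tr F d (upd (upd (upd (upd A u U) w W) y Y) x X) \<longleftrightarrow> Tr F d (?G X Y)" for X Y W
    proof (rule Tr_agree[OF d(1) \<open>sub d\<close> _ Asg])
      show "Asg (upd (upd (upd (upd A u U) w W) y Y) x X) d UNIV"
        using dom A' by (auto simp: Asg_def Fun_upd Fin_upd)
      show "agree d (upd (upd (upd (upd A u U) w W) y Y) x X) (?G X Y)"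
        using d dist by (auto simp: agree_def)
    qed
    let ?F = "{p. \<exists>X Y. p = pair X Y \<and> Tr F d (?G X Y)}"
    have "?F \<in> Cls" by (rule defble_class) (intro definable)
    \<comment> \<open>For fixed X, all values Y equal the Z given by \<open>uniq\<close>, so any two
      of them coincide.\<close>
    moreover have "Fun ?F" unfolding Fun_def using uniq unfolding z by auto metis
    ultimately obtain W where "ext W = {Y. \<exists>X\<in>ext U. pair X Y \<in> ?F}" using replacement by blast
    then show ?thesis unfolding w by (intro exI[of _ W]) auto
  qed
  then have "tsat ((!) [x, y, z, u, w, d]) A (TAll 3 (TImp
        (TAll 0 (TEx 2 (TAll 1 (TImp (TSub 5) (TEq 1 2)))))
        (TEx 4 (TAll 1 (TIff (TMem 1 4) (TEx 0 (TConj (TMem 0 3) (TSub 5))))))))"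
    unfolding tsat_derived tsat.simps(4,5)
    by (simp add: dist dist[symmetric] eval_nat_numeral)
  then show ?thesis
    using sub A unfolding a by (subst Tr_tcode) (use nats in \<open>simp_all add: eval_nat_numeral\<close>)
qed

theorem Tr_Axiom_S:
  assumes "Axiom_S c" "c \<in> \<Phi>"
  shows "Tr F c emp"
proof -
  have sub: "sub c" unfolding sub_def using assms(2) Sub_refl by blast
  from assms(1) consider "Ext_axiom c" | "Empty_axiom c" | "Pairing_axiom c" | "Union_axiom c" |
    "Power_axiom c" | "Foundation_axiom c" | "Separation_axiom c" | "Replacement_axiom c"
    unfolding Axiom_S_def by blast
  then show ?thesis
  proof cases
    case 1
    then obtain x y z where *: "distinct_Nats [x, y, z]" and c: "c = tcode ((!) [x, y, z])
        (TAll 0 (TAll 1 (TImp (TAll 2 (TIff (TMem 2 0) (TMem 2 1))) (TEq 0 1))))"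
      unfolding Ext_axiom_def by blast
    have ax: "a = b" if "\<forall>x. x \<in> ext a \<longleftrightarrow> x \<in> ext b" for a b using that ext_eq by blast
    show ?thesis unfolding c
    \<comment> \<open>Goals 1 and 2 say that the variables are naturals and that the template is
      closed; only goal 3 needs the axiom of C. The other single axioms follow the same
      pattern.\<close>
    proof (rule Tr_closed_tcode[OF _ _ sub[unfolded c]], goal_cases)
      case 3
      show ?case using * ax unfolding tsat_derived tsat.simps(4,5)
        by (simp add: distinct_Nats_def eval_nat_numeral)
    qed (use * in \<open>auto simp: distinct_Nats_def eval_nat_numeral\<close>)
  next
    case 2
    then obtain x y where *: "distinct_Nats [x, y]" and c: "c = tcode ((!) [x, y])
        (TEx 0 (TAll 1 (TNeg (TMem 1 0))))"
      unfolding Empty_axiom_def by blast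
    show ?thesis unfolding c
    proof (rule Tr_closed_tcode[OF _ _ sub[unfolded c]], goal_cases)
      case 3
      show ?case using * ext_emp  unfolding tsat_derived tsat.simps(4,5)
        by (simp add: distinct_Nats_def eval_nat_numeral)
    qed (use * in \<open>auto simp: distinct_Nats_def eval_nat_numeral\<close>)
  next
    case 3
    then obtain x y z w where *: "distinct_Nats [x, y, z, w]" and c: "c = tcode ((!) [x, y, z, w])
        (TAll 0 (TAll 1 (TEx 2 (TAll 3 (TIff (TMem 3 2) (TDisj (TEq 3 0) (TEq 3 1)))))))"
      unfolding Pairing_axiom_def by blast
    \<comment> \<open>The implication is the form that \<open>TDisj\<close> takes after
      unfolding.\<close>
    have ax: "\<exists>c. \<forall>x. x \<in> ext c \<longleftrightarrow> (x \<noteq> a \<longrightarrow> x = b)" for a b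
      by (rule exI[of _ "upair a b"]) auto
    show ?thesis unfolding c
    proof (rule Tr_closed_tcode[OF _ _ sub[unfolded c]], goal_cases)
      case 3
      show ?case using * ax unfolding tsat_derived tsat.simps(4,5)
        by (simp add: distinct_Nats_def eval_nat_numeral)
    qed (use * in \<open>auto simp: distinct_Nats_def eval_nat_numeral\<close>)
  next
    case 4
    then obtain x y z w where *: "distinct_Nats [x, y, z, w]" and c: "c = tcode ((!) [x, y, z, w])
        (TAll 0 (TEx 1 (TAll 2 (TIff (TMem 2 1) (TEx 3 (TConj (TMem 3 0) (TMem 2 3)))))))"
      unfolding Union_axiom_def by blast
    have ax: "\<exists>b. \<forall>x. x \<in> ext b \<longleftrightarrow> (\<exists>y. y \<in> ext a \<and> x \<in> ext y)" for a
      using ex_union[of a] by (elim ex_forward) auto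
    show ?thesis unfolding c
    proof (rule Tr_closed_tcode[OF _ _ sub[unfolded c]], goal_cases)
      case 3
      show ?case using * ax unfolding tsat_derived tsat.simps(4,5)
        by (simp add: distinct_Nats_def eval_nat_numeral)
    qed (use * in \<open>auto simp: distinct_Nats_def eval_nat_numeral\<close>)
  next
    case 5
    then obtain x y z w where *: "distinct_Nats [x, y, z, w]" and c: "c = tcode ((!) [x, y, z, w])
        (TAll 0 (TEx 1 (TAll 2 (TIff (TMem 2 1) (TAll 3 (TImp (TMem 3 2) (TMem 3 0)))))))"
      unfolding Power_axiom_def by blast
    have ax: "\<exists>b. \<forall>x. x \<in> ext b \<longleftrightarrow> (\<forall>y. y \<in> ext x \<longrightarrow> y \<in> ext a)" for a
      using ex_power[of a] by (elim ex_forward) auto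
    show ?thesis unfolding c
    proof (rule Tr_closed_tcode[OF _ _ sub[unfolded c]], goal_cases)
      case 3
      show ?case using * ax unfolding tsat_derived tsat.simps(4,5)
        by (simp add: distinct_Nats_def eval_nat_numeral)
    qed (use * in \<open>auto simp: distinct_Nats_def eval_nat_numeral\<close>)
  next
    case 6
    then obtain x y z where *: "distinct_Nats [x, y, z]" and c: "c = tcode ((!) [x, y, z])
        (TAll 0 (TImp (TEx 1 (TMem 1 0))
          (TEx 1 (TConj (TMem 1 0) (TAll 2 (TImp (TMem 2 0) (TNeg (TMem 2 1))))))))"
      unfolding Foundation_axiom_def by blast
    have ax: "\<exists>b. b \<in> ext a \<and> (\<forall>x. x \<in> ext a \<longrightarrow> x \<notin> ext b)" if "\<exists>b. b \<in> ext a" for a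
    proof -
      have "ext a \<noteq> {}" using that by blast
      then show ?thesis using foundation[of a] by blast
    qed
    show ?thesis unfolding c
    proof (rule Tr_closed_tcode[OF _ _ sub[unfolded c]], goal_cases)
      case 3
      show ?case using * ax unfolding tsat_derived tsat.simps(4,5)
        by (simp add: distinct_Nats_def eval_nat_numeral)
    qed (use * in \<open>auto simp: distinct_Nats_def eval_nat_numeral\<close>)
  next
    case 7
    then show ?thesis
      unfolding Separation_axiom_def using Tr_universal_closure sub Tr_separation by blast
  next
    case 8
    then show ?thesis
      unfolding Replacement_axiom_def using Tr_universal_closure sub Tr_replacement by blast
  qed
qed

end

section \<open>Evaluation of the formulas of class theory\<close>

context class_theory_model
begin

lemma holds_isSucc [simp]:
  "y < n \<Longrightarrow> x < n \<Longrightarrow> e y \<in> range ext \<Longrightarrow> e x \<in> range ext \<Longrightarrow>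
    holds \<delta> (isSucc y x) n e = (st (e y) = suc (st (e x)))"
proof (elim rangeE, goal_cases)
  case (1 y' x')
  have "y' = suc x' \<longleftrightarrow> (\<forall>z. z \<in> ext y' \<longleftrightarrow> z \<in> ext x' \<or> z = x')"
    unfolding ext_eq[symmetric] ext_suc by auto
  with 1 show ?case by (simp add: isSucc_def)
qed

lemma holds_isNat [simp]:
  "x < n \<Longrightarrow> e x \<in> range ext \<Longrightarrow> holds \<delta> (isNat x) n e = Nat (st (e x))"
  by (elim rangeE) (simp add: isNat_def Nat_def isTransitive_def transitive_def Ball_def)

lemma holds_isNumeral [simp]:
  "x < n \<Longrightarrow> e x \<in> range ext \<Longrightarrow> holds \<delta> (isNumeral k x) n e = (st (e x) = num k)"
proof (induction k arbitrary: x n e)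
  case 0
  then show ?case by (elim rangeE) simp
next
  case (Suc k)
  then show ?case by (elim rangeE) simp
qed

lemma holds_isFinite [simp]:
  "x < n \<Longrightarrow> e x \<in> range ext \<Longrightarrow> holds \<delta> (isFinite x) n e = Fin (st (e x))"
  by (elim rangeE) (simp add: isFinite_def Fin_def)

lemma holds_isSeq [simp]:
  "f < n \<Longrightarrow> x < n \<Longrightarrow> e f \<in> range ext \<Longrightarrow> e x \<in> range ext \<Longrightarrow>
    holds \<delta> (isSeq f x) n e = Seq (st (e f)) (st (e x))"
  by (elim rangeE) (simp add: isSeq_def Seq_def)

text \<open>R is evaluated below the binders of \<open>chain\<close>, so its meaning is required at
  all later levels m. Agreement with e below n is needed when R mentions an outer variable, as in
  \<open>isFreeIn\<close>.\<close>

lemma holds_chain: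
  assumes "x < n" "y < n" "e x \<in> range ext" "e y \<in> range ext"
    and "\<And>m e' a b. n \<le> m \<Longrightarrow> a < m \<Longrightarrow> b < m \<Longrightarrow> (\<And>i. i < n \<Longrightarrow> e' i = e i) \<Longrightarrow>
      e' a \<in> range ext \<Longrightarrow> e' b \<in> range ext \<Longrightarrow> holds \<delta> (R a b) m e' = R' (st (e' a)) (st (e' b))"
  shows "holds \<delta> (chain R x y) n e = Chain R' (st (e x)) (st (e y))"
  using assms(1-4) by (elim rangeE) (simp add: chain_def Chain_def assms(5))

lemma holds_codes [simp]:
  "c < n \<Longrightarrow> i < n \<Longrightarrow> j < n \<Longrightarrow> e c \<in> range ext \<Longrightarrow> e i \<in> range ext \<Longrightarrow> e j \<in> range ext \<Longrightarrow>
    holds \<delta> (isMemCode c i j) n e = (st (e c) = memc (st (e i)) (st (e j)))"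
  "c < n \<Longrightarrow> i < n \<Longrightarrow> j < n \<Longrightarrow> e c \<in> range ext \<Longrightarrow> e i \<in> range ext \<Longrightarrow> e j \<in> range ext \<Longrightarrow>
    holds \<delta> (isEqCode c i j) n e = (st (e c) = eqc (st (e i)) (st (e j)))"
  "c < n \<Longrightarrow> i < n \<Longrightarrow> e c \<in> range ext \<Longrightarrow> e i \<in> range ext \<Longrightarrow>
    holds \<delta> (isNegCode c i) n e = (st (e c) = negc (st (e i)))"
  "c < n \<Longrightarrow> i < n \<Longrightarrow> j < n \<Longrightarrow> e c \<in> range ext \<Longrightarrow> e i \<in> range ext \<Longrightarrow> e j \<in> range ext \<Longrightarrow>
    holds \<delta> (isImpCode c i j) n e = (st (e c) = impc (st (e i)) (st (e j)))"
  "c < n \<Longrightarrow> i < n \<Longrightarrow> j < n \<Longrightarrow> e c \<in> range ext \<Longrightarrow> e i \<in> range ext \<Longrightarrow> e j \<in> range ext \<Longrightarrow>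
    holds \<delta> (isAllCode c i j) n e = (st (e c) = allc (st (e i)) (st (e j)))"
  unfolding isMemCode_def isEqCode_def isNegCode_def isImpCode_def isAllCode_def isTagged_def code_defs
  by (simp_all del: num.simps isNumeral.simps)

lemma holds_isFormula [simp]:
  "c < n \<Longrightarrow> e c \<in> range ext \<Longrightarrow> holds \<delta> (isFormula c) n e = Formula (st (e c))"
  by (elim rangeE) (simp add: isFormula_def Formula_def)

lemma holds_isSubformula [simp]:
  "x < n \<Longrightarrow> y < n \<Longrightarrow> e x \<in> range ext \<Longrightarrow> e y \<in> range ext \<Longrightarrow>
    holds \<delta> (isSubformula x y) n e = Sub (st (e x)) (st (e y))"
  unfolding isSubformula_def Sub_def
  by (rule holds_chain) (auto simp: isImmediateSubformula_def Imm_def)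

lemma holds_isFreeIn [simp]:
  "v < n \<Longrightarrow> c < n \<Longrightarrow> e v \<in> range ext \<Longrightarrow> e c \<in> range ext \<Longrightarrow>
    holds \<delta> (isFreeIn v c) n e = Free (st (e v)) (st (e c))"
  by (elim rangeE) (simp add: isFreeIn_def Free_def holds_chain[where R'="Free_step (st (e v))"] Free_step_def)

lemma holds_isUniversalClosure [simp]:
  "c < n \<Longrightarrow> a < n \<Longrightarrow> e c \<in> range ext \<Longrightarrow> e a \<in> range ext \<Longrightarrow>
    holds \<delta> (isUniversalClosure c a) n e = Universal_closure (st (e c)) (st (e a))"
  by (elim rangeE) (simp add: isUniversalClosure_def isSentence_def Universal_closure_def Sentence_def
      holds_chain[where R'="All_step"] All_step_def)

text \<open>Unlike \<open>tvars\<close> this includes the level in \<open>TSub\<close>: that level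
  must have a value, but the value is a formula and not a natural.\<close>

primrec tlevels :: "template \<Rightarrow> var set" where
  "tlevels (TMem i j) = {i, j}"
| "tlevels (TEq i j) = {i, j}"
| "tlevels (TNeg s) = tlevels s"
| "tlevels (TImp s t) = tlevels s \<union> tlevels t"
| "tlevels (TAll i s) = insert i (tlevels s)"
| "tlevels (TSub d) = {d}"

text \<open>The valuation \<open>\<nu>\<close> is kept apart from e, because e grows by the codes of
  the parts while \<open>\<nu>\<close> stays fixed in the induction.\<close>

lemma holds_isCode:
  "c < n \<Longrightarrow> e c \<in> range ext \<Longrightarrow> \<forall>i\<in>tlevels t. i < n \<and> e i = ext (\<nu> i) \<Longrightarrow>
    holds \<delta> (isCode c t) n e = (st (e c) = tcode \<nu> t)"
proof (induction t arbitrary: c n e)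
  case (TNeg t)
  have "holds \<delta> (isCode n t) (Suc n) (e(n := ext a)) = (a = tcode \<nu> t)" for a
    by (subst TNeg.IH) (use TNeg.prems in auto)
  then show ?case using TNeg.prems by simp
next
  case (TImp s t)
  let ?e = "\<lambda>a b. e(n := ext a, Suc n := ext b)"
  have "holds \<delta> (isCode n s) (Suc (Suc n)) (?e a b) = (a = tcode \<nu> s)" for a b
    by (subst TImp.IH(1)) (use TImp.prems in \<open>auto simp: ball_Un\<close>)
  moreover have "holds \<delta> (isCode (Suc n) t) (Suc (Suc n)) (?e a b) = (b = tcode \<nu> t)" for a b
    by (subst TImp.IH(2)) (use TImp.prems in \<open>auto simp: ball_Un\<close>)
  ultimately show ?case using TImp.prems by simp
next
  case (TAll i t)
  have "holds \<delta> (isCode n t) (Suc n) (e(n := ext a)) = (a = tcode \<nu> t)" for a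
    by (subst TAll.IH) (use TAll.prems in auto)
  then show ?case using TAll.prems by auto
qed auto

lemma holds_isCode_st:
  "c < n \<Longrightarrow> e c \<in> range ext \<Longrightarrow> \<forall>i\<in>tlevels t. i < n \<and> e i \<in> range ext \<Longrightarrow>
    holds \<delta> (isCode c t) n e = (st (e c) = tcode (\<lambda>i. st (e i)) t)"
  by (rule holds_isCode) auto

lemma holds_distinctVars:
  "\<forall>x\<in>set xs. x < n \<and> e x \<in> range ext \<Longrightarrow>
    holds \<delta> (distinctVars xs) n e = distinct_Nats (map (\<lambda>x. st (e x)) xs)"
proof (induction xs)
  case Nil
  then show ?case by (simp add: distinct_Nats_def)
next
  case (Cons x xs)
  note prems = Cons.prems
  \<comment> \<open>The inner fold compares x with each entry of the tail; an induction on sublists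
    with an arbitrary continuation Q unwinds it.\<close>
  have "holds \<delta> (foldr (\<lambda>y P. \<^bold>\<not> x \<^bold>= y \<^bold>\<and> P) ys Q) n e \<longleftrightarrow>
      (\<forall>y\<in>set ys. st (e x) \<noteq> st (e y)) \<and> holds \<delta> Q n e" if "set ys \<subseteq> set xs" for ys Q
    using that
  proof (induction ys)
    case (Cons y ys)
    then have "y < n" "x < n" "e x \<in> range ext" "e y \<in> range ext" using prems by auto
    then show ?case using Cons by auto
  qed simp
  then show ?case using Cons by (auto simp: distinct_Nats_def)
qed

lemma holds_axioms [simp]:
  assumes "c < n" "e c \<in> range ext"
  shows "holds \<delta> (isExtensionality c) n e = Ext_axiom (st (e c))"
    "holds \<delta> (isEmptySetAxiom c) n e = Empty_axiom (st (e c))"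
    "holds \<delta> (isPairing c) n e = Pairing_axiom (st (e c))"
    "holds \<delta> (isUnion c) n e = Union_axiom (st (e c))"
    "holds \<delta> (isPowerSet c) n e = Power_axiom (st (e c))"
    "holds \<delta> (isFoundation c) n e = Foundation_axiom (st (e c))"
    "holds \<delta> (isSeparation c) n e = Separation_axiom (st (e c))"
    "holds \<delta> (isReplacement c) n e = Replacement_axiom (st (e c))"
  using assms unfolding axiom_defs isExtensionality_def isEmptySetAxiom_def isPairing_def isUnion_def
    isPowerSet_def isFoundation_def isSeparation_def isReplacement_def
  by (simp_all add: holds_distinctVars holds_isCode_st eval_nat_numeral del: distinctVars.simps isCode.simps)

lemma holds_isAxiomOfS [simp]:
  "c < n \<Longrightarrow> e c \<in> range ext \<Longrightarrow> holds \<delta> (isAxiomOfS c) n e = Axiom_S (st (e c))"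
  by (simp add: isAxiomOfS_def Axiom_S_def)

lemma holds_isAssignment [simp]:
  "A < n \<Longrightarrow> c < n \<Longrightarrow> U < n \<Longrightarrow> e A \<in> range ext \<Longrightarrow> e c \<in> range ext \<Longrightarrow>
    holds \<delta> (isAssignment A c U) n e = Asg (st (e A)) (st (e c)) (e U)"
  by (elim rangeE) (simp add: isAssignment_def Asg_def)

lemma holds_isUpdate [simp]:
  "B < n \<Longrightarrow> A < n \<Longrightarrow> v < n \<Longrightarrow> y < n \<Longrightarrow> e B \<in> range ext \<Longrightarrow> e A \<in> range ext \<Longrightarrow>
    e v \<in> range ext \<Longrightarrow> e y \<in> range ext \<Longrightarrow>
    holds \<delta> (isUpdate B A v y) n e = (st (e B) = upd (st (e A)) (st (e v)) (st (e y)))"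
proof (elim rangeE, goal_cases)
  case (1 b a v' y')
  have "b = upd a v' y' \<longleftrightarrow> (\<forall>p. p \<in> ext b \<longleftrightarrow> p \<in> ext a \<and> \<not> (\<exists>z. p = pair v' z) \<or> p = pair v' y')"
    unfolding ext_eq[symmetric] ext_upd by auto
  with 1 show ?case by (simp add: isUpdate_def)
qed

lemma holds_inDomain [simp]:
  "c < n \<Longrightarrow> A < n \<Longrightarrow> \<Phi> < n \<Longrightarrow> U < n \<Longrightarrow> e c \<in> range ext \<Longrightarrow> e A \<in> range ext \<Longrightarrow>
    holds \<delta> (inDomain c A \<Phi> U) n e = Dom (st (e c)) (st (e A)) (e \<Phi>) (e U)"
  by (elim rangeE) (simp add: inDomain_def Dom_def)

lemma holds_isTrueAt [simp]:
  "F < n \<Longrightarrow> c < n \<Longrightarrow> A < n \<Longrightarrow> e c \<in> range ext \<Longrightarrow> e A \<in> range ext \<Longrightarrow>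
    holds \<delta> (isTrueAt F c A) n e = Tr (e F) (st (e c)) (st (e A))"
  by (elim rangeE) (simp add: isTrueAt_def Tr_def del: num.simps isNumeral.simps)

lemma holds_isValuation [simp]:
  "F < n \<Longrightarrow> \<Phi> < n \<Longrightarrow> U < n \<Longrightarrow> R < n \<Longrightarrow>
    holds \<delta> (isValuation F \<Phi> U R) n e = Valuation (e F) (e \<Phi>) (e U) (e R)"
  by (simp add: isValuation_def Valuation_def del: num.simps isNumeral.simps)

lemma holds_isSatisfactionRelation [simp]:
  "R < n \<Longrightarrow> \<Phi> < n \<Longrightarrow> U < n \<Longrightarrow> E < n \<Longrightarrow>
    holds \<delta> (isSatisfactionRelation R \<Phi> U E) n e =
    (\<exists>F\<in>Cls. Valuation F (e \<Phi>) (e U) (e E) \<and> e R = {p. \<exists>c A. p = pair c A \<and> Tr F c A})"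
  by (simp add: isSatisfactionRelation_def set_eq_iff[of "e R"])

lemma holds_satisfies [simp]:
  "R < n \<Longrightarrow> c < n \<Longrightarrow> e c \<in> range ext \<Longrightarrow>
    holds \<delta> (satisfies R c) n e = (pair (st (e c)) emp \<in> e R)"
  by (elim rangeE) (simp add: satisfies_def)

lemma holds_universallySatisfies:
  "U < n \<Longrightarrow> E < n \<Longrightarrow> c < n \<Longrightarrow> e c \<in> range ext \<Longrightarrow>
    holds \<delta> (universallySatisfies U E c) n e =
    (\<forall>R\<in>Cls. (\<exists>F\<in>Cls. Valuation F {st (e c)} (e U) (e E) \<and> R = {p. \<exists>c A. p = pair c A \<and> Tr F c A}) \<longrightarrow>
      pair (st (e c)) emp \<in> R)"
  by (elim rangeE) (simp add: universallySatisfies_def ext_eq_doubleton)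

theorem V_satisfies_S:
  "holds \<delta> (\<^bold>\<exists>\<^sub>C V E \<Theta>. isV V \<^bold>\<and> isMembershipRelation E \<^bold>\<and> isS \<Theta> \<^bold>\<and> universallySatisfiesAll V E \<Theta>) 0 e"
proof -
  let ?E = "{p. \<exists>x y. p = pair x y \<and> x \<in> ext y}"
  let ?S = "{c. Axiom_S c}"
  \<comment> \<open>Comprehension provides the universe and the membership relation as
    classes.\<close>
  have "{x. x = x} \<in> Cls" "?E \<in> Cls" by (rule defble_class, intro definable)+
  then have V: "UNIV \<in> Cls" and E: "?E \<in> Cls" by simp_all
  have Tr: "Tr F c emp" if "Axiom_S c" "F \<in> Cls" "Valuation F {c} UNIV ?E" for c F
  proof -
    \<comment> \<open>The class of formulas is the extension of the unordered pair of c with itself,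
      as in \<open>universallySatisfies\<close>.\<close>
    have "{c} \<in> Cls" using ext_Cls[of "upair c c"] by simp
    then interpret V_valuation ext Cls F "{c}"
      using that by unfold_locales
    show ?thesis using Tr_Axiom_S that by simp
  qed
  show ?thesis unfolding holds_exC
  proof (rule bexI[OF _ V], rule bexI[OF _ E], rule bexI[OF _ Axiom_S_Cls])
    let ?e = "e(0 := UNIV, Suc 0 := ?E, Suc (Suc 0) := ?S)"
    have "holds \<delta> (isMembershipRelation (Suc 0)) (Suc (Suc (Suc 0))) ?e"
      "holds \<delta> (isV 0 \<^bold>\<and> isS (Suc (Suc 0))) (Suc (Suc (Suc 0))) ?e"
      by (simp_all add: isV_def isMembershipRelation_def isS_def)
    moreover have "holds \<delta> (universallySatisfiesAll 0 (Suc 0) (Suc (Suc 0))) (Suc (Suc (Suc 0))) ?e"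
      using Tr by (auto simp: universallySatisfiesAll_def holds_universallySatisfies)
    ultimately show "holds \<delta> (isV 0 \<^bold>\<and> isMembershipRelation (Suc 0) \<^bold>\<and> isS (Suc (Suc 0)) \<^bold>\<and>
        universallySatisfiesAll 0 (Suc 0) (Suc (Suc 0))) (Suc (Suc (Suc 0))) ?e"
      by simp
  qed
qed

end

section \<open>Countable models\<close>

lemma sem_iso:
  assumes "bij_betw \<iota> D D'" and E: "\<And>x y. x \<in> D \<Longrightarrow> y \<in> D \<Longrightarrow> E x y \<longleftrightarrow> E' (\<iota> x) (\<iota> y)"
  shows "range e \<subseteq> D \<Longrightarrow> sem D E e p \<longleftrightarrow> sem D' E' (\<lambda>i. \<iota> (e i)) p"
proof (induction p arbitrary: e)
  case (Eql i j)
  then show ?case using bij_betw_imp_inj_on[OF assms(1)] by (auto dest!: inj_onD)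
next
  case (Forall p)
  have D': "D' = \<iota> ` D" using assms(1) by (auto simp: bij_betw_def)
  have "sem D E (case_nat x e) p \<longleftrightarrow> sem D' E' (case_nat (\<iota> x) (\<lambda>i. \<iota> (e i))) p" if "x \<in> D" for x
  proof -
    have "range (case_nat x e) \<subseteq> D" using Forall.prems that by (auto simp: image_subset_iff split: nat.split)
    moreover have "(\<lambda>i. \<iota> (case_nat x e i)) = case_nat (\<iota> x) (\<lambda>i. \<iota> (e i))"
      by (rule ext) (simp split: nat.split)
    ultimately show ?thesis using Forall.IH by metis
  qed
  then show ?case unfolding D' by simp
qed (simp_all add: image_subset_iff E)

section \<open>Invariance of the axioms under renaming\<close>

lemma ren_comprehension: "ren r (comprehension p) = comprehension (ren (lift r) p)"
proof -
  have "(\<lambda>i. lift (lift r) (case i of 0 \<Rightarrow> 0 | Suc j \<Rightarrow> Suc (Suc j))) =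
      (\<lambda>i. case lift r i of 0 \<Rightarrow> 0 | Suc j \<Rightarrow> Suc (Suc j))"
    by (rule ext) (simp split: nat.split)
  then show ?thesis by (simp add: comprehension_def ren_ren)
qed

lemmas form_defs = sentence_def mem\<^sub>f_def eq\<^sub>f_def neg\<^sub>f_def conj\<^sub>f_def disj\<^sub>f_def imp\<^sub>f_def iff\<^sub>f_def
  allC_def allS_def exS_def isEmpty_def subset\<^sub>f_def isUPair_def isPair_def maps_def isFun_def

text \<open>Only comprehension instances can have free variables, and renaming their parameters
  gives further instances; the other axioms are closed.\<close>

lemma ren_Th_C:
  assumes "p \<in> Th_C"
  shows "ren r p \<in> Th_C"
proof (cases "p \<in> comprehension ` {p. predicative p}")
  case True
  then show ?thesis
    unfolding Th_C_def by (auto simp: ren_comprehension intro!: image_eqI predicative_ren)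
next
  case False
  then have "ren r p = p" using assms unfolding Th_C_def by (auto simp: form_defs)
  then show ?thesis using assms by simp
qed

lemma sem_extensionality:
  assumes "sem D E e (sentence (\<^bold>\<forall>\<^sub>C X Y. (\<^bold>\<forall>z. z \<^bold>\<in> X \<^bold>\<longleftrightarrow> z \<^bold>\<in> Y) \<^bold>\<longrightarrow> X \<^bold>= Y))"
    "X \<in> D" "Y \<in> D" "\<And>z w. z \<in> D \<Longrightarrow> w \<in> D \<Longrightarrow> E z w \<Longrightarrow> E z X \<longleftrightarrow> E z Y"
  shows "X = Y"
  using assms by (simp add: form_defs) blast

lemma sem_set_quantifiers:
  "sem D E e (Forall (Imp (IsSet 0) p)) \<longleftrightarrow>
    (\<forall>x\<in>{x\<in>D. \<exists>y\<in>D. E x y}. sem D E (case_nat x e) p)"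
  "sem D E e (Neg (Forall (Imp (IsSet 0) (Neg p)))) \<longleftrightarrow>
    (\<exists>x\<in>{x\<in>D. \<exists>y\<in>D. E x y}. sem D E (case_nat x e) p)"
  by auto

lemma sem_empty_set:
  assumes "sem D E e (sentence (\<^bold>\<exists>x. isEmpty x))"
  shows "\<exists>x\<in>{x\<in>D. \<exists>y\<in>D. E x y}. \<forall>z\<in>{x\<in>D. \<exists>y\<in>D. E x y}. \<not> E z x"
  using assms unfolding form_defs sem_set_quantifiers by simp

lemma sem_pairing:
  assumes "sem D E e (sentence (\<^bold>\<forall>x y. \<^bold>\<exists>z. isUPair z x y))"
    "x \<in> {x\<in>D. \<exists>y\<in>D. E x y}" "y \<in> {x\<in>D. \<exists>y\<in>D. E x y}"
  shows "\<exists>z\<in>{x\<in>D. \<exists>y\<in>D. E x y}. \<forall>w\<in>{x\<in>D. \<exists>y\<in>D. E x y}. E w z \<longleftrightarrow> w = x \<or> w = y"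
proof -
  have "\<forall>x\<in>{x\<in>D. \<exists>y\<in>D. E x y}. \<forall>y\<in>{x\<in>D. \<exists>y\<in>D. E x y}. \<exists>z\<in>{x\<in>D. \<exists>y\<in>D. E x y}.
      \<forall>w\<in>{x\<in>D. \<exists>y\<in>D. E x y}. E w z \<longleftrightarrow> w = x \<or> w = y"
    using assms(1) unfolding form_defs unfolding sem_set_quantifiers sem_abbrevs(3) by (simp add: disj_imp)
  then show ?thesis using assms(2,3) by blast
qed

text \<open>The map \<open>x \<mapsto> {x}\<close> on sets is injective but misses the empty set.\<close>

lemma infinite_sets:
  assumes model: "\<And>p. p \<in> Th_C \<Longrightarrow> sem D E e p"
  shows "infinite {x\<in>D. \<exists>y\<in>D. E x y}" (is "infinite ?S")
proof
  define S where "S = ?S"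
  assume "finite ?S"
  then have fin: "finite S" unfolding S_def .
  have "\<forall>x\<in>S. \<exists>z. z \<in> S \<and> (\<forall>w\<in>S. E w z \<longleftrightarrow> w = x)"
  proof
    fix x assume x: "x \<in> S"
    have "sem D E e (sentence (\<^bold>\<forall>x y. \<^bold>\<exists>z. isUPair z x y))" by (rule model) (simp add: Th_C_def)
    from sem_pairing[OF this, folded S_def, OF x x]
    show "\<exists>z. z \<in> S \<and> (\<forall>w\<in>S. E w z \<longleftrightarrow> w = x)" by (simp add: Bex_def)
  qed
  from bchoice[OF this] obtain f where f: "\<forall>x\<in>S. f x \<in> S \<and> (\<forall>w\<in>S. E w (f x) \<longleftrightarrow> w = x)" ..
  have "inj_on f S"
  proof (rule inj_onI)
    fix x y assume "x \<in> S" "y \<in> S" "f x = f y"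
    with f show "x = y" by metis
  qed
  then have surj: "f ` S = S" using fin f by (intro endo_inj_surj) auto
  have "sem D E e (sentence (\<^bold>\<exists>x. isEmpty x))" by (rule model) (simp add: Th_C_def)
  from sem_empty_set[OF this, folded S_def] obtain z where z: "z \<in> S" "\<forall>w\<in>S. \<not> E w z" ..
  then obtain x where "x \<in> S" "z = f x" using surj by blast
  then show False using f z(2) by blast
qed

theorem theorem2p22:
  shows "Th_C \<turnstile> sentence (\<^bold>\<exists>\<^sub>C V E \<Theta>.
    isV V \<^bold>\<and> isMembershipRelation E \<^bold>\<and> isS \<Theta> \<^bold>\<and> universallySatisfiesAll V E \<Theta>)"
    (is "Th_C \<turnstile> ?\<phi>")
proof (rule completeness[OF ren_Th_C])
  fix D :: "nat set" and E and e :: "nat \<Rightarrow> nat"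
  assume model: "\<And>p e. p \<in> Th_C \<Longrightarrow> range e \<subseteq> D \<Longrightarrow> sem D E e p" and e: "range e \<subseteq> D"
  define S where "S = {x\<in>D. \<exists>y\<in>D. E x y}"
  have "infinite S" unfolding S_def using infinite_sets model e by blast
  \<comment> \<open>A bijection with all of \<open>nat\<close> is needed, since in
    \<open>class_structure\<close> every element of the type is a set.\<close>
  then obtain h where h: "bij_betw h (UNIV :: nat set) S"
    using bij_betw_from_nat_into[of S] by blast
  have hS: "h a \<in> D" "\<exists>y\<in>D. E (h a) y" for a
    using bij_betw_apply[OF h, of a] by (auto simp: S_def)
  \<comment> \<open>A class becomes the set of indices of its members. Injectivity is
    Extensionality, because members are sets and thus have indices.\<close>
  define \<iota> where "\<iota> X = {a. E (h a) X}" for X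
  have inj: "inj_on \<iota> D"
  proof (rule inj_onI)
    fix X Y assume XY: "X \<in> D" "Y \<in> D" "\<iota> X = \<iota> Y"
    show "X = Y"
    proof (rule sem_extensionality[OF model[OF _ e] XY(1,2)])
      fix z w assume "z \<in> D" "w \<in> D" "E z w"
      then have "z \<in> S" by (auto simp: S_def)
      then obtain a where "z = h a" using h by (auto simp: bij_betw_def)
      then show "E z X \<longleftrightarrow> E z Y" using XY(3) by (auto simp: \<iota>_def)
    qed (simp add: Th_C_def)
  qed
  let ?ext = "\<lambda>a. \<iota> (h a)" and ?Cls = "\<iota> ` D"
  have iso: "sem D E e p \<longleftrightarrow> sem ?Cls (\<lambda>X Y. \<exists>s. X = ?ext s \<and> s \<in> Y) (\<lambda>i. \<iota> (e i)) p"
    if "range e \<subseteq> D" for e p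
  proof (rule sem_iso[OF _ _ that])
    show "bij_betw \<iota> D ?Cls" using inj by (rule inj_on_imp_bij_betw)
    fix x y assume xy: "x \<in> D" "y \<in> D"
    show "E x y \<longleftrightarrow> (\<exists>s. \<iota> x = ?ext s \<and> s \<in> \<iota> y)"
    proof
      assume "E x y"
      then have "x \<in> S" using xy by (auto simp: S_def)
      then obtain s where "x = h s" using h by (auto simp: bij_betw_def)
      then show "\<exists>s. \<iota> x = ?ext s \<and> s \<in> \<iota> y" using \<open>E x y\<close> by (auto simp: \<iota>_def)
    next
      assume "\<exists>s. \<iota> x = ?ext s \<and> s \<in> \<iota> y"
      then obtain s where "\<iota> x = \<iota> (h s)" "E (h s) y" by (auto simp: \<iota>_def)
      then show "E x y" using inj_onD[OF inj] xy hS by metis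
    qed
  qed
  interpret class_theory_model ?ext ?Cls
  proof
    show "inj ?ext"
      using inj hS h by (auto simp: inj_def inj_on_def bij_betw_def)
    show "?ext x \<in> ?Cls" for x using hS by blast
    show "\<exists>X\<in>?Cls. x \<in> X" for x using hS(2)[of x] by (auto simp: \<iota>_def)
    fix p and e' :: "nat \<Rightarrow> nat set" assume p: "p \<in> Th_C" and e': "range e' \<subseteq> ?Cls"
    \<comment> \<open>Environments of the image are pulled back to D, where the axioms are known to
      hold.\<close>
    let ?e = "\<lambda>i. inv_into D \<iota> (e' i)"
    have e'_mem: "e' i \<in> ?Cls" for i using e' by (simp add: image_subset_iff)
    have "range ?e \<subseteq> D" using inv_into_into[OF e'_mem] by (simp add: image_subset_iff)
    moreover have "(\<lambda>i. \<iota> (?e i)) = e'" by (rule ext) (rule f_inv_into_f[OF e'_mem])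
    ultimately show "sem ?Cls (\<lambda>X Y. \<exists>s. X = ?ext s \<and> s \<in> Y) e' p"
      using iso[of ?e p] model[OF p] by simp
  qed
  have "sem ?Cls (\<lambda>X Y. \<exists>s. X = ?ext s \<and> s \<in> Y) (\<lambda>i. \<iota> (e i)) ?\<phi>"
    unfolding sat_sentence[of _ _ "\<lambda>_. {}"] by (rule V_satisfies_S)
  then show "sem D E e ?\<phi>" using iso[OF e] by simp
qed

end
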